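(* Let $\mathbb H$ be a graded affine Hecke algebra, let $\Pi_M\subset\Pi$, and let $(\sigma,U_\sigma)$ be a finite dimensional $\mathbb H_M$-module. Let $(\pi_\sigma^\bullet,X(M,\sigma)^h)$ be the $\bullet$-hermitian dual of the induced module $X(M,\sigma)=\mathbb H\otimes_{\mathbb H_M}U_\sigma$, and let $(\sigma^\bullet,U_\sigma^h)$ be the $\bullet$-hermitian dual of $\sigma$. Then the linear map $$\Phi:\ X(M,\sigma)^h\longrightarrow X(\delta(M),a\sigma^h)=\mathbb H\otimes_{\mathbb H_{\delta(M)}}U_{a\sigma^h},\qquad \Phi(t_x^h\otimes v^h)=t_{xw^0_M}\otimes a v^h\quad (x\in\mathcal J_M,\ v^h\in U_\sigma^h),$$ is an $\mathbb H$-equivariant isomorphism. Here $a\sigma^h$ is the $\mathbb H_{\delta(M)}$-module obtained by transferring $(\sigma^\bullet,U_\sigma^h)$ from $\mathbb H_M$ to $\mathbb H_{\delta(M)}$.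
   Context: Root data and algebra: $V,V^\vee$ are finite dimensional real vector spaces with a perfect pairing $(\ ,\ )$; $R\subset V\setminus\{0\}$, $R^\vee\subset V^\vee\setminus\{0\}$ form a reduced root system with bijection $\alpha\leftrightarrow\alpha^\vee$, $(\alpha,\alpha^\vee)=2$, reflections $s_\alpha$ and Weyl group $W$; $\Pi\subset R$ are simple roots, $R^+$ positive roots; $k:\Pi\to\mathbb R$ satisfies $k_\alpha=k_{\alpha'}$ whenever $\alpha,\alpha'$ are $W$-conjugate. $V_{\mathbb C}$ is the complexification of $V$, with complex conjugation $\bar{\ }$. The graded affine Hecke algebra $\mathbb H$ is the unital associative $\mathbb C$-algebra generated by $S(V_{\mathbb C})$ and $\{t_w:w\in W\}$ such that $w\otimes a\mapsto t_wa$ is an isomorphism $\mathbb C[W]\otimes S(V_{\mathbb C})\cong\mathbb H$ of $(\mathbb C[W],S(V_{\mathbb C}))$-bimodules and $a\,t_{s_\alpha}=t_{s_\alpha}s_\alpha(a)+k_\alpha\frac{a-s_\alpha(a)}{\alpha}$ for $\alpha\in\Pi$, $a\in S(V_{\mathbb C})$. The star operation $\bullet$ is the conjugate-linear anti-automorphism with $t_w^\bullet=t_{w^{-1}}$, $\omega^\bullet=\overline\omega$ for $\omega\in V_{\mathbb C}$. Parabolic subalgebras: for $\Pi_M\subset\Pi$, $W_M$ is the subgroup generated by $s_\alpha$, $\alpha\in\Pi_M$, with longest element $w_{0,M}$; $\mathbb H_M\subset\mathbb H$ is the subalgebra generated by $t_w$ ($w\in W_M$) and $S(V_{\mathbb C})$;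 $\bullet_M$ is the restriction of $\bullet$ to $\mathbb H_M$. $\mathcal J_M$ is the set of minimal length representatives of $W/W_M$. With $w_0$ the longest element of $W$, put $\delta(\alpha)=-w_0(\alpha)$, $\Pi_{\delta(M)}=\delta(\Pi_M)$, and $w^0_M=w_0w_{0,\delta(M)}=w_{0,M}w_0$. One has $xw_M^0\in\mathcal J_{\delta(M)}$ for $x\in\mathcal J_M$. Transfer: the map $\phi(t_m)=t_{(w^0_M)^{-1}mw^0_M}$ ($m\in W_M$), $\phi(\omega)=(w^0_M)^{-1}(\omega)$ ($\omega\in V_{\mathbb C}$) is an algebra isomorphism $\mathbb H_M\to\mathbb H_{\delta(M)}$. For an $\mathbb H_M$-module $(\tau,U_\tau)$, the $\mathbb H_{\delta(M)}$-module $(a\tau,U_{a\tau})$ is $U_{a\tau}=U_\tau$ with $(a\tau)(m')=\tau(\phi^{-1}(m'))$; the identity map $U_\tau\to U_{a\tau}$ is written $v\mapsto av$. Hermitian duals: for a finite dimensional module $(\pi,X)$, $X^h$ is the space of conjugate-linear functionals on $X$, with action $(\pi^\bullet(h)f)(x)=f(\pi(h^\bullet)x)$ (for $\mathbb H_M$ use $\bullet_M$). For $x\in\mathcal J_M$ and $v^h\in U_\sigma^h$, $t_x^h\otimes v^h\in X(M,\sigma)^h$ is the functional with $(t_x^h\otimes v^h)(t_y\otimes v)=\delta_{x,y}\,v^h(v)$ for $y\in\mathcal J_M$, $v\in U_\sigma$. *)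

theory Defs
  imports "HOL-Analysis.Analysis" "HOL-Library.Multiset" "HOL-Library.Poly_Mapping"
begin

section \<open>The symmetric algebra of a complexified real vector space\<close>

text \<open>The complexification of a real vector space \<open>V\<close> is \<open>V \<times> V\<close>, the pair \<open>(x, y)\<close> standing for
  \<open>x + iy\<close>.\<close>

definition cx_scale :: "complex \<Rightarrow> 'v::real_vector \<times> 'v \<Rightarrow> 'v \<times> 'v" where
  "cx_scale c z = (Re c *\<^sub>R fst z - Im c *\<^sub>R snd z, Re c *\<^sub>R snd z + Im c *\<^sub>R fst z)"

definition cx_cnj :: "'v::real_vector \<times> 'v \<Rightarrow> 'v \<times> 'v" where
  "cx_cnj z = (fst z, - snd z)"

definition cx_map :: "('v \<Rightarrow> 'v) \<Rightarrow> 'v \<times> 'v \<Rightarrow> 'v \<times> 'v" where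
  "cx_map f = map_prod f f"

text \<open>The symmetric algebra is the commutative polynomial ring over \<open>\<complex>\<close> with one variable for every
  vector of the complexification, modulo the ideal of the relations making the variables depend
  linearly on the vector. The monomials of the polynomial ring are the finite multisets of
  vectors.\<close>

type_synonym 'v vpoly = "('v \<times> 'v) multiset \<Rightarrow>\<^sub>0 complex"

definition vvar :: "'v \<times> 'v \<Rightarrow> 'v vpoly" where
  "vvar z = Poly_Mapping.single {#z#} 1"

definition vconst :: "complex \<Rightarrow> 'v vpoly" where
  "vconst c = Poly_Mapping.single {#} c"

inductive_set lin_ideal :: "'v::real_vector vpoly set" where
  zero: "0 \<in> lin_ideal"
| add: "p \<in> lin_ideal \<Longrightarrow> q \<in> lin_ideal \<Longrightarrow> p + q \<in> lin_ideal"
| mult: "p \<in> lin_ideal \<Longrightarrow> q * p \<in> lin_ideal"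
| rel_add: "vvar (y + z) - (vvar y + vvar z) \<in> lin_ideal"
| rel_scale: "vvar (cx_scale c z) - vconst c * vvar z \<in> lin_ideal"

definition lin_cong :: "'v::real_vector vpoly \<Rightarrow> 'v vpoly \<Rightarrow> bool" where
  "lin_cong p q \<longleftrightarrow> p - q \<in> lin_ideal"

lemma lin_ideal_uminus: "p \<in> lin_ideal \<Longrightarrow> - p \<in> lin_ideal"
  using lin_ideal.mult[of p "- 1"] by simp

lemma lin_ideal_diff: "p \<in> lin_ideal \<Longrightarrow> q \<in> lin_ideal \<Longrightarrow> p - q \<in> lin_ideal"
  using lin_ideal.add[of p "- q"] lin_ideal_uminus[of q] by simp

lemma equivp_lin_cong: "equivp (lin_cong :: 'a::real_vector vpoly \<Rightarrow> 'a vpoly \<Rightarrow> bool)"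
proof (rule equivpI)
  show "reflp (lin_cong :: 'a vpoly \<Rightarrow> _)"
    by (auto simp: reflp_def lin_cong_def lin_ideal.zero)
  show "symp (lin_cong :: 'a vpoly \<Rightarrow> _)"
    unfolding symp_def lin_cong_def by (metis lin_ideal_uminus minus_diff_eq)
  show "transp (lin_cong :: 'a vpoly \<Rightarrow> _)"
  proof (rule transpI)
    fix p q r :: "'a vpoly"
    assume "lin_cong p q" "lin_cong q r"
    then have "(p - q) + (q - r) \<in> lin_ideal"
      unfolding lin_cong_def by (rule lin_ideal.add)
    then show "lin_cong p r"
      by (simp add: lin_cong_def)
  qed
qed

lemma lookup_mult_empty:
  fixes p q :: "'a multiset \<Rightarrow>\<^sub>0 complex"
  shows "Poly_Mapping.lookup (q * p) {#} = Poly_Mapping.lookup q {#} * Poly_Mapping.lookup p {#}"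
proof -
  have 1: "Sum_any (\<lambda>m. Poly_Mapping.lookup p m when {#} = l + m) = (Poly_Mapping.lookup p {#} when l = {#})"
    for l :: "'a multiset"
  proof (cases "l = {#}")
    case True
    then have "(\<lambda>m. Poly_Mapping.lookup p m when {#} = l + m)
        = (\<lambda>m. Poly_Mapping.lookup p m when m = {#})"
      by (auto simp: fun_eq_iff when_def)
    with True show ?thesis by simp
  next
    case False
    then show ?thesis by (simp add: when_def)
  qed
  show ?thesis
    by (simp only: lookup_mult 1 mult_when Sum_any_when_equal)
qed

lemma lin_ideal_lookup_empty: "p \<in> lin_ideal \<Longrightarrow> Poly_Mapping.lookup p {#} = 0"
  by (induction rule: lin_ideal.induct)
     (auto simp: lookup_add lookup_minus lookup_mult_empty vvar_def vconst_def lookup_single)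

quotient_type (overloaded) 'v symalg = "'v::real_vector vpoly" / lin_cong
  by (rule equivp_lin_cong)

instantiation symalg :: (real_vector) comm_ring_1
begin

lift_definition zero_symalg :: "'a symalg" is 0 .
lift_definition one_symalg :: "'a symalg" is 1 .
lift_definition plus_symalg :: "'a symalg \<Rightarrow> 'a symalg \<Rightarrow> 'a symalg" is "(+)"
proof -
  fix p p' q q' :: "'a vpoly"
  assume "lin_cong p p'" "lin_cong q q'"
  then have "(p - p') + (q - q') \<in> lin_ideal"
    unfolding lin_cong_def by (rule lin_ideal.add)
  then show "lin_cong (p + q) (p' + q')"
    by (simp add: lin_cong_def algebra_simps)
qed
lift_definition minus_symalg :: "'a symalg \<Rightarrow> 'a symalg \<Rightarrow> 'a symalg" is "(-)"
proof -
  fix p p' q q' :: "'a vpoly"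
  assume "lin_cong p p'" "lin_cong q q'"
  then have "(p - p') - (q - q') \<in> lin_ideal"
    unfolding lin_cong_def by (rule lin_ideal_diff)
  then show "lin_cong (p - q) (p' - q')"
    by (simp add: lin_cong_def algebra_simps)
qed
lift_definition uminus_symalg :: "'a symalg \<Rightarrow> 'a symalg" is "uminus"
proof -
  fix p p' :: "'a vpoly"
  assume "lin_cong p p'"
  then have "- (p - p') \<in> lin_ideal"
    unfolding lin_cong_def by (rule lin_ideal_uminus)
  then show "lin_cong (- p) (- p')"
    by (simp add: lin_cong_def algebra_simps)
qed
lift_definition times_symalg :: "'a symalg \<Rightarrow> 'a symalg \<Rightarrow> 'a symalg" is "(*)"
proof -
  fix p p' q q' :: "'a vpoly"
  assume "lin_cong p p'" "lin_cong q q'"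
  then have "q * (p - p') + p' * (q - q') \<in> lin_ideal"
    unfolding lin_cong_def by (intro lin_ideal.add lin_ideal.mult)
  then show "lin_cong (p * q) (p' * q')"
    unfolding lin_cong_def by (simp add: algebra_simps)
qed

instance
proof
  have cong_refl: "lin_cong p p" for p :: "'a vpoly"
    by (simp add: lin_cong_def lin_ideal.zero)
  fix a b c :: "'a symalg"
  show "a + b + c = a + (b + c)" "a + b = b + a" "0 + a = a" "- a + a = 0" "a - b = a + - b"
    "a * b * c = a * (b * c)" "a * b = b * a" "1 * a = a" "(a + b) * c = a * c + b * c"
    by (transfer; simp add: algebra_simps cong_refl)+
  show "(0::'a symalg) \<noteq> 1"
    by transfer (auto simp: lin_cong_def lookup_minus dest: lin_ideal_lookup_empty)
qed

end

lift_definition sym_vec :: "'v::real_vector \<times> 'v \<Rightarrow> 'v symalg" is vvar .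

lift_definition sym_const :: "complex \<Rightarrow> 'v::real_vector symalg" is vconst .

definition vpoly_map :: "('v \<Rightarrow> 'v) \<Rightarrow> 'v vpoly \<Rightarrow> 'v vpoly" where
  "vpoly_map f p = (\<Sum>m\<in>Poly_Mapping.keys p.
     Poly_Mapping.single (image_mset (cx_map f) m) (Poly_Mapping.lookup p m))"

text \<open>The algebra endomorphism induced by a linear map \<open>f\<close>; for linear \<open>f\<close> the choice of the
  representative is immaterial, see \<open>sym_map_abs\<close> below.\<close>

definition sym_map :: "('v \<Rightarrow> 'v) \<Rightarrow> 'v::real_vector symalg \<Rightarrow> 'v symalg" where
  "sym_map f a = abs_symalg (vpoly_map f (rep_symalg a))"

lemma vpoly_map_superset:
  assumes "finite A" "Poly_Mapping.keys p \<subseteq> A"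
  shows "vpoly_map f p
    = (\<Sum>m\<in>A. Poly_Mapping.single (image_mset (cx_map f) m) (Poly_Mapping.lookup p m))"
  unfolding vpoly_map_def using assms
  by (intro sum.mono_neutral_left) (auto simp: in_keys_iff)

lemma vpoly_map_0: "vpoly_map f 0 = 0"
  by (simp add: vpoly_map_def)

lemma vpoly_map_single:
  "vpoly_map f (Poly_Mapping.single m c) = Poly_Mapping.single (image_mset (cx_map f) m) c"
  by (cases "c = 0") (simp_all add: vpoly_map_def)

lemma vpoly_map_add: "vpoly_map f (p + q) = vpoly_map f p + vpoly_map f q"
proof -
  let ?A = "Poly_Mapping.keys p \<union> Poly_Mapping.keys q"
  have "Poly_Mapping.keys (p + q) \<subseteq> ?A"
    by (rule Poly_Mapping.keys_add)
  then show ?thesis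
    by (simp add: vpoly_map_superset[of ?A] lookup_add single_add sum.distrib)
qed

lemma vpoly_map_diff: "vpoly_map f (p - q) = vpoly_map f p - vpoly_map f q"
  using vpoly_map_add[of f "p - q" q] by (simp add: algebra_simps)

lemma vpoly_decomp:
  "p = (\<Sum>m\<in>Poly_Mapping.keys p. Poly_Mapping.single m (Poly_Mapping.lookup p m))"
  by (rule poly_mapping_eqI) (simp add: lookup_sum lookup_single when_def in_keys_iff)

lemma vpoly_map_sum: "vpoly_map f (sum g A) = (\<Sum>i\<in>A. vpoly_map f (g i))"
  by (induction A rule: infinite_finite_induct) (simp_all add: vpoly_map_0 vpoly_map_add)

lemma vpoly_map_mult: "vpoly_map f (p * q) = vpoly_map f p * vpoly_map f q"
proof -
  let ?s = "\<lambda>p m. Poly_Mapping.single m (Poly_Mapping.lookup p m)"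
  have "p * q = (\<Sum>m\<in>Poly_Mapping.keys p. \<Sum>n\<in>Poly_Mapping.keys q. ?s p m * ?s q n)"
    by (simp only: vpoly_decomp[symmetric] sum_product[symmetric])
  then show ?thesis
    by (simp add: vpoly_map_sum mult_single vpoly_map_single)
       (simp add: vpoly_map_def sum_product mult_single)
qed

lemma vpoly_map_ideal:
  assumes "linear f" "p \<in> lin_ideal"
  shows "vpoly_map f p \<in> lin_ideal"
  using assms(2)
proof induction
  case zero
  then show ?case by (simp add: vpoly_map_0 lin_ideal.zero)
next
  case (add p q)
  then show ?case by (simp add: vpoly_map_add lin_ideal.add)
next
  case (mult p q)
  then show ?case by (simp add: vpoly_map_mult lin_ideal.mult)
next
  case (rel_add y z)
  have "vpoly_map f (vvar (y + z) - (vvar y + vvar z))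
      = vvar (cx_map f y + cx_map f z) - (vvar (cx_map f y) + vvar (cx_map f z))"
    using \<open>linear f\<close>
    by (cases y; cases z)
       (simp add: vpoly_map_diff vpoly_map_add vvar_def vpoly_map_single cx_map_def linear_add)
  then show ?case by (simp only: lin_ideal.rel_add)
next
  case (rel_scale c z)
  have "vpoly_map f (vvar (cx_scale c z) - vconst c * vvar z)
      = vvar (cx_scale c (cx_map f z)) - vconst c * vvar (cx_map f z)"
    using \<open>linear f\<close>
    by (cases z)
       (simp add: vpoly_map_diff vpoly_map_mult vconst_def vvar_def vpoly_map_single cx_map_def
          cx_scale_def linear_add linear_diff linear_scale)
  then show ?case by (simp only: lin_ideal.rel_scale)
qed

lemma sym_map_abs:
  assumes "linear f"
  shows "sym_map f (abs_symalg p) = abs_symalg (vpoly_map f p)"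
proof -
  have "lin_cong (rep_symalg (abs_symalg p)) p"
    by (metis Quotient3_symalg Quotient3_abs_rep symalg.abs_eq_iff)
  then have "lin_cong (vpoly_map f (rep_symalg (abs_symalg p))) (vpoly_map f p)"
    unfolding lin_cong_def by (metis assms vpoly_map_ideal vpoly_map_diff)
  then show ?thesis
    by (simp add: sym_map_def symalg.abs_eq_iff)
qed

lemma sym_map_hom:
  assumes "linear f"
  shows "sym_map f (a + b) = sym_map f a + sym_map f b"
    and "sym_map f (a * b) = sym_map f a * sym_map f b"
    and "sym_map f (sym_const c) = sym_const c"
    and "sym_map f (sym_vec z) = sym_vec (cx_map f z)"
proof -
  show "sym_map f (a + b) = sym_map f a + sym_map f b"
    by (induct a rule: symalg.abs_induct, induct b rule: symalg.abs_induct)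
       (simp add: plus_symalg.abs_eq sym_map_abs[OF assms] vpoly_map_add)
  show "sym_map f (a * b) = sym_map f a * sym_map f b"
    by (induct a rule: symalg.abs_induct, induct b rule: symalg.abs_induct)
       (simp add: times_symalg.abs_eq sym_map_abs[OF assms] vpoly_map_mult)
  show "sym_map f (sym_const c) = sym_const c"
    by (simp add: sym_const.abs_eq sym_map_abs[OF assms] vconst_def vpoly_map_single)
  show "sym_map f (sym_vec z) = sym_vec (cx_map f z)"
    by (simp add: sym_vec.abs_eq sym_map_abs[OF assms] vvar_def vpoly_map_single)
qed


section \<open>Root data and Weyl groups\<close>

text \<open>The set of coroots is the image of the roots under \<open>rd_coroot\<close>.\<close>

record ('v, 'w) root_data =
  rd_pair :: "'v \<Rightarrow> 'w \<Rightarrow> real"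
  rd_roots :: "'v set"
  rd_coroot :: "'v \<Rightarrow> 'w"
  rd_simple :: "'v set"

definition reflection :: "('v::real_vector, 'w) root_data \<Rightarrow> 'v \<Rightarrow> 'v \<Rightarrow> 'v" where
  "reflection D \<alpha> x = x - rd_pair D x (rd_coroot D \<alpha>) *\<^sub>R \<alpha>"

definition coreflection :: "('v, 'w::real_vector) root_data \<Rightarrow> 'v \<Rightarrow> 'w \<Rightarrow> 'w" where
  "coreflection D \<alpha> y = y - rd_pair D \<alpha> y *\<^sub>R rd_coroot D \<alpha>"

definition perfect_pairing :: "('v::real_vector \<Rightarrow> 'w::real_vector \<Rightarrow> real) \<Rightarrow> bool" where
  "perfect_pairing b \<longleftrightarrow> bilinear b
     \<and> bij_betw (\<lambda>x y. b x y) UNIV {f. linear f}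
     \<and> bij_betw (\<lambda>y x. b x y) UNIV {f. linear f}"

definition pos_roots :: "('v::real_vector, 'w) root_data \<Rightarrow> 'v set" where
  "pos_roots D = {\<beta> \<in> rd_roots D.
     \<exists>c. (\<forall>\<alpha>\<in>rd_simple D. 0 \<le> c \<alpha>) \<and> \<beta> = (\<Sum>\<alpha>\<in>rd_simple D. c \<alpha> *\<^sub>R \<alpha>)}"

text \<open>The roots need not span, and no integrality of the pairing is imposed.\<close>

definition reduced_root_data :: "('v::real_vector, 'w::real_vector) root_data \<Rightarrow> bool" where
  "reduced_root_data D \<longleftrightarrow>
     (\<exists>B::'v set. finite B \<and> span B = UNIV) \<and> (\<exists>B::'w set. finite B \<and> span B = UNIV)
     \<and> perfect_pairing (rd_pair D)
     \<and> finite (rd_roots D) \<and> 0 \<notin> rd_roots D \<and> 0 \<notin> rd_coroot D ` rd_roots D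
     \<and> inj_on (rd_coroot D) (rd_roots D)
     \<and> (\<forall>\<alpha>\<in>rd_roots D. rd_pair D \<alpha> (rd_coroot D \<alpha>) = 2)
     \<and> (\<forall>\<alpha>\<in>rd_roots D. reflection D \<alpha> ` rd_roots D = rd_roots D)
     \<and> (\<forall>\<alpha>\<in>rd_roots D.
          coreflection D \<alpha> ` rd_coroot D ` rd_roots D = rd_coroot D ` rd_roots D)
     \<and> (\<forall>\<alpha>\<in>rd_roots D. \<forall>c. c *\<^sub>R \<alpha> \<in> rd_roots D \<longrightarrow> c = 1 \<or> c = - 1)
     \<and> rd_simple D \<subseteq> rd_roots D \<and> independent (rd_simple D)
     \<and> (\<forall>\<beta>\<in>rd_roots D. \<beta> \<in> pos_roots D \<or> - \<beta> \<in> pos_roots D)"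

inductive_set generated_group :: "('a \<Rightarrow> 'a) set \<Rightarrow> ('a \<Rightarrow> 'a) set" for S where
  one: "id \<in> generated_group S"
| gen: "g \<in> S \<Longrightarrow> g \<in> generated_group S"
| mult: "g \<in> generated_group S \<Longrightarrow> h \<in> generated_group S \<Longrightarrow> g \<circ> h \<in> generated_group S"
| inverse: "g \<in> generated_group S \<Longrightarrow> inv g \<in> generated_group S"

definition weyl :: "('v::real_vector, 'w) root_data \<Rightarrow> ('v \<Rightarrow> 'v) set" where
  "weyl D = generated_group (reflection D ` rd_roots D)"

definition weyl_par :: "('v::real_vector, 'w) root_data \<Rightarrow> 'v set \<Rightarrow> ('v \<Rightarrow> 'v) set" where
  "weyl_par D M = generated_group (reflection D ` M)"

definition weyl_length :: "('v::real_vector, 'w) root_data \<Rightarrow> ('v \<Rightarrow> 'v) \<Rightarrow> nat" where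
  "weyl_length D w = (LEAST n. \<exists>\<alpha>s. length \<alpha>s = n \<and> set \<alpha>s \<subseteq> rd_simple D
     \<and> w = foldr (\<lambda>\<alpha> f. reflection D \<alpha> \<circ> f) \<alpha>s id)"

definition longest_in :: "('v::real_vector, 'w) root_data \<Rightarrow> ('v \<Rightarrow> 'v) set \<Rightarrow> 'v \<Rightarrow> 'v" where
  "longest_in D G = (THE w. w \<in> G \<and> (\<forall>u\<in>G. weyl_length D u \<le> weyl_length D w))"

definition w_long :: "('v::real_vector, 'w) root_data \<Rightarrow> 'v \<Rightarrow> 'v" where
  "w_long D = longest_in D (weyl D)"

definition w_long_par :: "('v::real_vector, 'w) root_data \<Rightarrow> 'v set \<Rightarrow> 'v \<Rightarrow> 'v" where
  "w_long_par D M = longest_in D (weyl_par D M)"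

definition min_reps :: "('v::real_vector, 'w) root_data \<Rightarrow> 'v set \<Rightarrow> ('v \<Rightarrow> 'v) set" where
  "min_reps D M = {x \<in> weyl D. \<forall>m\<in>weyl_par D M. weyl_length D x \<le> weyl_length D (x \<circ> m)}"

definition delta_par :: "('v::real_vector, 'w) root_data \<Rightarrow> 'v set \<Rightarrow> 'v set" where
  "delta_par D M = (\<lambda>\<alpha>. - w_long D \<alpha>) ` M"

definition w_transfer :: "('v::real_vector, 'w) root_data \<Rightarrow> 'v set \<Rightarrow> 'v \<Rightarrow> 'v" where
  "w_transfer D M = w_long D \<circ> w_long_par D (delta_par D M)"


section \<open>Graded affine Hecke algebras\<close>

text \<open>The underlying ring is a type of class \<open>ring_1\<close>; the record holds its complex scalar
  multiplication, the elements \<open>t\<^sub>w\<close> and the inclusion of the symmetric algebra.\<close>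

record (overloaded) ('v, 'h) hecke_data =
  ha_scale :: "complex \<Rightarrow> 'h \<Rightarrow> 'h"
  ha_t :: "('v \<Rightarrow> 'v) \<Rightarrow> 'h"
  ha_inc :: "'v symalg \<Rightarrow> 'h"

definition parameter_function :: "('v::real_vector, 'w) root_data \<Rightarrow> ('v \<Rightarrow> real) \<Rightarrow> bool" where
  "parameter_function D k \<longleftrightarrow>
     (\<forall>\<alpha>\<in>rd_simple D. \<forall>\<beta>\<in>rd_simple D. (\<exists>w\<in>weyl D. w \<alpha> = \<beta>) \<longrightarrow> k \<alpha> = k \<beta>)"

text \<open>An element of \<open>\<complex>[W] \<otimes> S(V\<^sub>\<complex>)\<close> is written uniquely as \<open>\<Sum>w. w \<otimes> c w\<close>, so this space is
  identified with the functions \<open>c\<close> vanishing outside of \<open>W\<close>. The map \<open>w \<otimes> a \<mapsto> t\<^sub>w a\<close> is then one of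
  bimodules because \<open>t\<close> and the inclusion are multiplicative. In the commutation relation \<open>q\<close> is
  the quotient \<open>(a - s\<^sub>\<alpha> a) / \<alpha>\<close>.\<close>

definition graded_hecke_algebra ::
  "('v::real_vector, 'w) root_data \<Rightarrow> ('v \<Rightarrow> real) \<Rightarrow> ('v, 'h::ring_1) hecke_data \<Rightarrow> bool" where
  "graded_hecke_algebra D k H \<longleftrightarrow>
     vector_space (ha_scale H)
     \<and> (\<forall>c x y. ha_scale H c x * y = ha_scale H c (x * y) \<and> x * ha_scale H c y = ha_scale H c (x * y))
     \<and> ha_t H id = 1
     \<and> (\<forall>u\<in>weyl D. \<forall>w\<in>weyl D. ha_t H (u \<circ> w) = ha_t H u * ha_t H w)
     \<and> ha_inc H 1 = 1
     \<and> (\<forall>a b. ha_inc H (a + b) = ha_inc H a + ha_inc H b)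
     \<and> (\<forall>a b. ha_inc H (a * b) = ha_inc H a * ha_inc H b)
     \<and> (\<forall>c a. ha_inc H (sym_const c * a) = ha_scale H c (ha_inc H a))
     \<and> bij_betw (\<lambda>c. \<Sum>w\<in>weyl D. ha_t H w * ha_inc H (c w)) {c. \<forall>w. w \<notin> weyl D \<longrightarrow> c w = 0} UNIV
     \<and> (\<forall>\<alpha>\<in>rd_simple D. \<forall>a q. sym_vec (\<alpha>, 0) * q = a - sym_map (reflection D \<alpha>) a \<longrightarrow>
          ha_inc H a * ha_t H (reflection D \<alpha>)
            = ha_t H (reflection D \<alpha>) * ha_inc H (sym_map (reflection D \<alpha>) a)
              + ha_scale H (complex_of_real (k \<alpha>)) (ha_inc H q))"

definition is_star ::
  "('v::real_vector, 'w) root_data \<Rightarrow> ('v, 'h::ring_1) hecke_data \<Rightarrow> ('h \<Rightarrow> 'h) \<Rightarrow> bool" where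
  "is_star D H s \<longleftrightarrow> bij s
     \<and> (\<forall>x y. s (x + y) = s x + s y)
     \<and> (\<forall>c x. s (ha_scale H c x) = ha_scale H (cnj c) (s x))
     \<and> (\<forall>x y. s (x * y) = s y * s x)
     \<and> (\<forall>w\<in>weyl D. s (ha_t H w) = ha_t H (inv w))
     \<and> (\<forall>z. s (ha_inc H (sym_vec z)) = ha_inc H (sym_vec (cx_cnj z)))"

definition hecke_star ::
  "('v::real_vector, 'w) root_data \<Rightarrow> ('v, 'h::ring_1) hecke_data \<Rightarrow> 'h \<Rightarrow> 'h" where
  "hecke_star D H = (THE s. is_star D H s)"

inductive_set generated_algebra :: "(complex \<Rightarrow> 'h \<Rightarrow> 'h) \<Rightarrow> 'h::ring_1 set \<Rightarrow> 'h set"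
  for sc S where
  one: "1 \<in> generated_algebra sc S"
| gen: "x \<in> S \<Longrightarrow> x \<in> generated_algebra sc S"
| add: "x \<in> generated_algebra sc S \<Longrightarrow> y \<in> generated_algebra sc S
    \<Longrightarrow> x + y \<in> generated_algebra sc S"
| mult: "x \<in> generated_algebra sc S \<Longrightarrow> y \<in> generated_algebra sc S
    \<Longrightarrow> x * y \<in> generated_algebra sc S"
| scale: "x \<in> generated_algebra sc S \<Longrightarrow> sc c x \<in> generated_algebra sc S"

definition hecke_par ::
  "('v::real_vector, 'w) root_data \<Rightarrow> ('v, 'h::ring_1) hecke_data \<Rightarrow> 'v set \<Rightarrow> 'h set" where
  "hecke_par D H M = generated_algebra (ha_scale H) (ha_t H ` weyl_par D M \<union> range (ha_inc H))"

definition is_transfer :: "('v::real_vector, 'w) root_data \<Rightarrow> ('v, 'h::ring_1) hecke_data \<Rightarrow> 'v set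
    \<Rightarrow> ('h \<Rightarrow> 'h) \<Rightarrow> bool" where
  "is_transfer D H M \<phi> \<longleftrightarrow>
     \<phi> \<in> extensional (hecke_par D H M)
     \<and> bij_betw \<phi> (hecke_par D H M) (hecke_par D H (delta_par D M))
     \<and> \<phi> 1 = 1
     \<and> (\<forall>x\<in>hecke_par D H M. \<forall>y\<in>hecke_par D H M. \<phi> (x + y) = \<phi> x + \<phi> y \<and> \<phi> (x * y) = \<phi> x * \<phi> y)
     \<and> (\<forall>c. \<forall>x\<in>hecke_par D H M. \<phi> (ha_scale H c x) = ha_scale H c (\<phi> x))
     \<and> (\<forall>m\<in>weyl_par D M. \<phi> (ha_t H m) = ha_t H (inv (w_transfer D M) \<circ> m \<circ> w_transfer D M))
     \<and> (\<forall>z. \<phi> (ha_inc H (sym_vec z)) = ha_inc H (sym_vec (cx_map (inv (w_transfer D M)) z)))"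

definition transfer_iso :: "('v::real_vector, 'w) root_data \<Rightarrow> ('v, 'h::ring_1) hecke_data \<Rightarrow> 'v set
    \<Rightarrow> 'h \<Rightarrow> 'h" where
  "transfer_iso D H M = (THE \<phi>. is_transfer D H M \<phi>)"


section \<open>Modules\<close>

record ('h, 'x) hmodule =
  hm_carrier :: "'x set"
  hm_zero :: 'x
  hm_add :: "'x \<Rightarrow> 'x \<Rightarrow> 'x"
  hm_scale :: "complex \<Rightarrow> 'x \<Rightarrow> 'x"
  hm_act :: "'h \<Rightarrow> 'x \<Rightarrow> 'x"

definition complex_space :: "('h, 'x) hmodule \<Rightarrow> bool" where
  "complex_space X \<longleftrightarrow>
     hm_zero X \<in> hm_carrier X
     \<and> (\<forall>x\<in>hm_carrier X. \<forall>y\<in>hm_carrier X. hm_add X x y \<in> hm_carrier X)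
     \<and> (\<forall>c. \<forall>x\<in>hm_carrier X. hm_scale X c x \<in> hm_carrier X)
     \<and> (\<forall>x\<in>hm_carrier X. \<forall>y\<in>hm_carrier X. \<forall>z\<in>hm_carrier X.
          hm_add X (hm_add X x y) z = hm_add X x (hm_add X y z))
     \<and> (\<forall>x\<in>hm_carrier X. \<forall>y\<in>hm_carrier X. hm_add X x y = hm_add X y x)
     \<and> (\<forall>x\<in>hm_carrier X. hm_add X (hm_zero X) x = x)
     \<and> (\<forall>x\<in>hm_carrier X. \<exists>y\<in>hm_carrier X. hm_add X x y = hm_zero X)
     \<and> (\<forall>c. \<forall>x\<in>hm_carrier X. \<forall>y\<in>hm_carrier X.
          hm_scale X c (hm_add X x y) = hm_add X (hm_scale X c x) (hm_scale X c y))
     \<and> (\<forall>c d. \<forall>x\<in>hm_carrier X. hm_scale X (c + d) x = hm_add X (hm_scale X c x) (hm_scale X d x))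
     \<and> (\<forall>c d. \<forall>x\<in>hm_carrier X. hm_scale X (c * d) x = hm_scale X c (hm_scale X d x))
     \<and> (\<forall>x\<in>hm_carrier X. hm_scale X 1 x = x)"

definition linear_between :: "('h, 'x) hmodule \<Rightarrow> ('h, 'y) hmodule \<Rightarrow> ('x \<Rightarrow> 'y) \<Rightarrow> bool" where
  "linear_between X Y f \<longleftrightarrow>
     (\<forall>x\<in>hm_carrier X. f x \<in> hm_carrier Y)
     \<and> (\<forall>x\<in>hm_carrier X. \<forall>y\<in>hm_carrier X. f (hm_add X x y) = hm_add Y (f x) (f y))
     \<and> (\<forall>c. \<forall>x\<in>hm_carrier X. f (hm_scale X c x) = hm_scale Y c (f x))"

text \<open>\<open>X\<close> is a module over the subalgebra \<open>A\<close>, where \<open>sc\<close> is the complex scalar multiplication of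
  the ambient algebra.\<close>

definition module_over :: "(complex \<Rightarrow> 'h \<Rightarrow> 'h) \<Rightarrow> 'h::ring_1 set \<Rightarrow> ('h, 'x) hmodule \<Rightarrow> bool" where
  "module_over sc A X \<longleftrightarrow> complex_space X
     \<and> (\<forall>h\<in>A. linear_between X X (hm_act X h))
     \<and> (\<forall>x\<in>hm_carrier X. hm_act X 1 x = x)
     \<and> (\<forall>g\<in>A. \<forall>h\<in>A. \<forall>x\<in>hm_carrier X. hm_act X (g + h) x = hm_add X (hm_act X g x) (hm_act X h x))
     \<and> (\<forall>g\<in>A. \<forall>h\<in>A. \<forall>x\<in>hm_carrier X. hm_act X (g * h) x = hm_act X g (hm_act X h x))
     \<and> (\<forall>c. \<forall>h\<in>A. \<forall>x\<in>hm_carrier X. hm_act X (sc c h) x = hm_scale X c (hm_act X h x))"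

inductive_set hm_span :: "('h, 'x) hmodule \<Rightarrow> 'x set \<Rightarrow> 'x set" for X B where
  zero: "hm_zero X \<in> hm_span X B"
| gen: "b \<in> B \<Longrightarrow> b \<in> hm_span X B"
| add: "x \<in> hm_span X B \<Longrightarrow> y \<in> hm_span X B \<Longrightarrow> hm_add X x y \<in> hm_span X B"
| scale: "x \<in> hm_span X B \<Longrightarrow> hm_scale X c x \<in> hm_span X B"

definition finite_dimensional :: "('h, 'x) hmodule \<Rightarrow> bool" where
  "finite_dimensional X \<longleftrightarrow> (\<exists>B\<subseteq>hm_carrier X. finite B \<and> hm_span X B = hm_carrier X)"

text \<open>Conjugate-linear functionals are represented by functions that are \<open>undefined\<close> outside of the
  carrier; without this, functionals that agree on the carrier could be different.\<close>

definition herm_dual :: "('h \<Rightarrow> 'h) \<Rightarrow> ('h, 'x) hmodule \<Rightarrow> ('h, 'x \<Rightarrow> complex) hmodule" where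
  "herm_dual s X = \<lparr>
     hm_carrier = {f \<in> extensional (hm_carrier X).
       (\<forall>x\<in>hm_carrier X. \<forall>y\<in>hm_carrier X. f (hm_add X x y) = f x + f y)
       \<and> (\<forall>c. \<forall>x\<in>hm_carrier X. f (hm_scale X c x) = cnj c * f x)},
     hm_zero = (\<lambda>x\<in>hm_carrier X. 0),
     hm_add = (\<lambda>f g. \<lambda>x\<in>hm_carrier X. f x + g x),
     hm_scale = (\<lambda>c f. \<lambda>x\<in>hm_carrier X. c * f x),
     hm_act = (\<lambda>h f. \<lambda>x\<in>hm_carrier X. f (hm_act X (s h) x))\<rparr>"

text \<open>The tensor product \<open>H \<otimes>\<^sub>A U\<close> is the free abelian group on \<open>H \<times> U\<close> modulo the subgroup of the
  relations of a balanced biadditive map; its elements are cosets.\<close>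

inductive_set tensor_rels :: "'h::ring_1 set \<Rightarrow> ('h, 'u) hmodule \<Rightarrow> ('h \<times> 'u \<Rightarrow>\<^sub>0 int) set"
  for A U where
  zero: "0 \<in> tensor_rels A U"
| diff: "p \<in> tensor_rels A U \<Longrightarrow> q \<in> tensor_rels A U \<Longrightarrow> p - q \<in> tensor_rels A U"
| add_left: "u \<in> hm_carrier U \<Longrightarrow>
    frag_of (g + h, u) - (frag_of (g, u) + frag_of (h, u)) \<in> tensor_rels A U"
| add_right: "u \<in> hm_carrier U \<Longrightarrow> v \<in> hm_carrier U \<Longrightarrow>
    frag_of (h, hm_add U u v) - (frag_of (h, u) + frag_of (h, v)) \<in> tensor_rels A U"
| balanced: "u \<in> hm_carrier U \<Longrightarrow> m \<in> A \<Longrightarrow>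
    frag_of (h * m, u) - frag_of (h, hm_act U m u) \<in> tensor_rels A U"

definition tensor_class ::
  "'h::ring_1 set \<Rightarrow> ('h, 'u) hmodule \<Rightarrow> ('h \<times> 'u \<Rightarrow>\<^sub>0 int) \<Rightarrow> ('h \<times> 'u \<Rightarrow>\<^sub>0 int) set" where
  "tensor_class A U p = {q. q - p \<in> tensor_rels A U}"

definition tensor ::
  "'h::ring_1 set \<Rightarrow> ('h, 'u) hmodule \<Rightarrow> 'h \<Rightarrow> 'u \<Rightarrow> ('h \<times> 'u \<Rightarrow>\<^sub>0 int) set" where
  "tensor A U h u = tensor_class A U (frag_of (h, u))"

definition left_mult :: "'h::ring_1 \<Rightarrow> ('h \<times> 'u \<Rightarrow>\<^sub>0 int) \<Rightarrow> ('h \<times> 'u \<Rightarrow>\<^sub>0 int)" where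
  "left_mult h = frag_extend (\<lambda>(g, u). frag_of (h * g, u))"

text \<open>The operations on cosets are written without choosing representatives: for instance
  \<open>h \<cdot> P\<close> is the union of the classes of \<open>h \<cdot> p\<close> for \<open>p \<in> P\<close>, all of which coincide. A complex
  number \<open>c\<close> acts as the element \<open>c \<cdot> 1\<close> of the algebra.\<close>

definition tensor_act :: "'h::ring_1 set \<Rightarrow> ('h, 'u) hmodule \<Rightarrow> 'h
    \<Rightarrow> ('h \<times> 'u \<Rightarrow>\<^sub>0 int) set \<Rightarrow> ('h \<times> 'u \<Rightarrow>\<^sub>0 int) set" where
  "tensor_act A U h P = (\<Union>p\<in>P. tensor_class A U (left_mult h p))"

definition induced :: "(complex \<Rightarrow> 'h \<Rightarrow> 'h) \<Rightarrow> 'h::ring_1 set \<Rightarrow> ('h, 'u) hmodule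
    \<Rightarrow> ('h, ('h \<times> 'u \<Rightarrow>\<^sub>0 int) set) hmodule" where
  "induced sc A U = \<lparr>
     hm_carrier = tensor_class A U ` {p. Poly_Mapping.keys p \<subseteq> UNIV \<times> hm_carrier U},
     hm_zero = tensor_class A U 0,
     hm_add = (\<lambda>P Q. \<Union>p\<in>P. \<Union>q\<in>Q. tensor_class A U (p + q)),
     hm_scale = (\<lambda>c. tensor_act A U (sc c 1)),
     hm_act = tensor_act A U\<rparr>"

definition transfer_module :: "('v::real_vector, 'w) root_data \<Rightarrow> ('v, 'h::ring_1) hecke_data
    \<Rightarrow> 'v set \<Rightarrow> ('h, 'u) hmodule \<Rightarrow> ('h, 'u) hmodule" where
  "transfer_module D H M U =
     U\<lparr>hm_act := (\<lambda>m. hm_act U (inv_into (hecke_par D H M) (transfer_iso D H M) m))\<rparr>"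

definition ind_module :: "('v::real_vector, 'w) root_data \<Rightarrow> ('v, 'h::ring_1) hecke_data
    \<Rightarrow> 'v set \<Rightarrow> ('h, 'u) hmodule \<Rightarrow> ('h, ('h \<times> 'u \<Rightarrow>\<^sub>0 int) set) hmodule" where
  "ind_module D H M U = induced (ha_scale H) (hecke_par D H M) U"

text \<open>The functional \<open>t\<^sub>x\<^sup>h \<otimes> v\<^sup>h\<close>.\<close>

definition dual_tensor :: "('v::real_vector, 'w) root_data \<Rightarrow> ('v, 'h::ring_1) hecke_data
    \<Rightarrow> 'v set \<Rightarrow> ('h, 'u) hmodule \<Rightarrow> ('v \<Rightarrow> 'v) \<Rightarrow> ('u \<Rightarrow> complex)
    \<Rightarrow> ('h \<times> 'u \<Rightarrow>\<^sub>0 int) set \<Rightarrow> complex" where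
  "dual_tensor D H M U x f = (THE F.
     F \<in> hm_carrier (herm_dual (hecke_star D H) (ind_module D H M U))
     \<and> (\<forall>y\<in>min_reps D M. \<forall>v\<in>hm_carrier U.
          F (tensor (hecke_par D H M) U (ha_t H y) v) = (if x = y then f v else 0)))"

definition equivariant_iso ::
  "'h set \<Rightarrow> ('h, 'x) hmodule \<Rightarrow> ('h, 'y) hmodule \<Rightarrow> ('x \<Rightarrow> 'y) \<Rightarrow> bool" where
  "equivariant_iso A X Y f \<longleftrightarrow> linear_between X Y f
     \<and> bij_betw f (hm_carrier X) (hm_carrier Y)
     \<and> (\<forall>h\<in>A. \<forall>x\<in>hm_carrier X. f (hm_act X h x) = hm_act Y h (f x))"

definition is_Phi :: "('v::real_vector, 'w) root_data \<Rightarrow> ('v, 'h::ring_1) hecke_data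
    \<Rightarrow> 'v set \<Rightarrow> ('h, 'u) hmodule
    \<Rightarrow> ((('h \<times> 'u \<Rightarrow>\<^sub>0 int) set \<Rightarrow> complex) \<Rightarrow> ('h \<times> ('u \<Rightarrow> complex) \<Rightarrow>\<^sub>0 int) set) \<Rightarrow> bool" where
  "is_Phi D H M \<sigma> \<Phi> \<longleftrightarrow>
     (let a\<sigma>h = transfer_module D H M (herm_dual (hecke_star D H) \<sigma>)
      in linear_between (herm_dual (hecke_star D H) (ind_module D H M \<sigma>))
           (ind_module D H (delta_par D M) a\<sigma>h) \<Phi>
         \<and> (\<forall>x\<in>min_reps D M. \<forall>f\<in>hm_carrier (herm_dual (hecke_star D H) \<sigma>).
              \<Phi> (dual_tensor D H M \<sigma> x f)
                = tensor (hecke_par D H (delta_par D M)) a\<sigma>h (ha_t H (x \<circ> w_transfer D M)) f))"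

end

theory Submission
  imports Defs
begin

text \<open>
  Write \<open>X\<close> for the induced module, \<open>w\<close> for \<open>w_transfer D M\<close>, \<open>J\<close> for the minimal coset
  representatives of \<open>W / W\<^sub>M\<close>, and \<open>proj M\<close> for the projection of the Hecke algebra onto its
  parabolic subalgebra that forgets the terms \<open>t\<^sub>u a\<close> with \<open>u\<close> outside of \<open>W\<^sub>M\<close>. The Hecke
  algebra is free as a right module over the parabolic subalgebra, with basis \<open>t\<^sub>x\<close>, \<open>x \<in> J\<close>, and
  the coordinate of \<open>h\<close> at \<open>x\<close> is \<open>proj M (t\<^sub>x\<^sup>-\<^sup>1 h)\<close>. Hence \<open>t\<^sub>x\<^sup>h \<otimes> f\<close> is the functional
  \<open>h \<otimes> u \<mapsto> f (proj M (t\<^sub>x\<^sup>-\<^sup>1 h) u)\<close>, and both sides of the asserted isomorphism are direct sums of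
  copies of the dual of \<open>U\<close>, indexed by \<open>J\<close> and by \<open>J w\<close>. Bijectivity of \<open>\<Phi>\<close> is this
  bookkeeping; the content is equivariance.

  Equivariance rests on one identity in the Hecke algebra (\<open>proj_twist\<close>):
  \<open>proj M (t\<^sub>w \<phi>(m) h) = m proj M (t\<^sub>w h)\<close> for \<open>m\<close> in the parabolic subalgebra, where \<open>\<phi>\<close> is the
  transfer isomorphism. It makes the Hecke algebra a twisted Frobenius extension of the
  parabolic subalgebra, and coinduction then agrees with induction from the twisted subalgebra. For
  \<open>m\<close> in the group algebra the identity is formal. For \<open>m\<close> in the symmetric algebra one moves
  \<open>\<phi>(m)\<close> past \<open>t\<^sub>y\<close>, \<open>y \<in> J\<close>, which creates an error made of elements \<open>t\<^sub>v\<close> shorter than \<open>t\<^sub>y\<close>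
  (\<open>I_T_triangular\<close>). The projection \<open>proj M (t\<^sub>w \<cdot>)\<close> only sees \<open>v \<in> w\<^sup>-\<^sup>1 W\<^sub>M\<close>, and these are at
  least as long as any element of \<open>J\<close> (\<open>w_transfer_coset_long\<close>), because they invert every positive
  root outside of the subsystem of \<open>M\<close> while an element of \<open>J\<close> inverts no other root. So the error
  disappears.

  Put \<open>G f = t\<^sub>y\<^sup>h \<otimes> f\<close> for the longest representative \<open>y = w\<^sup>-\<^sup>1\<close>. The identity says that
  \<open>f \<mapsto> G f\<close> intertwines the transferred dual with the restriction of the dual of \<open>X\<close>
  (\<open>dual_at_equivariant\<close>), and directly from the definition \<open>t\<^sub>x\<^sub>w \<cdot> G f = t\<^sub>x\<^sup>h \<otimes> f\<close>
  (\<open>dual_at_translate\<close>). Together these give \<open>\<Phi> (g \<cdot> G f) = g \<otimes> f\<close> for every \<open>g\<close>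
  (\<open>Phi_generated\<close>), which is equivariance, since the \<open>G f\<close> generate.

  The root system theory behind this is developed from the axioms: coroots are moved along by
  reflections because a transvection of infinite order cannot preserve the finite set of roots
  (\<open>coroot_refl\<close>), and the length is the number of inversions by the exchange property. The star
  operation and the transfer isomorphism are definite descriptions, so their existence and
  uniqueness are proved as well; both are constructed on the basis \<open>t\<^sub>u a\<close> and checked to be
  multiplicative on generators only.
\<close>

section \<open>Root systems\<close>

locale root_datum =
  fixes D :: "('v::real_vector, 'w::real_vector) root_data"
  assumes rrd: "reduced_root_data D"
begin

abbreviation "R \<equiv> rd_roots D"
abbreviation "co \<equiv> rd_coroot D"
abbreviation "pair \<equiv> rd_pair D"
abbreviation "S \<equiv> rd_simple D"
abbreviation "P \<equiv> pos_roots D"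
abbreviation "srefl \<equiv> reflection D"
abbreviation "corefl \<equiv> coreflection D"
abbreviation "W \<equiv> weyl D"

lemma bilinear_pair: "bilinear pair"
  and finite_roots: "finite R"
  and zero_not_root: "0 \<notin> R"
  and inj_co: "inj_on co R"
  and pair_co: "\<alpha> \<in> R \<Longrightarrow> pair \<alpha> (co \<alpha>) = 2"
  and refl_roots: "\<alpha> \<in> R \<Longrightarrow> srefl \<alpha> ` R = R"
  and corefl_coroots: "\<alpha> \<in> R \<Longrightarrow> corefl \<alpha> ` co ` R = co ` R"
  and reduced: "\<alpha> \<in> R \<Longrightarrow> c *\<^sub>R \<alpha> \<in> R \<Longrightarrow> c = 1 \<or> c = - 1"
  and simple_roots: "S \<subseteq> R"
  and indep_simple: "independent S"
  and pos_or_neg: "\<beta> \<in> R \<Longrightarrow> \<beta> \<in> P \<or> - \<beta> \<in> P"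
  using rrd unfolding reduced_root_data_def perfect_pairing_def by auto

lemma linear_pair_left: "linear (\<lambda>x. pair x y)"
  and linear_pair_right: "linear (\<lambda>y. pair x y)"
  using bilinear_pair by (auto simp: bilinear_def)

lemma pair_simps:
  "pair (x + x') y = pair x y + pair x' y" "pair (x - x') y = pair x y - pair x' y"
  "pair (c *\<^sub>R x) y = c * pair x y" "pair (- x) y = - pair x y"
  "pair x (y + y') = pair x y + pair x y'" "pair x (y - y') = pair x y - pair x y'"
  "pair x (c *\<^sub>R y) = c * pair x y" "pair x (- y) = - pair x y" "pair 0 y = 0" "pair x 0 = 0"
  by (simp_all add: linear_add[OF linear_pair_left] linear_diff[OF linear_pair_left]
      linear_scale[OF linear_pair_left] linear_neg[OF linear_pair_left] linear_0[OF linear_pair_left]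
      linear_add[OF linear_pair_right] linear_diff[OF linear_pair_right]
      linear_scale[OF linear_pair_right] linear_neg[OF linear_pair_right] linear_0[OF linear_pair_right])

lemma linear_refl: "linear (srefl \<alpha>)"
  by (rule linearI) (simp_all add: reflection_def pair_simps algebra_simps)

lemma refl_refl: "\<alpha> \<in> R \<Longrightarrow> srefl \<alpha> (srefl \<alpha> x) = x"
  using pair_co by (simp add: reflection_def pair_simps algebra_simps scaleR_left_distrib[symmetric])

lemma refl_comp_refl: "\<alpha> \<in> R \<Longrightarrow> srefl \<alpha> \<circ> srefl \<alpha> = id"
  by (simp add: fun_eq_iff refl_refl)

lemma refl_self: "\<alpha> \<in> R \<Longrightarrow> srefl \<alpha> \<alpha> = - \<alpha>"
  using pair_co by (simp add: reflection_def scaleR_2)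

lemma refl_root: "\<alpha> \<in> R \<Longrightarrow> \<beta> \<in> R \<Longrightarrow> srefl \<alpha> \<beta> \<in> R"
  using refl_roots by blast

lemma uminus_root: "\<alpha> \<in> R \<Longrightarrow> - \<alpha> \<in> R"
  using refl_root[of \<alpha> \<alpha>] refl_self by simp

lemma pair_refl: "pair (srefl \<alpha> x) y = pair x (corefl \<alpha> y)"
  by (simp add: reflection_def coreflection_def pair_simps)

lemma corefl_corefl: "\<alpha> \<in> R \<Longrightarrow> corefl \<alpha> (corefl \<alpha> x) = x"
  using pair_co by (simp add: coreflection_def pair_simps algebra_simps scaleR_left_distrib[symmetric])

text \<open>Iterating \<open>x \<mapsto> x + f x a\<close> moves \<open>x\<close> along the line with direction \<open>a\<close> in steps of \<open>f x\<close>; a finite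
  set can only be stable if the steps vanish. This replaces the usual appeal to an invariant scalar
  product on the span of the roots.\<close>

lemma transvection_trivial:
  assumes "linear f" "f a = 0" "a \<noteq> 0" and stable: "\<And>x. x \<in> R \<Longrightarrow> x + f x *\<^sub>R a \<in> R" and "x \<in> R"
  shows "f x = 0"
proof (rule ccontr)
  assume nz: "f x \<noteq> 0"
  have f: "f (x + c *\<^sub>R a) = f x" for c
    using assms(1,2) by (simp add: linear_add linear_scale)
  have "x + (real n * f x) *\<^sub>R a \<in> R" for n
  proof (induction n)
    case (Suc n)
    then show ?case using stable[OF Suc] by (simp add: f algebra_simps scaleR_left_distrib)
  qed (simp add: \<open>x \<in> R\<close>)
  then have "range (\<lambda>n. x + (real n * f x) *\<^sub>R a) \<subseteq> R" by auto
  moreover have "inj (\<lambda>n. x + (real n * f x) *\<^sub>R a)"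
    using nz \<open>a \<noteq> 0\<close> by (auto simp: inj_def)
  ultimately show False
    using finite_roots finite_subset range_inj_infinite by blast
qed

text \<open>If the two coroots restrict to the same functional, the product of the two reflections is a
  transvection along \<open>\<gamma> - \<delta>\<close>.\<close>

lemma coroot_determined_on_roots:
  assumes "\<gamma> \<in> R" "\<delta> \<in> R" and eq: "\<And>x. x \<in> R \<Longrightarrow> pair x (co \<gamma>) = pair x (co \<delta>)"
  shows "\<gamma> = \<delta>"
proof (rule ccontr)
  assume "\<gamma> \<noteq> \<delta>"
  have "pair \<gamma> (co \<gamma>) = 0"
  proof (rule transvection_trivial[where a = "\<gamma> - \<delta>" and f = "\<lambda>x. pair x (co \<gamma>)" and x = \<gamma>])
    show "linear (\<lambda>x. pair x (co \<gamma>))" by (rule linear_pair_left)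
    show "pair (\<gamma> - \<delta>) (co \<gamma>) = 0"
      using eq[of \<delta>] assms(1,2) pair_co by (simp add: pair_simps)
    show "\<gamma> - \<delta> \<noteq> 0" using \<open>\<gamma> \<noteq> \<delta>\<close> by simp
    show "\<gamma> \<in> R" by fact
    fix x assume "x \<in> R"
    then have "srefl \<gamma> (srefl \<delta> x) \<in> R" using assms by (intro refl_root)
    moreover have "srefl \<gamma> (srefl \<delta> x) = x + pair x (co \<gamma>) *\<^sub>R (\<gamma> - \<delta>)"
      using eq[of \<delta>] eq[OF \<open>x \<in> R\<close>] assms(1,2) pair_co
      by (simp add: reflection_def pair_simps algebra_simps scaleR_2 scaleR_left_distrib[symmetric])
    ultimately show "x + pair x (co \<gamma>) *\<^sub>R (\<gamma> - \<delta>) \<in> R" by simp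
  qed
  then show False using pair_co[OF \<open>\<gamma> \<in> R\<close>] by simp
qed

text \<open>The right-hand side is the coroot of some root \<open>\<delta>\<close>. On the roots, \<open>s\<^sub>\<alpha> s\<^sub>\<beta> s\<^sub>\<alpha>\<close> is the
  reflection along \<open>s\<^sub>\<alpha> \<beta>\<close> with functional \<open>co \<delta>\<close>, so composing it with the reflection of the root
  \<open>s\<^sub>\<alpha> \<beta>\<close> gives a transvection and the two functionals agree on the roots. The point is that this
  determines \<open>\<delta>\<close>, although the roots may fail to span.\<close>

lemma coroot_refl:
  assumes "\<alpha> \<in> R" "\<beta> \<in> R"
  shows "co (srefl \<alpha> \<beta>) = corefl \<alpha> (co \<beta>)"
proof -
  let ?a = "srefl \<alpha> \<beta>"
  have aR: "?a \<in> R" using assms refl_root by blast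
  obtain \<delta> where \<delta>: "\<delta> \<in> R" "corefl \<alpha> (co \<beta>) = co \<delta>"
    using corefl_coroots[OF assms(1)] assms(2) by (metis image_iff)
  have a\<delta>: "pair ?a (co \<delta>) = 2"
    using assms pair_co by (simp add: \<delta>(2)[symmetric] pair_refl corefl_corefl)
  have g: "srefl \<alpha> (srefl \<beta> (srefl \<alpha> x)) = x - pair x (co \<delta>) *\<^sub>R ?a" for x
  proof -
    have "srefl \<beta> (srefl \<alpha> x) = srefl \<alpha> x - pair x (co \<delta>) *\<^sub>R \<beta>"
      by (simp add: reflection_def[of D \<beta>] pair_refl \<delta>(2))
    then show ?thesis
      using assms(1) by (simp only: linear_diff[OF linear_refl] linear_scale[OF linear_refl] refl_refl)
  qed
  have "pair x (co \<delta>) - pair x (co ?a) = 0" if "x \<in> R" for x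
  proof (rule transvection_trivial[where a = ?a and x = x
        and f = "\<lambda>x. pair x (co \<delta>) - pair x (co ?a)"])
    show "linear (\<lambda>x. pair x (co \<delta>) - pair x (co ?a))"
      by (intro linear_compose_sub linear_pair_left)
    show "pair ?a (co \<delta>) - pair ?a (co ?a) = 0" using a\<delta> pair_co[OF aR] by simp
    show "?a \<noteq> 0" using aR zero_not_root by metis
    show "x \<in> R" by fact
    fix x assume x: "x \<in> R"
    then have "srefl ?a (srefl \<alpha> (srefl \<beta> (srefl \<alpha> x))) \<in> R"
      by (intro refl_root assms aR)
    moreover have "srefl ?a (srefl \<alpha> (srefl \<beta> (srefl \<alpha> x)))
        = x + (pair x (co \<delta>) - pair x (co ?a)) *\<^sub>R ?a"
      using pair_co[OF aR]
      by (simp add: g reflection_def[of D ?a] pair_simps scaleR_left_diff_distrib)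
        (simp flip: scaleR_left_diff_distrib)
    ultimately show "x + (pair x (co \<delta>) - pair x (co ?a)) *\<^sub>R ?a \<in> R" by simp
  qed
  then have "\<delta> = ?a"
    using coroot_determined_on_roots[OF \<delta>(1) aR] by simp
  then show ?thesis using \<delta>(2) by simp
qed


subsection \<open>Positive roots\<close>

text \<open>Linear extension of the coordinate on the span of the simple roots to the whole space; its values
  off the span are arbitrary, but having it everywhere defined and linear avoids side conditions.\<close>

definition root_coef :: "'v \<Rightarrow> 'v \<Rightarrow> real" where
  "root_coef \<alpha> = (SOME g. linear g \<and> (\<forall>x\<in>S. g x = (if x = \<alpha> then 1 else 0)))"

lemma linear_root_coef: "linear (root_coef \<alpha>)"
  and root_coef_simple: "\<beta> \<in> S \<Longrightarrow> root_coef \<alpha> \<beta> = (if \<beta> = \<alpha> then 1 else 0)"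
proof -
  have "\<exists>g::'v \<Rightarrow> real. linear g \<and> (\<forall>x\<in>S. g x = (if x = \<alpha> then 1 else 0))"
    using linear_independent_extend[OF indep_simple, of "\<lambda>x. if x = \<alpha> then 1 else 0"] by auto
  from someI_ex[OF this]
  show "linear (root_coef \<alpha>)" "\<beta> \<in> S \<Longrightarrow> root_coef \<alpha> \<beta> = (if \<beta> = \<alpha> then 1 else 0)"
    by (auto simp: root_coef_def)
qed

lemmas root_coef_linear_simps =
  linear_add[OF linear_root_coef] linear_diff[OF linear_root_coef] linear_neg[OF linear_root_coef]
  linear_0[OF linear_root_coef] linear_scale[OF linear_root_coef] linear_sum[OF linear_root_coef]

lemma finite_simple: "finite S"
  using finite_subset[OF simple_roots finite_roots] .

lemma simple_root: "\<alpha> \<in> S \<Longrightarrow> \<alpha> \<in> R"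
  using simple_roots by auto

lemma root_coef_expansion: "finite A \<Longrightarrow> A \<subseteq> S \<Longrightarrow> \<alpha> \<in> S \<Longrightarrow>
    root_coef \<alpha> (\<Sum>\<beta>\<in>A. c \<beta> *\<^sub>R \<beta>) = (if \<alpha> \<in> A then c \<alpha> else 0)"
  by (simp add: root_coef_linear_simps root_coef_simple subset_iff if_distrib cong: if_cong sum.cong)

lemma pos_root_expansion:
  assumes "\<beta> \<in> P" shows "\<beta> = (\<Sum>\<alpha>\<in>S. root_coef \<alpha> \<beta> *\<^sub>R \<alpha>)" and "\<alpha> \<in> S \<Longrightarrow> 0 \<le> root_coef \<alpha> \<beta>"
proof -
  obtain c where c: "\<forall>\<alpha>\<in>S. 0 \<le> c \<alpha>" "\<beta> = (\<Sum>\<alpha>\<in>S. c \<alpha> *\<^sub>R \<alpha>)"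
    using assms by (auto simp: pos_roots_def)
  have *: "root_coef \<alpha> \<beta> = c \<alpha>" if "\<alpha> \<in> S" for \<alpha>
    using that by (simp add: c(2) root_coef_expansion finite_simple)
  show "\<beta> = (\<Sum>\<alpha>\<in>S. root_coef \<alpha> \<beta> *\<^sub>R \<alpha>)" by (subst c(2)) (simp add: *)
  show "\<alpha> \<in> S \<Longrightarrow> 0 \<le> root_coef \<alpha> \<beta>" using * c(1) by simp
qed

lemma root_expansion: "\<beta> \<in> R \<Longrightarrow> \<beta> = (\<Sum>\<alpha>\<in>S. root_coef \<alpha> \<beta> *\<^sub>R \<alpha>)"
  using pos_or_neg[of \<beta>] pos_root_expansion(1)[of \<beta>] pos_root_expansion(1)[of "- \<beta>"]
  by (auto simp: root_coef_linear_simps sum_negf)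

lemma pos_root: "\<beta> \<in> P \<Longrightarrow> \<beta> \<in> R"
  by (simp add: pos_roots_def)

lemma finite_pos: "finite P"
  by (rule finite_subset[OF _ finite_roots]) (auto simp: pos_root)

lemma simple_pos: "\<alpha> \<in> S \<Longrightarrow> \<alpha> \<in> P"
  unfolding pos_roots_def using simple_roots finite_simple
  by (auto intro!: exI[of _ "\<lambda>\<beta>. if \<beta> = \<alpha> then 1 else 0"] simp: if_distrib[of "\<lambda>c. c *\<^sub>R _"] cong: if_cong)

lemma posI:
  assumes "\<beta> \<in> R" "\<And>\<alpha>. \<alpha> \<in> S \<Longrightarrow> 0 \<le> root_coef \<alpha> \<beta>" shows "\<beta> \<in> P"
proof -
  have "\<exists>c. (\<forall>\<alpha>\<in>S. 0 \<le> c \<alpha>) \<and> \<beta> = (\<Sum>\<alpha>\<in>S. c \<alpha> *\<^sub>R \<alpha>)"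
    using assms(2) root_expansion[OF assms(1)] by (intro exI[of _ "\<lambda>\<alpha>. root_coef \<alpha> \<beta>"]) simp
  then show ?thesis using assms(1) by (simp add: pos_roots_def)
qed

lemma not_pos_and_neg: "\<beta> \<in> P \<Longrightarrow> - \<beta> \<notin> P"
proof
  assume b: "\<beta> \<in> P" "- \<beta> \<in> P"
  have "root_coef \<alpha> \<beta> = 0" if "\<alpha> \<in> S" for \<alpha>
    using pos_root_expansion(2)[OF b(1) that] pos_root_expansion(2)[OF b(2) that]
    by (simp add: root_coef_linear_simps)
  then have "\<beta> = 0" using pos_root_expansion(1)[OF b(1)] by simp
  then show False using b(1) pos_root zero_not_root by auto
qed

lemma uminus_pos_iff: "\<beta> \<in> R \<Longrightarrow> - \<beta> \<in> P \<longleftrightarrow> \<beta> \<notin> P"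
  using not_pos_and_neg pos_or_neg by blast

text \<open>The coordinates of a root all have the same sign, so one of them decides positivity.\<close>

lemma pos_if_root_coef_pos: "\<beta> \<in> R \<Longrightarrow> \<alpha> \<in> S \<Longrightarrow> 0 < root_coef \<alpha> \<beta> \<Longrightarrow> \<beta> \<in> P"
  using uminus_pos_iff[of \<beta>] pos_root_expansion(2)[of "- \<beta>" \<alpha>]
  by (force simp: root_coef_linear_simps)

lemma pos_single_simple:
  assumes "\<beta> \<in> P" "\<alpha> \<in> S" "\<And>\<gamma>. \<gamma> \<in> S \<Longrightarrow> \<gamma> \<noteq> \<alpha> \<Longrightarrow> root_coef \<gamma> \<beta> = 0"
  shows "\<beta> = \<alpha>"
proof -
  have "\<beta> = (\<Sum>\<gamma>\<in>S. (if \<gamma> = \<alpha> then root_coef \<alpha> \<beta> *\<^sub>R \<alpha> else 0))"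
    by (subst pos_root_expansion(1)[OF assms(1)], rule sum.cong) (auto simp: assms(3))
  then have b: "\<beta> = root_coef \<alpha> \<beta> *\<^sub>R \<alpha>" using assms(2) finite_simple by simp
  then have "root_coef \<alpha> \<beta> = 1 \<or> root_coef \<alpha> \<beta> = - 1"
    using reduced[of \<alpha> "root_coef \<alpha> \<beta>"] pos_root[OF assms(1)] simple_root[OF assms(2)] by simp
  then show ?thesis using b pos_root_expansion(2)[OF assms(1,2)] by auto
qed

lemma root_coef_refl: "\<gamma> \<in> S \<Longrightarrow> \<alpha> \<in> S \<Longrightarrow> \<gamma> \<noteq> \<alpha> \<Longrightarrow> root_coef \<gamma> (srefl \<alpha> \<beta>) = root_coef \<gamma> \<beta>"
  by (simp add: reflection_def root_coef_linear_simps root_coef_simple)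

text \<open>By reducedness \<open>\<beta>\<close> has a second simple root in its support, whose coefficient the reflection in
  \<open>\<alpha>\<close> does not change.\<close>

lemma refl_simple_pos:
  assumes "\<alpha> \<in> S" "\<beta> \<in> P" "\<beta> \<noteq> \<alpha>"
  shows "srefl \<alpha> \<beta> \<in> P"
proof -
  obtain \<gamma> where \<gamma>: "\<gamma> \<in> S" "\<gamma> \<noteq> \<alpha>" "root_coef \<gamma> \<beta> \<noteq> 0"
    using pos_single_simple[OF assms(2,1)] assms(3) by blast
  then have "0 < root_coef \<gamma> (srefl \<alpha> \<beta>)"
    using pos_root_expansion(2)[OF assms(2), of \<gamma>] assms(1) by (simp add: root_coef_refl)
  then show ?thesis
    using pos_if_root_coef_pos[of "srefl \<alpha> \<beta>" \<gamma>] \<gamma>(1) assms pos_root simple_root refl_root by blast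
qed

text \<open>Pairing a root with the simple roots under the invariant form
  \<open>\<Sum>\<gamma>. pair x (co \<gamma>) * pair y (co \<gamma>)\<close> finds a simple root at an acute angle.\<close>

lemma exists_acute_simple:
  assumes "\<beta> \<in> P" shows "\<exists>\<alpha>\<in>S. 0 < pair \<beta> (co \<alpha>)"
proof (rule ccontr)
  assume neg: "\<not> ?thesis"
  define B where "B x y = (\<Sum>\<gamma>\<in>co ` R. pair x \<gamma> * pair y \<gamma>)" for x y
  have inv: "B (srefl \<alpha> x) (srefl \<alpha> y) = B x y" if "\<alpha> \<in> R" for \<alpha> x y
  proof -
    have "B (srefl \<alpha> x) (srefl \<alpha> y) = (\<Sum>\<gamma>\<in>co ` R. pair x (corefl \<alpha> \<gamma>) * pair y (corefl \<alpha> \<gamma>))"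
      by (simp add: B_def pair_refl)
    also have "\<dots> = (\<Sum>\<gamma>\<in>corefl \<alpha> ` co ` R. pair x \<gamma> * pair y \<gamma>)"
      by (rule sum.reindex[symmetric, unfolded comp_def]) (metis inj_onI corefl_corefl that)
    finally show ?thesis by (simp add: B_def corefl_coroots[OF that])
  qed
  have lin: "linear (B x)" for x
    unfolding B_def by (rule linearI) (simp_all add: pair_simps algebra_simps sum.distrib sum_distrib_left)
  have Blin: "B (x - c *\<^sub>R y) z = B x z - c * B y z" for x y z c
    by (simp add: B_def pair_simps algebra_simps sum_subtractf sum_distrib_left)
  have Bpos: "0 < B \<gamma> \<gamma>" if "\<gamma> \<in> R" for \<gamma>
    unfolding B_def
  proof (rule sum_pos2[of _ "co \<gamma>"])
    show "finite (co ` R)" using finite_roots by simp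
  qed (use that pair_co in auto)
  have "B \<beta> \<alpha> \<le> 0" if "\<alpha> \<in> S" for \<alpha>
  proof -
    have "B \<beta> \<alpha> - pair \<beta> (co \<alpha>) * B \<alpha> \<alpha> = B (srefl \<alpha> \<beta>) \<alpha>"
      by (simp add: reflection_def Blin)
    also have "\<dots> = B \<beta> (- \<alpha>)"
      using inv[of \<alpha> "\<beta>" "- \<alpha>"] simple_root[OF that]
      by (simp add: linear_neg[OF linear_refl] refl_self)
    finally have "2 * B \<beta> \<alpha> = pair \<beta> (co \<alpha>) * B \<alpha> \<alpha>"
      by (simp add: linear_neg[OF lin])
    moreover have "pair \<beta> (co \<alpha>) * B \<alpha> \<alpha> \<le> 0"
      using neg that Bpos[of \<alpha>] simple_root[OF that]
      by (meson linorder_not_less mult_nonpos_nonneg less_imp_le)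
    ultimately show ?thesis by simp
  qed
  then have "(\<Sum>\<alpha>\<in>S. root_coef \<alpha> \<beta> * B \<beta> \<alpha>) \<le> 0"
    using pos_root_expansion(2)[OF assms] by (intro sum_nonpos) (simp add: mult_nonneg_nonpos)
  moreover have "B \<beta> \<beta> = (\<Sum>\<alpha>\<in>S. root_coef \<alpha> \<beta> * B \<beta> \<alpha>)"
    by (subst (2) pos_root_expansion(1)[OF assms])
      (simp add: linear_sum[OF lin] linear_scale[OF lin])
  ultimately show False using Bpos pos_root[OF assms] by force
qed


subsection \<open>Words in reflections\<close>

abbreviation "WP \<equiv> weyl_par D"

text \<open>The product of reflections that occurs in \<open>weyl_length\<close>, here also for words in arbitrary roots.\<close>

definition word :: "'v list \<Rightarrow> 'v \<Rightarrow> 'v" where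
  "word \<alpha>s = foldr (\<lambda>\<alpha> f. srefl \<alpha> \<circ> f) \<alpha>s id"

lemma word_simps [simp]: "word [] = id" "word (\<alpha> # \<alpha>s) = srefl \<alpha> \<circ> word \<alpha>s"
  by (simp_all add: word_def)

lemma word_append: "word (\<alpha>s @ \<beta>s) = word \<alpha>s \<circ> word \<beta>s"
  by (induction \<alpha>s) auto

lemma word_rev: "set \<alpha>s \<subseteq> R \<Longrightarrow> word (rev \<alpha>s) \<circ> word \<alpha>s = id"
proof (induction \<alpha>s)
  case (Cons \<alpha> \<alpha>s)
  then have "word (rev \<alpha>s) (word \<alpha>s x) = x" for x by (metis comp_apply id_apply insert_subset list.set(2))
  then show ?case using Cons.prems by (auto simp: word_append fun_eq_iff refl_refl)
qed simp

lemma inv_word: "set \<alpha>s \<subseteq> R \<Longrightarrow> inv (word \<alpha>s) = word (rev \<alpha>s)"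
  using word_rev[of \<alpha>s] word_rev[of "rev \<alpha>s"] by (metis inv_unique_comp rev_rev_ident set_rev)

lemma generated_group_word:
  assumes "A \<subseteq> R"
  shows "generated_group (srefl ` A) = {word \<alpha>s | \<alpha>s. set \<alpha>s \<subseteq> A}"
proof (intro equalityI subsetI)
  fix w assume "w \<in> generated_group (srefl ` A)"
  then show "w \<in> {word \<alpha>s | \<alpha>s. set \<alpha>s \<subseteq> A}"
  proof induction
    case one
    then show ?case by (auto intro!: exI[of _ "[]"])
  next
    case (gen g)
    then obtain \<alpha> where "\<alpha> \<in> A" "g = srefl \<alpha>" by auto
    then show ?case by (auto intro!: exI[of _ "[\<alpha>]"])
  next
    case (mult g h)
    then obtain as bs where "g = word as" "set as \<subseteq> A" "h = word bs" "set bs \<subseteq> A" by auto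
    then show ?case by (auto intro!: exI[of _ "as @ bs"] simp: word_append)
  next
    case (inverse g)
    then obtain as where "g = word as" "set as \<subseteq> A" by auto
    then show ?case using assms by (auto intro!: exI[of _ "rev as"] simp: inv_word)
  qed
next
  fix w assume "w \<in> {word \<alpha>s | \<alpha>s. set \<alpha>s \<subseteq> A}"
  then obtain \<alpha>s where "w = word \<alpha>s" "set \<alpha>s \<subseteq> A" by auto
  moreover have "set \<alpha>s \<subseteq> A \<Longrightarrow> word \<alpha>s \<in> generated_group (srefl ` A)"
    by (induction \<alpha>s) (auto intro: generated_group.intros)
  ultimately show "w \<in> generated_group (srefl ` A)" by simp
qed

lemma WP_word: "M \<subseteq> R \<Longrightarrow> w \<in> WP M \<longleftrightarrow> (\<exists>\<alpha>s. set \<alpha>s \<subseteq> M \<and> w = word \<alpha>s)"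
  by (auto simp: weyl_par_def generated_group_word)

lemma W_word: "w \<in> W \<longleftrightarrow> (\<exists>\<alpha>s. set \<alpha>s \<subseteq> R \<and> w = word \<alpha>s)"
  by (auto simp: weyl_def generated_group_word)

lemma WP_id [simp]: "id \<in> WP M" and WP_refl: "\<alpha> \<in> M \<Longrightarrow> srefl \<alpha> \<in> WP M"
  and WP_comp: "u \<in> WP M \<Longrightarrow> w \<in> WP M \<Longrightarrow> u \<circ> w \<in> WP M"
  and WP_inv: "u \<in> WP M \<Longrightarrow> inv u \<in> WP M"
  by (auto simp: weyl_par_def intro: generated_group.intros)

lemma W_id [simp]: "id \<in> W" and W_refl: "\<alpha> \<in> R \<Longrightarrow> srefl \<alpha> \<in> W"
  and W_comp: "u \<in> W \<Longrightarrow> w \<in> W \<Longrightarrow> u \<circ> w \<in> W"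
  and W_inv: "u \<in> W \<Longrightarrow> inv u \<in> W"
  by (auto simp: weyl_def intro: generated_group.intros)

lemma WP_induct [consumes 2, case_names id srefl]:
  assumes "M \<subseteq> R" "w \<in> WP M" "Q id" "\<And>\<alpha> w. \<alpha> \<in> M \<Longrightarrow> w \<in> WP M \<Longrightarrow> Q w \<Longrightarrow> Q (srefl \<alpha> \<circ> w)"
  shows "Q w"
proof -
  obtain \<alpha>s where "set \<alpha>s \<subseteq> M" "w = word \<alpha>s" using assms WP_word by blast
  moreover have "set \<alpha>s \<subseteq> M \<Longrightarrow> Q (word \<alpha>s)"
    by (induction \<alpha>s) (use assms WP_word in auto)
  ultimately show ?thesis by simp
qed

lemma W_eq_WP_R: "W = WP R"
  by (simp add: weyl_def weyl_par_def)

lemma WP_mono: "M \<subseteq> N \<Longrightarrow> N \<subseteq> R \<Longrightarrow> WP M \<subseteq> WP N"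
  using WP_word[of M] WP_word[of N] by blast

lemma WP_W: "M \<subseteq> S \<Longrightarrow> w \<in> WP M \<Longrightarrow> w \<in> W"
  using WP_mono[of M R] simple_roots W_eq_WP_R by blast

lemma W_linear: "w \<in> W \<Longrightarrow> linear w"
  unfolding W_eq_WP_R
  by (induction rule: WP_induct[OF order_refl, consumes 1, case_names id srefl])
    (simp_all only: linear_id linear_compose linear_refl)

lemma W_root: "w \<in> W \<Longrightarrow> \<beta> \<in> R \<Longrightarrow> w \<beta> \<in> R"
  unfolding W_eq_WP_R
  by (induction rule: WP_induct[OF order_refl, consumes 1, case_names id srefl]) (auto simp: refl_root)

lemma W_bij: "w \<in> W \<Longrightarrow> bij w"
proof -
  assume "w \<in> W"
  then obtain \<alpha>s where "set \<alpha>s \<subseteq> R" "w = word \<alpha>s" using W_word by blast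
  then show "bij w"
    using word_rev[of \<alpha>s] word_rev[of "rev \<alpha>s"] by (metis o_bij rev_rev_ident set_rev)
qed

lemma W_inv_apply [simp]: "w \<in> W \<Longrightarrow> inv w (w x) = x" "w \<in> W \<Longrightarrow> w (inv w x) = x"
  using W_bij by (simp_all add: bij_is_inj bij_is_surj surj_f_inv_f)

lemma W_inv_comp [simp]: "w \<in> W \<Longrightarrow> inv w \<circ> w = id" "w \<in> W \<Longrightarrow> w \<circ> inv w = id"
  by (simp_all add: fun_eq_iff)

lemma W_inv_inv [simp]: "w \<in> W \<Longrightarrow> inv (inv w) = w"
  by (simp add: W_bij inv_inv_eq)

lemma W_inv_o: "u \<in> W \<Longrightarrow> w \<in> W \<Longrightarrow> inv (u \<circ> w) = inv w \<circ> inv u"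
  by (simp add: W_bij o_inv_distrib)

lemma inv_refl [simp]: "\<alpha> \<in> R \<Longrightarrow> inv (srefl \<alpha>) = srefl \<alpha>"
  by (metis inv_unique_comp refl_comp_refl)

lemma conj_refl_refl:
  assumes "\<alpha> \<in> R" "\<beta> \<in> R" shows "srefl (srefl \<alpha> \<beta>) \<circ> srefl \<alpha> = srefl \<alpha> \<circ> srefl \<beta>"
proof
  fix x
  show "(srefl (srefl \<alpha> \<beta>) \<circ> srefl \<alpha>) x = (srefl \<alpha> \<circ> srefl \<beta>) x"
    using assms
    by (simp add: reflection_def[of D "srefl \<alpha> \<beta>"] reflection_def[of D \<beta>] coroot_refl pair_refl
        corefl_corefl linear_diff[OF linear_refl] linear_scale[OF linear_refl])
qed

lemma refl_W: "w \<in> W \<Longrightarrow> \<beta> \<in> R \<Longrightarrow> srefl (w \<beta>) \<circ> w = w \<circ> srefl \<beta>"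
  unfolding W_eq_WP_R
proof (induction rule: WP_induct[OF order_refl, consumes 1, case_names id srefl])
  case (srefl \<alpha> w)
  have "srefl (srefl \<alpha> (w \<beta>)) \<circ> srefl \<alpha> = srefl \<alpha> \<circ> srefl (w \<beta>)"
    using srefl W_root[of w \<beta>] by (intro conj_refl_refl) (auto simp: W_eq_WP_R)
  then show ?case using srefl by (simp add: fun_eq_iff)
qed simp

text \<open>A positive root of minimal height in its orbit under the simple reflections is simple: otherwise
  reflecting it in a simple root at an acute angle lowers the height and keeps it positive. So every
  reflection is conjugate to a simple one.\<close>

lemma W_eq_WP_simple: "W = WP S"
proof
  show "WP S \<subseteq> W" using WP_W by blast
  have refl_in: "srefl \<beta> \<in> WP S" if "\<beta> \<in> P" for \<beta>
  proof -
    define ht where "ht \<gamma> = (\<Sum>\<alpha>\<in>S. root_coef \<alpha> \<gamma>)" for \<gamma>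
    let ?O = "{\<gamma> \<in> P. \<exists>w\<in>WP S. \<gamma> = w \<beta>}"
    have "finite ?O" "\<beta> \<in> ?O" using finite_pos that by (auto intro: bexI[of _ id])
    then obtain \<gamma> where \<gamma>: "\<gamma> \<in> ?O" and min: "\<And>\<delta>. \<delta> \<in> ?O \<Longrightarrow> ht \<gamma> \<le> ht \<delta>"
      using ex_is_arg_min_if_finite[of ?O ht] unfolding is_arg_min_linorder by blast
    from \<gamma> obtain w where w: "w \<in> WP S" "\<gamma> = w \<beta>" "\<gamma> \<in> P" by auto
    obtain \<alpha> where \<alpha>: "\<alpha> \<in> S" "0 < pair \<gamma> (co \<alpha>)" using exists_acute_simple[OF w(3)] by auto
    have "\<gamma> = \<alpha>"
    proof (rule ccontr)
      assume "\<gamma> \<noteq> \<alpha>"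
      then have "srefl \<alpha> \<gamma> \<in> ?O"
        using w \<alpha> refl_simple_pos by (auto intro!: bexI[of _ "srefl \<alpha> \<circ> w"] WP_comp WP_refl)
      moreover have "ht (srefl \<alpha> \<gamma>) = ht \<gamma> - pair \<gamma> (co \<alpha>)"
        using \<alpha>(1) finite_simple
        by (simp add: ht_def reflection_def root_coef_linear_simps root_coef_simple sum_subtractf
            sum_distrib_left[symmetric])
      ultimately show False using min[of "srefl \<alpha> \<gamma>"] \<alpha>(2) by simp
    qed
    then have "srefl \<alpha> \<circ> w = w \<circ> srefl \<beta>"
      using refl_W[of w \<beta>] w WP_W[of S w] that pos_root by auto
    moreover have "inv w \<circ> w = id" using w WP_W[of S w] by simp
    ultimately have "srefl \<beta> = inv w \<circ> (srefl \<alpha> \<circ> w)" by (metis comp_assoc id_comp)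
    then show ?thesis using w \<alpha> by (simp add: WP_comp WP_inv WP_refl)
  qed
  have root: "srefl \<beta> \<in> WP S" if "\<beta> \<in> R" for \<beta>
  proof (cases "\<beta> \<in> P")
    case False
    then have "- \<beta> \<in> P" using pos_or_neg that by blast
    moreover have "srefl (- \<beta>) = srefl \<beta>"
      using refl_W[of "srefl \<beta>" \<beta>] that W_refl[OF that]
      by (simp add: refl_self fun_eq_iff) (metis refl_refl)
    ultimately show ?thesis using refl_in by metis
  qed (rule refl_in)
  have "w \<in> WP S" if "w \<in> WP R" for w
    using that
    by (induction rule: WP_induct[OF order_refl, consumes 1, case_names id srefl])
      (simp_all only: WP_id WP_comp root)
  then show "W \<subseteq> WP S" by (auto simp: W_eq_WP_R)
qed


subsection \<open>Length and inversions\<close>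

definition inversions :: "('v \<Rightarrow> 'v) \<Rightarrow> 'v set" where
  "inversions w = {\<beta> \<in> P. w \<beta> \<notin> P}"

lemma finite_inversions: "finite (inversions w)"
  using finite_pos by (simp add: inversions_def)

lemma W_neg: "w \<in> W \<Longrightarrow> w (- x) = - w x"
  by (simp add: W_linear linear_neg)

lemma W_uminus_pos: "w \<in> W \<Longrightarrow> \<beta> \<in> R \<Longrightarrow> - w \<beta> \<in> P \<longleftrightarrow> w \<beta> \<notin> P"
  by (simp add: uminus_pos_iff W_root)

lemma W_simple_refl: "\<alpha> \<in> S \<Longrightarrow> srefl \<alpha> \<in> W"
  by (simp add: W_refl simple_root)

text \<open>The reflection in \<open>\<alpha>\<close> permutes the positive roots other than \<open>\<alpha>\<close>, so the inversions
  correspond except for \<open>\<alpha>\<close> itself.\<close>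

lemma card_inversions_up:
  assumes "\<alpha> \<in> S" "w \<in> W" "w \<alpha> \<in> P"
  shows "card (inversions (w \<circ> srefl \<alpha>)) = Suc (card (inversions w))"
proof -
  have \<alpha>: "\<alpha> \<in> R" "\<alpha> \<in> P" using assms simple_root simple_pos by auto
  have "inversions (w \<circ> srefl \<alpha>) = insert \<alpha> (srefl \<alpha> ` inversions w)"
  proof (intro equalityI subsetI)
    fix \<beta> assume b: "\<beta> \<in> inversions (w \<circ> srefl \<alpha>)"
    show "\<beta> \<in> insert \<alpha> (srefl \<alpha> ` inversions w)"
    proof (cases "\<beta> = \<alpha>")
      case False
      then have "srefl \<alpha> \<beta> \<in> inversions w"
        using b assms(1) refl_simple_pos by (simp add: inversions_def)
      then show ?thesis using refl_refl[OF \<alpha>(1), of \<beta>] by (metis image_eqI insertI2)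
    qed simp
  next
    fix \<beta> assume "\<beta> \<in> insert \<alpha> (srefl \<alpha> ` inversions w)"
    then consider "\<beta> = \<alpha>" | \<gamma> where "\<gamma> \<in> inversions w" "\<beta> = srefl \<alpha> \<gamma>" by auto
    then show "\<beta> \<in> inversions (w \<circ> srefl \<alpha>)"
    proof cases
      case 1
      then show ?thesis
        using assms \<alpha> not_pos_and_neg by (simp add: inversions_def refl_self W_neg)
    next
      case 2
      then have "\<gamma> \<noteq> \<alpha>" using assms by (auto simp: inversions_def)
      then show ?thesis
        using 2 assms(1) \<alpha> refl_simple_pos by (simp add: inversions_def refl_refl)
    qed
  qed
  moreover have "\<alpha> \<notin> srefl \<alpha> ` inversions w"
  proof
    assume "\<alpha> \<in> srefl \<alpha> ` inversions w"
    then obtain \<gamma> where "\<gamma> \<in> P" "\<alpha> = srefl \<alpha> \<gamma>" by (auto simp: inversions_def)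
    then have "\<gamma> = - \<alpha>" using refl_refl[OF \<alpha>(1), of \<gamma>] refl_self[OF \<alpha>(1)] by simp
    then show False using \<open>\<gamma> \<in> P\<close> \<alpha>(2) not_pos_and_neg by simp
  qed
  moreover have "card (srefl \<alpha> ` inversions w) = card (inversions w)"
    by (rule card_image) (metis inj_onI refl_refl \<alpha>(1))
  ultimately show ?thesis by (simp add: finite_inversions)
qed

lemma card_inversions_down:
  assumes "\<alpha> \<in> S" "w \<in> W" "w \<alpha> \<notin> P"
  shows "card (inversions w) = Suc (card (inversions (w \<circ> srefl \<alpha>)))"
proof -
  have "(w \<circ> srefl \<alpha>) \<alpha> \<in> P"
    using assms simple_root W_uminus_pos by (simp add: refl_self W_neg)
  then have "card (inversions (w \<circ> srefl \<alpha> \<circ> srefl \<alpha>)) = Suc (card (inversions (w \<circ> srefl \<alpha>)))"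
    by (intro card_inversions_up W_comp W_simple_refl assms)
  then show ?thesis
    using assms simple_root by (simp only: comp_assoc refl_comp_refl comp_id)
qed

lemma word_simple_W: "set \<alpha>s \<subseteq> S \<Longrightarrow> word \<alpha>s \<in> W"
  using W_eq_WP_simple WP_word[OF simple_roots] by blast

text \<open>Follow \<open>\<alpha>\<close> through the word from the right. At the letter \<open>\<gamma>\<close> where it turns negative it must be
  equal to \<open>\<gamma>\<close>, so this letter can be traded for \<open>\<alpha>\<close> at the right end.\<close>

lemma exchange:
  assumes "set \<alpha>s \<subseteq> S" "\<alpha> \<in> S" "word \<alpha>s \<alpha> \<notin> P"
  shows "\<exists>\<beta>s. set \<beta>s \<subseteq> S \<and> length \<beta>s < length \<alpha>s \<and> word \<alpha>s \<circ> srefl \<alpha> = word \<beta>s"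
  using assms
proof (induction \<alpha>s)
  case Nil
  then show ?case using simple_pos by simp
next
  case (Cons \<gamma> \<alpha>s)
  show ?case
  proof (cases "word \<alpha>s \<alpha> \<in> P")
    case False
    then obtain \<beta>s where "set \<beta>s \<subseteq> S" "length \<beta>s < length \<alpha>s" "word \<alpha>s \<circ> srefl \<alpha> = word \<beta>s"
      using Cons.IH Cons.prems by (metis insert_subset list.simps(15))
    moreover from this(3) have "word (\<gamma> # \<alpha>s) \<circ> srefl \<alpha> = word (\<gamma> # \<beta>s)"
      by (simp only: word_simps comp_assoc)
    ultimately show ?thesis
      using Cons.prems by (metis insert_subset length_Cons list.simps(15) Suc_less_eq)
  next
    case True
    then have "word \<alpha>s \<alpha> = \<gamma>" using Cons.prems refl_simple_pos by auto
    then have "srefl \<gamma> \<circ> word \<alpha>s = word \<alpha>s \<circ> srefl \<alpha>"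
      using refl_W[of "word \<alpha>s" \<alpha>] Cons.prems word_simple_W simple_root by auto
    then have "word (\<gamma> # \<alpha>s) \<circ> srefl \<alpha> = word \<alpha>s"
      using refl_comp_refl[OF simple_root[OF \<open>\<alpha> \<in> S\<close>]] by (simp add: comp_assoc)
    then show ?thesis using Cons.prems by (metis insert_subset length_Cons lessI list.simps(15))
  qed
qed

text \<open>If the last letter \<open>\<alpha>\<close> is not an inversion, the word without it sends \<open>\<alpha>\<close> to a negative root
  and the exchange property shortens the word.\<close>

lemma no_inversions_word: "set \<alpha>s \<subseteq> S \<Longrightarrow> inversions (word \<alpha>s) = {} \<Longrightarrow> word \<alpha>s = id"
proof (induction \<alpha>s rule: measure_induct_rule[of length])
  case (less \<alpha>s)
  show ?case
  proof (cases \<alpha>s rule: rev_cases)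
    case (snoc \<beta>s \<alpha>)
    then have \<alpha>: "\<alpha> \<in> S" "set \<beta>s \<subseteq> S" using less.prems by auto
    have "word \<alpha>s \<alpha> \<in> P" using less.prems(2) simple_pos[OF \<alpha>(1)] by (auto simp: inversions_def)
    then have "- word \<beta>s \<alpha> \<in> P"
      using snoc \<alpha> by (simp add: word_append refl_self simple_root W_neg word_simple_W)
    then have "word \<beta>s \<alpha> \<notin> P" using not_pos_and_neg by blast
    then obtain \<gamma>s where "set \<gamma>s \<subseteq> S" "length \<gamma>s < length \<beta>s" "word \<beta>s \<circ> srefl \<alpha> = word \<gamma>s"
      using exchange \<alpha> by blast
    then show ?thesis using less.IH[of \<gamma>s] less.prems snoc by (simp add: word_append)
  qed simp
qed

lemma no_inversions_id: "w \<in> W \<Longrightarrow> inversions w = {} \<Longrightarrow> w = id"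
  using no_inversions_word W_eq_WP_simple WP_word[OF simple_roots] by metis

lemma exists_descent:
  assumes "w \<in> W" "w \<noteq> id" shows "\<exists>\<alpha>\<in>S. w \<alpha> \<notin> P"
proof (rule ccontr)
  assume neg: "\<not> ?thesis"
  have "w \<beta> \<in> P" if "\<beta> \<in> P" for \<beta>
  proof (rule posI)
    show "w \<beta> \<in> R" using assms that pos_root W_root by blast
    fix \<gamma> assume "\<gamma> \<in> S"
    have "w \<beta> = (\<Sum>\<alpha>\<in>S. root_coef \<alpha> \<beta> *\<^sub>R w \<alpha>)"
      by (subst pos_root_expansion(1)[OF that])
        (simp add: linear_sum[OF W_linear] linear_scale[OF W_linear] assms)
    then have "root_coef \<gamma> (w \<beta>) = (\<Sum>\<alpha>\<in>S. root_coef \<alpha> \<beta> * root_coef \<gamma> (w \<alpha>))"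
      by (simp add: root_coef_linear_simps)
    then show "0 \<le> root_coef \<gamma> (w \<beta>)"
      using neg pos_root_expansion(2) that \<open>\<gamma> \<in> S\<close> by (auto intro!: sum_nonneg mult_nonneg_nonneg)
  qed
  then show False using no_inversions_id assms by (auto simp: inversions_def)
qed

lemma word_of_length_inversions:
  "w \<in> W \<Longrightarrow> \<exists>\<alpha>s. length \<alpha>s = card (inversions w) \<and> set \<alpha>s \<subseteq> S \<and> w = word \<alpha>s"
proof (induction "card (inversions w)" arbitrary: w rule: less_induct)
  case less
  show ?case
  proof (cases "w = id")
    case True
    then show ?thesis by (intro exI[of _ "[]"]) (simp add: inversions_def)
  next
    case False
    then obtain \<alpha> where \<alpha>: "\<alpha> \<in> S" "w \<alpha> \<notin> P" using exists_descent less.prems by blast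
    have c: "card (inversions w) = Suc (card (inversions (w \<circ> srefl \<alpha>)))"
      using card_inversions_down \<alpha> less.prems by blast
    then obtain \<alpha>s where "length \<alpha>s = card (inversions (w \<circ> srefl \<alpha>))" "set \<alpha>s \<subseteq> S"
        "w \<circ> srefl \<alpha> = word \<alpha>s"
      using less.hyps[of "w \<circ> srefl \<alpha>"] less.prems \<alpha> W_comp W_simple_refl by auto
    moreover from this(3) have "w = word \<alpha>s \<circ> srefl \<alpha>"
      using refl_comp_refl[OF simple_root[OF \<alpha>(1)]] by (metis comp_assoc comp_id)
    ultimately show ?thesis using c \<alpha> by (intro exI[of _ "\<alpha>s @ [\<alpha>]"]) (simp add: word_append)
  qed
qed

lemma inversions_word_le: "set \<alpha>s \<subseteq> S \<Longrightarrow> card (inversions (word \<alpha>s)) \<le> length \<alpha>s"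
proof (induction \<alpha>s rule: rev_induct)
  case Nil
  then show ?case by (simp add: inversions_def)
next
  case (snoc \<alpha> \<alpha>s)
  then have "word \<alpha>s \<in> W" "\<alpha> \<in> S" using word_simple_W by auto
  then have "card (inversions (word \<alpha>s \<circ> srefl \<alpha>)) \<le> Suc (card (inversions (word \<alpha>s)))"
    using card_inversions_up[of \<alpha> "word \<alpha>s"] card_inversions_down[of \<alpha> "word \<alpha>s"] by fastforce
  moreover have "card (inversions (word \<alpha>s)) \<le> length \<alpha>s" using snoc by simp
  moreover have "word (\<alpha>s @ [\<alpha>]) = word \<alpha>s \<circ> srefl \<alpha>" by (simp add: word_append)
  ultimately show ?case by (simp only: length_append_singleton le_trans[OF _ Suc_le_mono[THEN iffD2]])
qed

lemma weyl_length_inversions: "w \<in> W \<Longrightarrow> weyl_length D w = card (inversions w)"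
  unfolding weyl_length_def word_def[symmetric]
  by (rule Least_equality) (use word_of_length_inversions inversions_word_le in auto)

text \<open>An element that fixes all roots has no inversions, so it is the identity even where the roots do
  not span; the Weyl group therefore embeds into the permutations of the roots.\<close>

lemma finite_W: "finite W"
proof (rule inj_on_finite)
  show "inj_on (\<lambda>w. \<lambda>\<beta>\<in>R. w \<beta>) W"
  proof (rule inj_onI)
    fix u w assume uw: "u \<in> W" "w \<in> W" "(\<lambda>\<beta>\<in>R. u \<beta>) = (\<lambda>\<beta>\<in>R. w \<beta>)"
    then have "u \<beta> = w \<beta>" if "\<beta> \<in> R" for \<beta> using that by (metis restrict_apply')
    then have "inversions (inv u \<circ> w) = {}"
      using uw(1) pos_root by (force simp: inversions_def simp flip: \<open>\<And>\<beta>. \<beta> \<in> R \<Longrightarrow> u \<beta> = w \<beta>\<close>)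
    then have "inv u \<circ> w = id" using no_inversions_id uw W_comp W_inv by blast
    then show "u = w" using uw(1) by (metis W_inv_comp(2) comp_assoc comp_id id_comp)
  qed
  show "(\<lambda>w. \<lambda>\<beta>\<in>R. w \<beta>) ` W \<subseteq> R \<rightarrow>\<^sub>E R" using W_root by auto
  show "finite (R \<rightarrow>\<^sub>E R)" by (intro finite_PiE finite_roots)
qed


subsection \<open>Coset representatives and longest elements\<close>

text \<open>The positive roots of the subsystem spanned by \<open>M\<close>, described by vanishing coordinates because
  the parabolic subgroup of \<open>M\<close> does not change the coordinates outside of \<open>M\<close>.\<close>

definition pos_par :: "'v set \<Rightarrow> 'v set" where
  "pos_par M = {\<beta> \<in> P. \<forall>\<gamma>\<in>S - M. root_coef \<gamma> \<beta> = 0}"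

lemma pos_par_pos: "\<beta> \<in> pos_par M \<Longrightarrow> \<beta> \<in> P"
  by (simp add: pos_par_def)

lemma pos_par_simple [simp]: "pos_par S = P"
  by (simp add: pos_par_def)

lemma pos_par_base: "M \<subseteq> S \<Longrightarrow> \<alpha> \<in> M \<Longrightarrow> \<alpha> \<in> pos_par M"
  using simple_pos by (auto simp: pos_par_def root_coef_simple)

lemma pos_par_expansion:
  assumes "M \<subseteq> S" "\<beta> \<in> pos_par M" shows "\<beta> = (\<Sum>\<alpha>\<in>M. root_coef \<alpha> \<beta> *\<^sub>R \<alpha>)"
proof -
  have "(\<Sum>\<alpha>\<in>S. root_coef \<alpha> \<beta> *\<^sub>R \<alpha>) = (\<Sum>\<alpha>\<in>M. root_coef \<alpha> \<beta> *\<^sub>R \<alpha>)"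
    using assms finite_simple by (intro sum.mono_neutral_right) (auto simp: pos_par_def)
  then show ?thesis using pos_root_expansion(1)[OF pos_par_pos[OF assms(2)]] by simp
qed

lemma pos_par_image_root_coef:
  assumes "M \<subseteq> S" "linear g" "\<beta> \<in> pos_par M"
  shows "root_coef \<gamma> (g \<beta>) = (\<Sum>\<alpha>\<in>M. root_coef \<alpha> \<beta> * root_coef \<gamma> (g \<alpha>))"
  by (subst pos_par_expansion[OF assms(1,3)])
    (simp add: linear_sum[OF assms(2)] linear_scale[OF assms(2)] root_coef_linear_simps)

lemma pos_par_image_pos:
  assumes "M \<subseteq> S" "x \<in> W" "\<And>\<alpha>. \<alpha> \<in> M \<Longrightarrow> x \<alpha> \<in> P" "\<beta> \<in> pos_par M"
  shows "x \<beta> \<in> P"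
proof (rule posI)
  show "x \<beta> \<in> R" using assms pos_par_pos pos_root W_root by blast
  fix \<gamma> assume "\<gamma> \<in> S"
  then show "0 \<le> root_coef \<gamma> (x \<beta>)"
    unfolding pos_par_image_root_coef[OF assms(1) W_linear[OF assms(2)] assms(4)]
    using assms pos_root_expansion(2) pos_par_pos by (intro sum_nonneg mult_nonneg_nonneg) auto
qed

lemma WP_root_coef: "M \<subseteq> S \<Longrightarrow> w \<in> WP M \<Longrightarrow> \<gamma> \<in> S - M \<Longrightarrow> root_coef \<gamma> (w \<beta>) = root_coef \<gamma> \<beta>"
proof -
  assume a: "M \<subseteq> S" "w \<in> WP M" "\<gamma> \<in> S - M"
  have "M \<subseteq> R" using a simple_roots by auto
  have "root_coef \<gamma> (srefl \<alpha> x) = root_coef \<gamma> x" if "\<alpha> \<in> M" for \<alpha> x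
    using a that by (intro root_coef_refl) auto
  from \<open>M \<subseteq> R\<close> a(2) this show ?thesis by (induction rule: WP_induct) simp_all
qed

text \<open>A positive coordinate outside of \<open>M\<close> survives, and one positive coordinate is enough.\<close>

lemma WP_outside:
  assumes "M \<subseteq> S" "w \<in> WP M" "\<beta> \<in> P - pos_par M" shows "w \<beta> \<in> P - pos_par M"
proof -
  obtain \<gamma> where \<gamma>: "\<gamma> \<in> S - M" "root_coef \<gamma> \<beta> \<noteq> 0" using assms by (auto simp: pos_par_def)
  then have "0 < root_coef \<gamma> (w \<beta>)" "root_coef \<gamma> (w \<beta>) \<noteq> 0"
    using pos_root_expansion(2)[of \<beta> \<gamma>] assms WP_root_coef[OF assms(1,2) \<gamma>(1), of \<beta>] by auto
  moreover have "w \<beta> \<in> R" using assms WP_W pos_root W_root by blast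
  ultimately have "w \<beta> \<in> P" "\<gamma> \<in> S - M \<and> root_coef \<gamma> (w \<beta>) \<noteq> 0" using \<gamma> pos_if_root_coef_pos by blast+
  then show ?thesis by (auto simp: pos_par_def)
qed

lemma WP_inside:
  assumes "M \<subseteq> S" "w \<in> WP M" "\<beta> \<in> pos_par M"
  shows "w \<beta> \<in> P \<Longrightarrow> w \<beta> \<in> pos_par M" and "w \<beta> \<notin> P \<Longrightarrow> - w \<beta> \<in> pos_par M"
proof -
  have "root_coef \<gamma> (w \<beta>) = 0" if "\<gamma> \<in> S - M" for \<gamma>
    using that assms WP_root_coef by (auto simp: pos_par_def)
  moreover have "w \<beta> \<notin> P \<Longrightarrow> - w \<beta> \<in> P"
    using W_uminus_pos WP_W[OF assms(1,2)] pos_root[OF pos_par_pos[OF assms(3)]] by blast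
  ultimately show "w \<beta> \<in> P \<Longrightarrow> w \<beta> \<in> pos_par M" "w \<beta> \<notin> P \<Longrightarrow> - w \<beta> \<in> pos_par M"
    by (simp_all add: pos_par_def root_coef_linear_simps)
qed

text \<open>If \<open>x\<close> keeps \<open>M\<close> positive, all its inversions lie outside of the subsystem of \<open>M\<close>, and
  \<open>inv m\<close> carries them injectively to inversions of \<open>x m\<close>.\<close>

lemma min_reps_iff:
  assumes "M \<subseteq> S"
  shows "x \<in> min_reps D M \<longleftrightarrow> x \<in> W \<and> (\<forall>\<alpha>\<in>M. x \<alpha> \<in> P)"
proof
  assume x: "x \<in> min_reps D M"
  then have xW: "x \<in> W" by (simp add: min_reps_def)
  have "x \<alpha> \<in> P" if "\<alpha> \<in> M" for \<alpha>
  proof (rule ccontr)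
    assume "x \<alpha> \<notin> P"
    then have "card (inversions x) = Suc (card (inversions (x \<circ> srefl \<alpha>)))"
      using card_inversions_down xW that assms by blast
    moreover have "weyl_length D x \<le> weyl_length D (x \<circ> srefl \<alpha>)"
      using x that by (simp add: min_reps_def WP_refl)
    moreover have "x \<circ> srefl \<alpha> \<in> W" using xW that assms W_comp W_simple_refl by blast
    ultimately show False using xW by (simp add: weyl_length_inversions)
  qed
  then show "x \<in> W \<and> (\<forall>\<alpha>\<in>M. x \<alpha> \<in> P)" using xW by blast
next
  assume x: "x \<in> W \<and> (\<forall>\<alpha>\<in>M. x \<alpha> \<in> P)"
  have "weyl_length D x \<le> weyl_length D (x \<circ> m)" if m: "m \<in> WP M" for m
  proof -
    have mW: "m \<in> W" "inv m \<in> WP M" using m WP_W assms WP_inv by auto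
    have "inv m ` inversions x \<subseteq> inversions (x \<circ> m)"
    proof (intro image_subsetI)
      fix \<beta> assume b: "\<beta> \<in> inversions x"
      then have "\<beta> \<in> P - pos_par M" using pos_par_image_pos assms x by (auto simp: inversions_def)
      then have "inv m \<beta> \<in> P" using WP_outside assms mW by blast
      then show "inv m \<beta> \<in> inversions (x \<circ> m)" using b mW by (simp add: inversions_def)
    qed
    moreover have "inj_on (inv m) (inversions x)" using mW by (metis W_inv_apply(2) inj_onI)
    ultimately have "card (inversions x) \<le> card (inversions (x \<circ> m))"
      by (metis card_image card_mono finite_inversions)
    then show ?thesis using x mW W_comp by (simp add: weyl_length_inversions)
  qed
  then show "x \<in> min_reps D M" using x by (simp add: min_reps_def)
qed

lemma min_reps_W: "x \<in> min_reps D M \<Longrightarrow> x \<in> W"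
  by (simp add: min_reps_def)

lemma finite_min_reps: "finite (min_reps D M)"
  by (rule finite_subset[OF _ finite_W]) (auto simp: min_reps_W)

lemma coset_decomposition:
  assumes "M \<subseteq> S" "u \<in> W"
  obtains x m where "x \<in> min_reps D M" "m \<in> WP M" "u = x \<circ> m"
proof -
  obtain n where n: "n \<in> WP M" "\<And>m. m \<in> WP M \<Longrightarrow> weyl_length D (u \<circ> n) \<le> weyl_length D (u \<circ> m)"
    using ex_has_least_nat[of "\<lambda>n. n \<in> WP M" id "\<lambda>n. weyl_length D (u \<circ> n)"] by auto
  have nW: "n \<in> W" using n assms WP_W by blast
  have "u \<circ> n \<in> min_reps D M"
    using n nW assms by (auto simp: min_reps_def W_comp comp_assoc WP_comp)
  moreover have "u = (u \<circ> n) \<circ> inv n" using nW by (simp add: comp_assoc)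
  ultimately show ?thesis using that n WP_inv by blast
qed

text \<open>A negative value \<open>m \<beta>\<close> would have to come from the subsystem of \<open>M\<close>; then \<open>x\<close> maps \<open>- m \<beta>\<close> and
  \<open>y\<close> maps \<open>\<beta>\<close> to positive roots, which are opposite to each other.\<close>

lemma coset_unique:
  assumes "M \<subseteq> S" "x \<in> min_reps D M" "y \<in> min_reps D M" "m \<in> WP M" "y = x \<circ> m"
  shows "m = id"
proof (rule no_inversions_id)
  show mW: "m \<in> W" using assms WP_W by blast
  have xy: "x \<in> W" "\<And>\<alpha>. \<alpha> \<in> M \<Longrightarrow> x \<alpha> \<in> P" "y \<in> W" "\<And>\<alpha>. \<alpha> \<in> M \<Longrightarrow> y \<alpha> \<in> P"
    using assms(1-3) min_reps_iff by auto
  have "m \<beta> \<in> P" if "\<beta> \<in> P" for \<beta>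
  proof (cases "\<beta> \<in> pos_par M")
    case True
    show ?thesis
    proof (rule ccontr)
      assume "m \<beta> \<notin> P"
      then have "- m \<beta> \<in> pos_par M" using WP_inside assms True by blast
      then have "x (- m \<beta>) \<in> P" using pos_par_image_pos assms(1) xy by blast
      then have "- y \<beta> \<in> P" using assms(5) xy W_neg by simp
      moreover have "y \<beta> \<in> P" using pos_par_image_pos assms(1) xy True by blast
      ultimately show False using not_pos_and_neg by blast
    qed
  next
    case False
    then show ?thesis using WP_outside assms that by blast
  qed
  then show "inversions m = {}" by (auto simp: inversions_def)
qed

text \<open>A simple root of \<open>M\<close> that stayed positive could be used to lengthen \<open>w\<close>.\<close>

lemma WP_longest_neg:
  assumes "M \<subseteq> S" "w \<in> WP M" "\<forall>u\<in>WP M. weyl_length D u \<le> weyl_length D w" "\<beta> \<in> pos_par M"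
  shows "- w \<beta> \<in> pos_par M"
proof -
  have wW: "w \<in> W" using assms WP_W by blast
  have neg: "- w \<alpha> \<in> P" if "\<alpha> \<in> M" for \<alpha>
  proof (rule ccontr)
    assume "- w \<alpha> \<notin> P"
    then have "w \<alpha> \<in> P" using W_uminus_pos wW that assms(1) simple_root by blast
    then have "card (inversions (w \<circ> srefl \<alpha>)) = Suc (card (inversions w))"
      using card_inversions_up wW that assms by blast
    moreover have "weyl_length D (w \<circ> srefl \<alpha>) \<le> weyl_length D w"
      using assms that by (simp add: WP_comp WP_refl)
    moreover have "w \<circ> srefl \<alpha> \<in> W" using wW that assms W_comp W_simple_refl by blast
    ultimately show False using wW by (simp add: weyl_length_inversions)
  qed
  have "w \<beta> \<notin> P"
  proof
    assume p: "w \<beta> \<in> P"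
    have "0 \<le> root_coef \<gamma> (- w \<beta>)" if "\<gamma> \<in> S" for \<gamma>
    proof -
      have "linear (\<lambda>x. - w x)" using W_linear[OF wW] by (rule linear_compose_neg)
      from pos_par_image_root_coef[OF assms(1) this assms(4)] show ?thesis
        using neg pos_root_expansion(2) pos_par_pos assms that
        by (auto intro!: sum_nonneg mult_nonneg_nonneg)
    qed
    then have "- w \<beta> \<in> P" using posI p pos_root uminus_root by blast
    then show False using p not_pos_and_neg by blast
  qed
  then show ?thesis using WP_inside assms by blast
qed

text \<open>Two elements that both make the subsystem of \<open>M\<close> negative differ by an element without
  inversions. This is the uniqueness that the definite description of the longest element needs.\<close>

lemma WP_neg_unique:
  assumes "M \<subseteq> S" "u \<in> WP M" "w \<in> WP M"
    and "\<And>\<beta>. \<beta> \<in> pos_par M \<Longrightarrow> - u \<beta> \<in> pos_par M" "\<And>\<beta>. \<beta> \<in> pos_par M \<Longrightarrow> - w \<beta> \<in> pos_par M"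
  shows "inv u \<circ> w = id"
proof (rule no_inversions_id)
  have uw: "u \<in> W" "w \<in> W" "inv u \<in> WP M" "inv u \<in> W" using assms WP_W WP_inv W_inv by auto
  then show "inv u \<circ> w \<in> W" using W_comp by blast
  have "inv u (w \<beta>) \<in> P" if "\<beta> \<in> P" for \<beta>
  proof (cases "\<beta> \<in> pos_par M")
    case True
    then have n: "- w \<beta> \<in> pos_par M" using assms by blast
    show ?thesis
    proof (rule ccontr)
      assume "inv u (w \<beta>) \<notin> P"
      then have "inv u (- w \<beta>) \<in> P"
        using uw W_uminus_pos[of "inv u" "w \<beta>"] W_root[of w \<beta>] that pos_root by (simp add: W_neg)
      then have "inv u (- w \<beta>) \<in> pos_par M" using WP_inside(1)[OF assms(1) uw(3) n] by simp
      then have "- u (inv u (- w \<beta>)) \<in> pos_par M" using assms by blast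
      then have "w \<beta> \<in> pos_par M" using uw by simp
      then show False using n not_pos_and_neg pos_par_pos by blast
    qed
  next
    case False
    then show ?thesis using WP_outside[OF assms(1)] assms(3) uw that by blast
  qed
  then show "inversions (inv u \<circ> w) = {}" by (auto simp: inversions_def)
qed

abbreviation "wl \<equiv> w_long_par D"

lemma wl_properties:
  assumes "M \<subseteq> S"
  shows "wl M \<in> WP M \<and> (\<forall>u\<in>WP M. weyl_length D u \<le> weyl_length D (wl M))"
proof -
  let ?Q = "\<lambda>w. w \<in> WP M \<and> (\<forall>u\<in>WP M. weyl_length D u \<le> weyl_length D w)"
  have fin: "finite (WP M)" by (rule finite_subset[OF _ finite_W]) (use WP_W assms in auto)
  have "Max (weyl_length D ` WP M) \<in> weyl_length D ` WP M"
    using fin WP_id[of M] by (intro Max_in) blast+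
  then obtain w where "w \<in> WP M" "weyl_length D w = Max (weyl_length D ` WP M)" by auto
  then have "?Q w" using fin by simp
  moreover have "u = w" if "?Q u" for u
  proof -
    have "inv u \<circ> w = id"
      using WP_neg_unique[OF assms, of u w] WP_longest_neg[OF assms] that \<open>?Q w\<close> by blast
    moreover have "u \<in> W" using WP_W assms that by blast
    ultimately show ?thesis by (metis W_inv_comp(2) comp_assoc comp_id id_comp)
  qed
  ultimately have "\<exists>!w. ?Q w" by blast
  from theI'[OF this] show ?thesis unfolding w_long_par_def longest_in_def .
qed

lemma wl_WP: "M \<subseteq> S \<Longrightarrow> wl M \<in> WP M"
  using wl_properties by blast

lemma wl_W: "M \<subseteq> S \<Longrightarrow> wl M \<in> W"
  using wl_WP WP_W by blast

lemma wl_neg: "M \<subseteq> S \<Longrightarrow> \<beta> \<in> pos_par M \<Longrightarrow> - wl M \<beta> \<in> pos_par M"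
  using wl_properties[of M] WP_longest_neg[of M "wl M" \<beta>] by blast

lemma wl_invol: assumes "M \<subseteq> S" shows "wl M \<circ> wl M = id"
proof -
  have W: "wl M \<in> W" "inv (wl M) \<in> WP M" using assms wl_WP WP_inv wl_W by blast+
  have "- inv (wl M) \<beta> \<in> pos_par M" if "\<beta> \<in> pos_par M" for \<beta>
  proof (rule WP_inside(2)[OF assms W(2) that])
    show "inv (wl M) \<beta> \<notin> P"
    proof
      assume "inv (wl M) \<beta> \<in> P"
      then have "inv (wl M) \<beta> \<in> pos_par M" using WP_inside(1)[OF assms W(2) that] by blast
      then have "- wl M (inv (wl M) \<beta>) \<in> pos_par M" using wl_neg assms by blast
      then show False using that W not_pos_and_neg pos_par_pos by auto
    qed
  qed
  then have "inv (inv (wl M)) \<circ> wl M = id"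
    using WP_neg_unique[OF assms W(2) wl_WP[OF assms]] wl_neg[OF assms] by blast
  then show ?thesis using W by simp
qed

lemma wl_wl: "M \<subseteq> S \<Longrightarrow> wl M (wl M x) = x"
  using wl_invol by (metis comp_apply id_apply)

lemma inv_wl: "M \<subseteq> S \<Longrightarrow> inv (wl M) = wl M"
  using wl_invol inv_unique_comp by blast

text \<open>\<open>g = - w\<^sub>0\<close> is an involution that preserves the positive roots of \<open>M\<close>. Expanding \<open>g \<alpha>\<close> in simple
  roots and applying \<open>g\<close> again writes the simple root \<open>\<alpha>\<close> as a combination of positive roots with
  nonnegative coefficients, so only multiples of \<open>\<alpha>\<close> can occur.\<close>

lemma neg_wl_permutes:
  assumes "M \<subseteq> S" "\<alpha> \<in> M" shows "- wl M \<alpha> \<in> M"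
proof -
  define g where "g x = - wl M x" for x
  have lin: "linear g" unfolding g_def using W_linear[OF wl_W[OF assms(1)]] by (rule linear_compose_neg)
  have gg: "g (g x) = x" for x using wl_wl assms wl_W by (simp add: g_def W_neg)
  have gPos: "\<beta> \<in> pos_par M \<Longrightarrow> g \<beta> \<in> pos_par M" for \<beta> using wl_neg assms by (simp add: g_def)
  have g\<alpha>: "g \<alpha> \<in> pos_par M" using gPos pos_par_base assms by blast
  have "\<exists>\<delta>\<in>M. root_coef \<delta> (g \<alpha>) \<noteq> 0"
    using pos_par_expansion[OF assms(1) g\<alpha>] pos_par_pos[OF g\<alpha>] pos_root zero_not_root
    by (metis (no_types, lifting) scale_eq_0_iff sum.neutral)
  then obtain \<delta> where \<delta>: "\<delta> \<in> M" "root_coef \<delta> (g \<alpha>) \<noteq> 0" by blast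
  have "g \<delta> = \<alpha>"
  proof (rule pos_single_simple)
    show "g \<delta> \<in> P" using gPos pos_par_base \<delta> assms pos_par_pos by blast
    show "\<alpha> \<in> S" using assms by auto
    fix \<gamma> assume "\<gamma> \<in> S" "\<gamma> \<noteq> \<alpha>"
    have "root_coef \<gamma> (g (g \<alpha>)) = (\<Sum>\<delta>\<in>M. root_coef \<delta> (g \<alpha>) * root_coef \<gamma> (g \<delta>))"
      by (rule pos_par_image_root_coef[OF assms(1) lin g\<alpha>])
    then have "(\<Sum>\<delta>\<in>M. root_coef \<delta> (g \<alpha>) * root_coef \<gamma> (g \<delta>)) = 0"
      using gg assms \<open>\<gamma> \<noteq> \<alpha>\<close> by (auto simp: root_coef_simple)
    moreover have "0 \<le> root_coef \<delta> (g \<alpha>) * root_coef \<gamma> (g \<delta>)" if "\<delta> \<in> M" for \<delta>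
      using that assms(1) \<open>\<gamma> \<in> S\<close> pos_par_pos[OF g\<alpha>] pos_par_pos[OF gPos[OF pos_par_base[OF assms(1) that]]]
      by (intro mult_nonneg_nonneg pos_root_expansion(2)) auto
    moreover have "finite M" using finite_subset assms(1) finite_simple by blast
    ultimately have "root_coef \<delta> (g \<alpha>) * root_coef \<gamma> (g \<delta>) = 0" using \<delta>(1) by (simp add: sum_nonneg_eq_0_iff)
    then show "root_coef \<gamma> (g \<delta>) = 0" using \<delta> by simp
  qed
  then have "g \<alpha> = \<delta>" using gg by metis
  then show ?thesis using \<delta> by (simp add: g_def)
qed


subsection \<open>The element conjugating dual parabolic subgroups\<close>

lemma w_long_eq: "w_long D = wl S"
  by (simp add: w_long_def w_long_par_def W_eq_WP_simple)

lemma delta_par_subset: "M \<subseteq> S \<Longrightarrow> delta_par D M \<subseteq> S"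
  using neg_wl_permutes by (auto simp: delta_par_def w_long_eq)

lemma w_transfer_W: "M \<subseteq> S \<Longrightarrow> w_transfer D M \<in> W"
  by (simp add: w_transfer_def w_long_eq wl_W delta_par_subset W_comp)

lemma inv_w_transfer: "M \<subseteq> S \<Longrightarrow> inv (w_transfer D M) = wl (delta_par D M) \<circ> wl S"
  by (simp add: w_transfer_def w_long_eq wl_W delta_par_subset W_inv_o inv_wl)

lemma inv_w_transfer_base:
  assumes "M \<subseteq> S" "\<alpha> \<in> M" shows "inv (w_transfer D M) \<alpha> \<in> delta_par D M"
proof -
  have "- wl S \<alpha> \<in> delta_par D M" using assms by (auto simp: delta_par_def w_long_eq)
  then have "- wl (delta_par D M) (- wl S \<alpha>) \<in> delta_par D M"
    using neg_wl_permutes delta_par_subset assms by blast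
  then show ?thesis using assms by (simp add: inv_w_transfer W_neg wl_W delta_par_subset)
qed

lemma w_transfer_base:
  assumes "M \<subseteq> S" "\<beta> \<in> delta_par D M" shows "w_transfer D M \<beta> \<in> M"
proof -
  have "- wl (delta_par D M) \<beta> \<in> delta_par D M"
    using neg_wl_permutes delta_par_subset assms by blast
  then obtain \<alpha> where \<alpha>: "\<alpha> \<in> M" "- wl (delta_par D M) \<beta> = - wl S \<alpha>"
    by (auto simp: delta_par_def w_long_eq)
  then have "w_transfer D M \<beta> = \<alpha>"
    by (simp add: w_transfer_def w_long_eq wl_wl)
  then show ?thesis using \<alpha> by simp
qed

lemma WP_conj:
  assumes "u \<in> W" "A \<subseteq> S" "\<And>\<alpha>. \<alpha> \<in> A \<Longrightarrow> u \<alpha> \<in> B" "m \<in> WP A"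
  shows "u \<circ> m \<circ> inv u \<in> WP B"
proof -
  have "A \<subseteq> R" using assms simple_roots by auto
  from this assms(4) show ?thesis
  proof (induction rule: WP_induct)
    case id
    then show ?case using assms by (simp del: id_apply)
  next
    case (srefl \<alpha> m)
    have "u \<circ> (srefl \<alpha> \<circ> m) \<circ> inv u = srefl (u \<alpha>) \<circ> (u \<circ> m \<circ> inv u)"
      using refl_W[OF assms(1), of \<alpha>] srefl.hyps(1) \<open>A \<subseteq> R\<close> by (auto simp flip: comp_assoc)
    then show ?case using srefl assms(3) WP_comp WP_refl by metis
  qed
qed

lemma w_transfer_conj:
  assumes "M \<subseteq> S"
  shows "m \<in> WP M \<Longrightarrow> inv (w_transfer D M) \<circ> m \<circ> w_transfer D M \<in> WP (delta_par D M)"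
    and "m' \<in> WP (delta_par D M) \<Longrightarrow> w_transfer D M \<circ> m' \<circ> inv (w_transfer D M) \<in> WP M"
proof -
  show "inv (w_transfer D M) \<circ> m \<circ> w_transfer D M \<in> WP (delta_par D M)" if "m \<in> WP M"
    using WP_conj[OF W_inv[OF w_transfer_W[OF assms]] assms inv_w_transfer_base[OF assms] that]
    by (simp add: w_transfer_W assms)
  show "w_transfer D M \<circ> m' \<circ> inv (w_transfer D M) \<in> WP M" if "m' \<in> WP (delta_par D M)"
    using WP_conj[OF w_transfer_W[OF assms] delta_par_subset[OF assms] w_transfer_base[OF assms] that]
    by simp
qed

lemma min_reps_transfer:
  assumes "M \<subseteq> S"
  shows "bij_betw (\<lambda>x. x \<circ> w_transfer D M) (min_reps D M) (min_reps D (delta_par D M))"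
proof (rule bij_betw_byWitness[where f' = "\<lambda>y. y \<circ> inv (w_transfer D M)"])
  let ?w = "w_transfer D M"
  note W = w_transfer_W[OF assms] W_inv[OF w_transfer_W[OF assms]]
  show "\<forall>x\<in>min_reps D M. (x \<circ> ?w) \<circ> inv ?w = x" "\<forall>y\<in>min_reps D (delta_par D M). (y \<circ> inv ?w) \<circ> ?w = y"
    using W by (simp_all add: comp_assoc)
  show "(\<lambda>x. x \<circ> ?w) ` min_reps D M \<subseteq> min_reps D (delta_par D M)"
    using W assms w_transfer_base delta_par_subset by (auto simp: min_reps_iff intro: W_comp)
  show "(\<lambda>y. y \<circ> inv ?w) ` min_reps D (delta_par D M) \<subseteq> min_reps D M"
    using W assms inv_w_transfer_base delta_par_subset by (auto simp: min_reps_iff intro: W_comp)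
qed

lemma inv_w_transfer_min_rep: "M \<subseteq> S \<Longrightarrow> inv (w_transfer D M) \<in> min_reps D M"
  by (simp add: min_reps_iff w_transfer_W W_inv)
    (meson inv_w_transfer_base delta_par_subset simple_pos subsetD)

text \<open>\<open>- w\<^sub>0\<close> moves the positive roots outside of the subsystem of \<open>M\<close> to those outside of the dual
  subsystem, and these stay positive under the longest element of the dual parabolic subgroup.\<close>

lemma inv_w_transfer_neg:
  assumes "M \<subseteq> S" "\<beta> \<in> P - pos_par M" shows "inv (w_transfer D M) \<beta> \<notin> P"
proof -
  have neg: "- wl S \<beta> \<in> P" using wl_neg[of S \<beta>] assms by simp
  moreover have "- wl S \<beta> \<notin> pos_par (delta_par D M)"
  proof
    assume Pd: "- wl S \<beta> \<in> pos_par (delta_par D M)"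
    have lin: "linear (\<lambda>x. - wl S x)"
      using W_linear[OF wl_W[OF order_refl]] by (rule linear_compose_neg)
    have in_M: "- wl S \<alpha> \<in> M" if "\<alpha> \<in> delta_par D M" for \<alpha>
      using that by (auto simp: delta_par_def w_long_eq W_neg wl_W wl_wl)
    have "root_coef \<gamma> \<beta> = 0" if "\<gamma> \<in> S - M" for \<gamma>
    proof -
      have "root_coef \<gamma> (- wl S (- wl S \<beta>)) = 0"
        unfolding pos_par_image_root_coef[OF delta_par_subset[OF assms(1)] lin Pd]
      proof (rule sum.neutral, rule ballI)
        fix \<alpha> assume "\<alpha> \<in> delta_par D M"
        then have "root_coef \<gamma> (- wl S \<alpha>) = 0" using in_M[of \<alpha>] that assms by (auto simp: root_coef_simple)
        then show "root_coef \<alpha> (- wl S \<beta>) * root_coef \<gamma> (- wl S \<alpha>) = 0" by simp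
      qed
      then show ?thesis by (simp add: W_neg wl_W wl_wl)
    qed
    then show False using assms by (auto simp: pos_par_def)
  qed
  ultimately have "wl (delta_par D M) (- wl S \<beta>) \<in> P"
    using WP_outside wl_WP delta_par_subset assms by blast
  then have "- inv (w_transfer D M) \<beta> \<in> P"
    using assms by (simp add: inv_w_transfer W_neg wl_W delta_par_subset)
  then show ?thesis using not_pos_and_neg by blast
qed

text \<open>Every element of the coset of \<open>inv (w_transfer D M)\<close> inverts all positive roots outside of
  the parabolic subsystem, and no minimal representative inverts any other root.\<close>

lemma w_transfer_coset_long:
  assumes "M \<subseteq> S" "u \<in> W" "w_transfer D M \<circ> u \<in> WP M" "y \<in> min_reps D M"
  shows "card (inversions y) \<le> card (inversions u)"
proof -
  have y: "y \<in> W" "\<And>\<alpha>. \<alpha> \<in> M \<Longrightarrow> y \<alpha> \<in> P" using assms(1,4) min_reps_iff by auto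
  have "inversions y \<subseteq> P - pos_par M"
    using pos_par_image_pos[OF assms(1) y] by (auto simp: inversions_def)
  moreover have "P - pos_par M \<subseteq> inversions u"
  proof
    fix \<beta> assume b: "\<beta> \<in> P - pos_par M"
    then have "(w_transfer D M \<circ> u) \<beta> \<in> P - pos_par M" using WP_outside assms by blast
    then have "inv (w_transfer D M) ((w_transfer D M \<circ> u) \<beta>) \<notin> P" using inv_w_transfer_neg assms by blast
    then show "\<beta> \<in> inversions u"
      using b w_transfer_W[OF assms(1)] by (simp add: inversions_def)
  qed
  ultimately show ?thesis using card_mono finite_inversions by (metis subset_trans)
qed

end

section \<open>The symmetric algebra\<close>

lemma sym_const_add: "sym_const (c + d) = sym_const c + sym_const d"
  and sym_const_mult: "sym_const (c * d) = sym_const c * sym_const d"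
  and sym_const_0 [simp]: "sym_const 0 = 0"
  and sym_const_1 [simp]: "sym_const 1 = 1"
  by (simp_all add: sym_const.abs_eq plus_symalg.abs_eq times_symalg.abs_eq zero_symalg_def
      one_symalg_def vconst_def single_add mult_single single_one)

lemma sym_vec_add: "sym_vec (y + z) = sym_vec y + sym_vec z"
  unfolding sym_vec.abs_eq plus_symalg.abs_eq symalg.abs_eq_iff lin_cong_def by (rule lin_ideal.rel_add)

lemma sym_vec_scale: "sym_vec (cx_scale c z) = sym_const c * sym_vec z"
  unfolding sym_vec.abs_eq times_symalg.abs_eq sym_const.abs_eq symalg.abs_eq_iff lin_cong_def
  by (rule lin_ideal.rel_scale)

text \<open>The symmetric algebra is generated by constants and vectors.\<close>

lemma symalg_induct [case_names const vec add mult]: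
  fixes a :: "'v::real_vector symalg"
  assumes const: "\<And>c. Q (sym_const c)" and vec: "\<And>z. Q (sym_vec z)"
    and add: "\<And>a b. Q a \<Longrightarrow> Q b \<Longrightarrow> Q (a + b)" and mult: "\<And>a b. Q a \<Longrightarrow> Q b \<Longrightarrow> Q (a * b)"
  shows "Q a"
proof (induct a rule: symalg.abs_induct)
  fix p :: "'v vpoly"
  have single: "Q (abs_symalg (Poly_Mapping.single m c))" for m c
  proof (induction m)
    case empty
    then show ?case using const[of c] by (simp add: sym_const.abs_eq vconst_def)
  next
    case (add z m)
    have "abs_symalg (Poly_Mapping.single (add_mset z m) c)
        = sym_vec z * abs_symalg (Poly_Mapping.single m c)"
      by (simp add: sym_vec.abs_eq times_symalg.abs_eq vvar_def mult_single)
    then show ?case using mult[OF vec add] by simp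
  qed
  have "Q (abs_symalg (\<Sum>m\<in>A. Poly_Mapping.single m (f m)))" if "finite A" for A f
    using that
  proof induction
    case empty
    then show ?case using const[of 0] by (simp add: zero_symalg_def)
  next
    case (insert m A)
    then show ?case using add[OF single insert.IH] by (simp add: plus_symalg.abs_eq)
  qed
  from this[of "Poly_Mapping.keys p" "Poly_Mapping.lookup p"] show "Q (abs_symalg p)"
    by (simp add: vpoly_decomp[symmetric])
qed

lemma sym_map_id: "sym_map id a = a"
  by (induction a rule: symalg_induct)
    (simp_all add: sym_map_hom[OF linear_id] cx_map_def prod.map_id del: id_apply)

lemma sym_map_comp:
  assumes "linear f" "linear g" shows "sym_map f (sym_map g a) = sym_map (f \<circ> g) a"
  by (induction a rule: symalg_induct)
    (simp_all add: sym_map_hom[OF assms(1)] sym_map_hom[OF assms(2)]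
      sym_map_hom[OF linear_compose[OF assms(2,1)]] cx_map_def prod.map_comp del: comp_apply)

lemma sym_map_0: "linear f \<Longrightarrow> sym_map f 0 = 0"
  and sym_map_1: "linear f \<Longrightarrow> sym_map f 1 = 1"
  using sym_map_hom(3)[of f 0] sym_map_hom(3)[of f 1] by simp_all

lemma sym_map_diff: "linear f \<Longrightarrow> sym_map f (a - b) = sym_map f a - sym_map f b"
  using sym_map_hom(1)[of f "a - b" b] by (simp add: algebra_simps)

text \<open>Complex conjugation of the symmetric algebra, as the conjugate-linear ring endomorphism of the
  polynomial ring that conjugates variables and coefficients. It preserves the ideal of linear
  relations, so that it descends.\<close>

definition vpoly_cnj :: "'v::real_vector vpoly \<Rightarrow> 'v vpoly" where
  "vpoly_cnj p = (\<Sum>m\<in>Poly_Mapping.keys p.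
     Poly_Mapping.single (image_mset cx_cnj m) (cnj (Poly_Mapping.lookup p m)))"

lemma vpoly_cnj_superset:
  assumes "finite A" "Poly_Mapping.keys p \<subseteq> A"
  shows "vpoly_cnj p = (\<Sum>m\<in>A. Poly_Mapping.single (image_mset cx_cnj m) (cnj (Poly_Mapping.lookup p m)))"
  unfolding vpoly_cnj_def using assms
  by (intro sum.mono_neutral_left) (auto simp: in_keys_iff)

lemma vpoly_cnj_0: "vpoly_cnj 0 = 0"
  by (simp add: vpoly_cnj_def)

lemma vpoly_cnj_single:
  "vpoly_cnj (Poly_Mapping.single m c) = Poly_Mapping.single (image_mset cx_cnj m) (cnj c)"
  by (cases "c = 0") (simp_all add: vpoly_cnj_def)

lemma vpoly_cnj_add: "vpoly_cnj (p + q) = vpoly_cnj p + vpoly_cnj q"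
proof -
  let ?A = "Poly_Mapping.keys p \<union> Poly_Mapping.keys q"
  have "Poly_Mapping.keys (p + q) \<subseteq> ?A"
    by (rule Poly_Mapping.keys_add)
  then show ?thesis
    by (simp add: vpoly_cnj_superset[of ?A] lookup_add single_add sum.distrib)
qed

lemma vpoly_cnj_diff: "vpoly_cnj (p - q) = vpoly_cnj p - vpoly_cnj q"
  using vpoly_cnj_add[of "p - q" q] by (simp add: algebra_simps)

lemma vpoly_cnj_sum: "vpoly_cnj (sum g A) = (\<Sum>i\<in>A. vpoly_cnj (g i))"
  by (induction A rule: infinite_finite_induct) (simp_all add: vpoly_cnj_0 vpoly_cnj_add)

lemma vpoly_cnj_mult: "vpoly_cnj (p * q) = vpoly_cnj p * vpoly_cnj q"
proof -
  let ?s = "\<lambda>p m. Poly_Mapping.single m (Poly_Mapping.lookup p m)"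
  have "p * q = (\<Sum>m\<in>Poly_Mapping.keys p. \<Sum>n\<in>Poly_Mapping.keys q. ?s p m * ?s q n)"
    by (simp only: vpoly_decomp[symmetric] sum_product[symmetric])
  then show ?thesis
    by (simp add: vpoly_cnj_sum mult_single vpoly_cnj_single)
       (simp add: vpoly_cnj_def sum_product mult_single)
qed

lemma vpoly_cnj_ideal: "p \<in> lin_ideal \<Longrightarrow> vpoly_cnj p \<in> lin_ideal"
proof (induction rule: lin_ideal.induct)
  case zero
  then show ?case by (simp add: vpoly_cnj_0 lin_ideal.zero)
next
  case (add p q)
  then show ?case by (simp add: vpoly_cnj_add lin_ideal.add)
next
  case (mult p q)
  then show ?case by (simp add: vpoly_cnj_mult lin_ideal.mult)
next
  case (rel_add y z)
  have "vpoly_cnj (vvar (y + z) - (vvar y + vvar z))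
      = vvar (cx_cnj y + cx_cnj z) - (vvar (cx_cnj y) + vvar (cx_cnj z))"
    by (simp add: vpoly_cnj_diff vpoly_cnj_add vvar_def vpoly_cnj_single cx_cnj_def)
  then show ?case by (simp only: lin_ideal.rel_add)
next
  case (rel_scale c z)
  have "vpoly_cnj (vvar (cx_scale c z) - vconst c * vvar z)
      = vvar (cx_scale (cnj c) (cx_cnj z)) - vconst (cnj c) * vvar (cx_cnj z)"
    by (simp add: vpoly_cnj_diff vpoly_cnj_mult vconst_def vvar_def vpoly_cnj_single cx_cnj_def
          cx_scale_def)
  then show ?case by (simp only: lin_ideal.rel_scale)
qed

lift_definition sym_cnj :: "'v::real_vector symalg \<Rightarrow> 'v symalg" is vpoly_cnj
  unfolding lin_cong_def by (metis vpoly_cnj_diff vpoly_cnj_ideal)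

lemma sym_cnj_hom:
  "sym_cnj (a + b) = sym_cnj a + sym_cnj b" "sym_cnj (a * b) = sym_cnj a * sym_cnj b"
  "sym_cnj (sym_const c) = sym_const (cnj c)" "sym_cnj (sym_vec z) = sym_vec (cx_cnj z)"
proof -
  show "sym_cnj (a + b) = sym_cnj a + sym_cnj b"
    by (induct a rule: symalg.abs_induct, induct b rule: symalg.abs_induct)
       (simp add: plus_symalg.abs_eq sym_cnj.abs_eq vpoly_cnj_add)
  show "sym_cnj (a * b) = sym_cnj a * sym_cnj b"
    by (induct a rule: symalg.abs_induct, induct b rule: symalg.abs_induct)
       (simp add: times_symalg.abs_eq sym_cnj.abs_eq vpoly_cnj_mult)
  show "sym_cnj (sym_const c) = sym_const (cnj c)"
    by (simp add: sym_const.abs_eq sym_cnj.abs_eq vconst_def vpoly_cnj_single)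
  show "sym_cnj (sym_vec z) = sym_vec (cx_cnj z)"
    by (simp add: sym_vec.abs_eq sym_cnj.abs_eq vvar_def vpoly_cnj_single)
qed

lemma sym_cnj_cnj: "sym_cnj (sym_cnj a) = a"
  by (induction a rule: symalg_induct) (simp_all add: sym_cnj_hom cx_cnj_def)

lemma sym_cnj_0: "sym_cnj 0 = 0" and sym_cnj_1: "sym_cnj 1 = 1"
  using sym_cnj_hom(3)[of 0] sym_cnj_hom(3)[of 1] by simp_all

lemma sym_cnj_diff: "sym_cnj (a - b) = sym_cnj a - sym_cnj b"
  using sym_cnj_hom(1)[of "a - b" b] by (simp add: algebra_simps)

lemma sym_cnj_map: "linear f \<Longrightarrow> sym_cnj (sym_map f a) = sym_map f (sym_cnj a)"
  by (induction a rule: symalg_induct)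
    (simp_all add: sym_map_hom sym_cnj_hom cx_map_def cx_cnj_def linear_neg split_beta)

context root_datum
begin

text \<open>On a vector the difference is a multiple of \<open>\<alpha>\<close> by definition of the reflection; products
  follow from the twisted Leibniz rule \<open>a b - s a s b = (a - s a) b + s a (b - s b)\<close>.\<close>

lemma divided_difference:
  "\<exists>q. sym_vec (\<alpha>, 0) * q = a - sym_map (srefl \<alpha>) a"
proof (induction a rule: symalg_induct)
  case (const c)
  then show ?case by (intro exI[of _ 0]) (simp add: sym_map_hom[OF linear_refl])
next
  case (vec z)
  let ?c = "Complex (pair (fst z) (co \<alpha>)) (pair (snd z) (co \<alpha>))"
  have "z = cx_map (srefl \<alpha>) z + cx_scale ?c (\<alpha>, 0)"
    by (simp add: cx_map_def cx_scale_def reflection_def prod_eq_iff)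
  then have "sym_vec z = sym_vec (cx_map (srefl \<alpha>) z) + sym_const ?c * sym_vec (\<alpha>, 0)"
    by (metis sym_vec_add sym_vec_scale)
  then show ?case
    unfolding sym_map_hom(4)[OF linear_refl] by (metis add_diff_cancel_left' mult.commute)
next
  case (add a b)
  then obtain p q where "sym_vec (\<alpha>, 0) * p = a - sym_map (srefl \<alpha>) a"
      "sym_vec (\<alpha>, 0) * q = b - sym_map (srefl \<alpha>) b" by blast
  then show ?case
    by (intro exI[of _ "p + q"]) (simp add: sym_map_hom[OF linear_refl] algebra_simps)
next
  case (mult a b)
  then obtain p q where pq: "sym_vec (\<alpha>, 0) * p = a - sym_map (srefl \<alpha>) a"
      "sym_vec (\<alpha>, 0) * q = b - sym_map (srefl \<alpha>) b" by blast
  have "sym_vec (\<alpha>, 0) * (p * b + sym_map (srefl \<alpha>) a * q)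
      = (sym_vec (\<alpha>, 0) * p) * b + sym_map (srefl \<alpha>) a * (sym_vec (\<alpha>, 0) * q)"
    by (simp add: algebra_simps)
  also have "\<dots> = a * b - sym_map (srefl \<alpha>) (a * b)"
    unfolding pq sym_map_hom[OF linear_refl] by (simp add: algebra_simps)
  finally show ?case by blast
qed

end


section \<open>Graded Hecke algebras\<close>

locale hecke = root_datum D
  for D :: "('v::real_vector, 'w::real_vector) root_data" +
  fixes k :: "'v \<Rightarrow> real" and H :: "('v, 'h::ring_1) hecke_data"
  assumes param: "parameter_function D k" and gha: "graded_hecke_algebra D k H"
begin

abbreviation "T \<equiv> ha_t H"
abbreviation "I \<equiv> ha_inc H"
abbreviation "sc \<equiv> ha_scale H"
abbreviation "HP \<equiv> hecke_par D H"

lemma T_id [simp]: "T id = 1"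
  and T_mult: "u \<in> W \<Longrightarrow> w \<in> W \<Longrightarrow> T u * T w = T (u \<circ> w)"
  and I_1 [simp]: "I 1 = 1"
  and I_add: "I (a + b) = I a + I b"
  and I_mult: "I (a * b) = I a * I b"
  and I_scale: "I (sym_const c * a) = sc c (I a)"
  and sc_mult_left: "sc c x * y = sc c (x * y)"
  and sc_mult_right: "x * sc c y = sc c (x * y)"
  and bij_coefficients:
    "bij_betw (\<lambda>c. \<Sum>w\<in>W. T w * I (c w)) {c. \<forall>w. w \<notin> W \<longrightarrow> c w = 0} UNIV"
  and cross: "\<alpha> \<in> S \<Longrightarrow> sym_vec (\<alpha>, 0) * q = a - sym_map (srefl \<alpha>) a \<Longrightarrow>
      I a * T (srefl \<alpha>) = T (srefl \<alpha>) * I (sym_map (srefl \<alpha>) a) + sc (complex_of_real (k \<alpha>)) (I q)"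
  using gha unfolding graded_hecke_algebra_def by auto

lemma I_0 [simp]: "I 0 = 0"
  using I_add[of 0 0] by simp

lemma sc_1: "sc c 1 = I (sym_const c)"
  using I_scale[of c 1] by simp

text \<open>Scalars act through the central constants of the symmetric algebra.\<close>

lemma sc_eq: "sc c x = I (sym_const c) * x" "sc c x = x * I (sym_const c)"
  using sc_mult_left[of c 1 x] sc_mult_right[of x c 1] by (simp_all add: sc_1)

lemma sc_add_left: "sc (c + d) x = sc c x + sc d x"
  by (simp add: sc_eq(1) algebra_simps sym_const_add I_add)

lemma sc_sc: "sc c (sc d x) = sc (c * d) x"
  by (simp add: sc_eq(1) mult.assoc sym_const_mult I_mult)

lemma sc_1_left [simp]: "sc 1 x = x"
  by (simp add: sc_eq(1))

lemma cross_ex: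
  assumes "\<alpha> \<in> S"
  obtains q where "sym_vec (\<alpha>, 0) * q = a - sym_map (srefl \<alpha>) a"
    "I a * T (srefl \<alpha>) = T (srefl \<alpha>) * I (sym_map (srefl \<alpha>) a) + sc (complex_of_real (k \<alpha>)) (I q)"
  using divided_difference cross[OF assms] by blast

subsection \<open>Coefficients\<close>

text \<open>The coefficient \<open>a\<^sub>w\<close> in the expansion \<open>h = \<Sum>w. t\<^sub>w a\<^sub>w\<close>.\<close>

definition coeff :: "'h \<Rightarrow> ('v \<Rightarrow> 'v) \<Rightarrow> 'v symalg" where
  "coeff h = the_inv_into {c. \<forall>w. w \<notin> W \<longrightarrow> c w = 0} (\<lambda>c. \<Sum>w\<in>W. T w * I (c w)) h"

lemma coeff_expansion: "(\<Sum>w\<in>W. T w * I (coeff h w)) = h"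
  unfolding coeff_def by (rule f_the_inv_into_f_bij_betw[OF bij_coefficients]) simp

lemma coeff_outside: "w \<notin> W \<Longrightarrow> coeff h w = 0"
  using bij_betwE[OF bij_betw_the_inv_into[OF bij_coefficients]] unfolding coeff_def by blast

lemma coeff_unique:
  assumes "\<And>w. w \<notin> W \<Longrightarrow> c w = 0" "h = (\<Sum>w\<in>W. T w * I (c w))" shows "coeff h = c"
  unfolding coeff_def assms(2)
  by (rule the_inv_into_f_f[OF bij_betw_imp_inj_on[OF bij_coefficients]]) (use assms in auto)

lemma coeff_add: "coeff (g + h) w = coeff g w + coeff h w"
proof -
  have "coeff (g + h) = (\<lambda>w. coeff g w + coeff h w)"
    by (rule coeff_unique)
      (simp_all add: coeff_outside I_add distrib_left sum.distrib coeff_expansion)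
  then show ?thesis by simp
qed

lemma coeff_mult_I: "coeff (h * I b) w = coeff h w * b"
proof -
  have "coeff (h * I b) = (\<lambda>w. coeff h w * b)"
    by (rule coeff_unique)
      (simp_all add: coeff_outside I_mult sum_distrib_right[symmetric] mult.assoc[symmetric] coeff_expansion)
  then show ?thesis by simp
qed

lemma coeff_T_I:
  assumes "u \<in> W" shows "coeff (T u * I a) w = (if w = u then a else 0)"
proof -
  have "coeff (T u * I a) = (\<lambda>w. if w = u then a else 0)"
  proof (rule coeff_unique)
    have "(\<Sum>w\<in>W. T w * I (if w = u then a else 0)) = (\<Sum>w\<in>W. if w = u then T w * I a else 0)"
      by (rule sum.cong) auto
    then show "T u * I a = (\<Sum>w\<in>W. T w * I (if w = u then a else 0))"
      using assms finite_W by simp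
  qed (use assms in auto)
  then show ?thesis by simp
qed

lemma coeff_0 [simp]: "coeff 0 w = 0"
  using coeff_add[of 0 0 w] by simp

lemma coeff_sum: "coeff (sum f A) w = (\<Sum>i\<in>A. coeff (f i) w)"
  by (induction A rule: infinite_finite_induct) (simp_all add: coeff_add)

lemma coeff_T_mult:
  assumes "u \<in> W" shows "coeff (T u * h) w = coeff h (inv u \<circ> w)"
proof -
  have eq: "w = u \<circ> v \<longleftrightarrow> v = inv u \<circ> w" for v
    using assms by (metis W_inv_comp comp_assoc id_comp)
  have "T u * h = (\<Sum>v\<in>W. T u * (T v * I (coeff h v)))"
    by (simp only: sum_distrib_left[symmetric] coeff_expansion)
  also have "\<dots> = (\<Sum>v\<in>W. T (u \<circ> v) * I (coeff h v))"
    using assms by (simp add: mult.assoc[symmetric] T_mult)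
  finally have "coeff (T u * h) w = (\<Sum>v\<in>W. if v = inv u \<circ> w then coeff h v else 0)"
    using assms by (simp add: coeff_sum coeff_T_I W_comp eq cong: sum.cong)
  then show ?thesis using finite_W by (simp add: coeff_outside)
qed

subsection \<open>Parabolic subalgebras\<close>

text \<open>The additive map given on the basis by \<open>t\<^sub>m a \<mapsto> g m a\<close> for \<open>m\<close> in the parabolic subgroup and
  by zero on the other cosets. The star operation, the transfer map and the projection to a
  parabolic subalgebra all arise in this way.\<close>

definition coeff_ext :: "'v set \<Rightarrow> (('v \<Rightarrow> 'v) \<Rightarrow> 'v symalg \<Rightarrow> 'h) \<Rightarrow> 'h \<Rightarrow> 'h" where
  "coeff_ext M g h = (\<Sum>m\<in>WP M. g m (coeff h m))"

lemma finite_WP: "M \<subseteq> S \<Longrightarrow> finite (WP M)"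
  by (rule finite_subset[OF _ finite_W]) (auto intro: WP_W)

lemma coeff_ext_add:
  assumes "\<And>m a b. g m (a + b) = g m a + g m b"
  shows "coeff_ext M g (x + y) = coeff_ext M g x + coeff_ext M g y"
  by (simp add: coeff_ext_def coeff_add assms sum.distrib)

lemma coeff_ext_T_I:
  assumes "\<And>m. g m 0 = 0" "M \<subseteq> S" "u \<in> W"
  shows "coeff_ext M g (T u * I a) = (if u \<in> WP M then g u a else 0)"
proof -
  have "coeff_ext M g (T u * I a) = (\<Sum>m\<in>WP M. if m = u then g u a else 0)"
    unfolding coeff_ext_def by (rule sum.cong) (simp_all add: coeff_T_I assms)
  then show ?thesis using finite_WP assms by simp
qed

lemma hecke_induct [case_names T_I add]:
  assumes "\<And>w a. w \<in> W \<Longrightarrow> Q (T w * I a)" "\<And>x y. Q x \<Longrightarrow> Q y \<Longrightarrow> Q (x + y)"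
  shows "Q h"
proof -
  have Q0: "Q 0" using assms(1)[of id 0] by simp
  have "Q (\<Sum>w\<in>A. T w * I (coeff h w))" if "A \<subseteq> W" for A
    using finite_subset[OF that finite_W] that by induction (use assms Q0 in auto)
  from this[of W] show ?thesis by (simp add: coeff_expansion)
qed

text \<open>A description of the parabolic subalgebra by supports; the two are identified in \<open>HP_eq\<close>.\<close>

definition coeffs_in :: "'v set \<Rightarrow> 'h set" where
  "coeffs_in M = {h. \<forall>w. w \<notin> WP M \<longrightarrow> coeff h w = 0}"

lemma coeffs_in_add: "x \<in> coeffs_in M \<Longrightarrow> y \<in> coeffs_in M \<Longrightarrow> x + y \<in> coeffs_in M"
  and coeffs_in_mult_I: "x \<in> coeffs_in M \<Longrightarrow> x * I a \<in> coeffs_in M"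
  by (simp_all add: coeffs_in_def coeff_add coeff_mult_I)

lemma coeffs_in_T_I: "M \<subseteq> S \<Longrightarrow> m \<in> WP M \<Longrightarrow> T m * I a \<in> coeffs_in M"
  using WP_W by (auto simp: coeffs_in_def coeff_T_I)

lemma coeffs_in_induct [consumes 2, case_names T_I add]:
  assumes "M \<subseteq> S" "h \<in> coeffs_in M"
    "\<And>m a. m \<in> WP M \<Longrightarrow> Q (T m * I a)" "\<And>x y. Q x \<Longrightarrow> Q y \<Longrightarrow> Q (x + y)"
  shows "Q h"
proof -
  have Q0: "Q 0" using assms(3)[of id 0] by simp
  have "Q (\<Sum>w\<in>A. T w * I (coeff h w))" if "A \<subseteq> WP M" for A
    using finite_subset[OF that finite_WP[OF assms(1)]] that by induction (use assms Q0 in auto)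
  moreover have "(\<Sum>w\<in>WP M. T w * I (coeff h w)) = (\<Sum>w\<in>W. T w * I (coeff h w))"
    using assms WP_W finite_W by (intro sum.mono_neutral_left) (auto simp: coeffs_in_def)
  ultimately show ?thesis by (metis coeff_expansion order_refl)
qed

text \<open>Commuting \<open>a\<close> past a simple reflection of \<open>M\<close> leaves the support inside the parabolic subgroup.\<close>

lemma coeffs_in_mult_T:
  assumes "M \<subseteq> S" "m \<in> WP M" "h \<in> coeffs_in M" shows "h * T m \<in> coeffs_in M"
proof -
  have "M \<subseteq> R" using assms simple_roots by auto
  then have "\<forall>h\<in>coeffs_in M. h * T m \<in> coeffs_in M"
    using assms(2)
  proof (induction rule: WP_induct)
    case (srefl \<alpha> w)
    have \<alpha>: "\<alpha> \<in> S" "srefl \<alpha> \<in> W" "srefl \<alpha> \<in> WP M" "w \<in> W"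
      using srefl assms W_simple_refl WP_refl WP_W by auto
    have "h * T (srefl \<alpha>) \<in> coeffs_in M" if "h \<in> coeffs_in M" for h
      using assms(1) that
    proof (induction rule: coeffs_in_induct)
      case (T_I m a)
      obtain q where q: "I a * T (srefl \<alpha>)
          = T (srefl \<alpha>) * I (sym_map (srefl \<alpha>) a) + sc (complex_of_real (k \<alpha>)) (I q)"
        using cross_ex[OF \<alpha>(1)] by metis
      have "T m * I a * T (srefl \<alpha>) = T (m \<circ> srefl \<alpha>) * I (sym_map (srefl \<alpha>) a)
          + T m * I (sym_const (complex_of_real (k \<alpha>)) * q)"
        using T_I WP_W[OF assms(1)] \<alpha>(2)
        by (simp add: mult.assoc q distrib_left I_scale T_mult flip: mult.assoc[of "T m" "T (srefl \<alpha>)"])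
      then show ?case
        using T_I \<alpha> assms by (simp add: coeffs_in_add coeffs_in_T_I WP_comp)
    next
      case (add x y)
      then show ?case by (simp add: distrib_right coeffs_in_add)
    qed
    then show ?case
      using srefl.IH \<alpha> by (metis T_mult mult.assoc)
  qed (simp del: id_apply)
  then show ?thesis using assms by blast
qed

lemma coeffs_in_mult:
  assumes "M \<subseteq> S" "g \<in> coeffs_in M" "h \<in> coeffs_in M" shows "g * h \<in> coeffs_in M"
  using assms(1,3)
proof (induction rule: coeffs_in_induct)
  case (T_I m a)
  then show ?case
    using coeffs_in_mult_I[OF coeffs_in_mult_T[OF assms(1) T_I assms(2)]] by (simp add: mult.assoc)
qed (simp add: distrib_left coeffs_in_add)

lemma HP_closed:
  shows HP_1: "1 \<in> HP M" and HP_add: "x \<in> HP M \<Longrightarrow> y \<in> HP M \<Longrightarrow> x + y \<in> HP M"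
    and HP_mult: "x \<in> HP M \<Longrightarrow> y \<in> HP M \<Longrightarrow> x * y \<in> HP M"
    and HP_scale: "x \<in> HP M \<Longrightarrow> sc c x \<in> HP M"
    and HP_T: "m \<in> WP M \<Longrightarrow> T m \<in> HP M" and HP_I: "I a \<in> HP M"
  unfolding hecke_par_def by (auto intro: generated_algebra.intros)

lemma HP_eq:
  assumes "M \<subseteq> S" shows "HP M = coeffs_in M"
proof (intro equalityI subsetI)
  have I_in: "I a \<in> coeffs_in M" for a using coeffs_in_T_I[OF assms WP_id, of a] by simp
  have T_in: "T m \<in> coeffs_in M" if "m \<in> WP M" for m using coeffs_in_T_I[OF assms that, of 1] by simp
  fix h assume "h \<in> HP M"
  then show "h \<in> coeffs_in M"
    unfolding hecke_par_def
  proof (induction rule: generated_algebra.induct)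
    case one
    then show ?case using I_in[of 1] by simp
  next
    case (scale x c)
    then show ?case using coeffs_in_mult_I[of x M "sym_const c"] by (simp add: sc_eq(2)[of c x])
  qed (use I_in T_in coeffs_in_add coeffs_in_mult[OF assms] in auto)
next
  fix h assume "h \<in> coeffs_in M"
  with assms show "h \<in> HP M"
    by (induction rule: coeffs_in_induct) (auto intro: HP_closed)
qed

lemma HP_induct [consumes 2, case_names T_I add]:
  assumes "M \<subseteq> S" "h \<in> HP M"
    "\<And>m a. m \<in> WP M \<Longrightarrow> Q (T m * I a)"
    "\<And>x y. x \<in> HP M \<Longrightarrow> y \<in> HP M \<Longrightarrow> Q x \<Longrightarrow> Q y \<Longrightarrow> Q (x + y)"
  shows "Q h"
proof -
  have "h \<in> coeffs_in M" using assms HP_eq by simp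
  with assms(1) have "h \<in> HP M \<and> Q h"
    by (induction rule: coeffs_in_induct) (auto intro: HP_closed assms(3,4))
  then show ?thesis ..
qed

text \<open>Multiplicativity of a map is most easily checked for the generators on one side, which is what
  this rule is for.\<close>

lemma HP_gen_induct [consumes 2, case_names I T add mult]:
  assumes "M \<subseteq> S" "h \<in> HP M"
    and I: "\<And>a. Q (I a)" and T: "\<And>\<alpha>. \<alpha> \<in> M \<Longrightarrow> Q (T (srefl \<alpha>))"
    and add: "\<And>x y. x \<in> HP M \<Longrightarrow> y \<in> HP M \<Longrightarrow> Q x \<Longrightarrow> Q y \<Longrightarrow> Q (x + y)"
    and mult: "\<And>x y. x \<in> HP M \<Longrightarrow> y \<in> HP M \<Longrightarrow> Q x \<Longrightarrow> Q y \<Longrightarrow> Q (x * y)"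
  shows "Q h"
  using assms(1,2)
proof (induction rule: HP_induct)
  case (T_I m a)
  have "M \<subseteq> R" using assms simple_roots by auto
  then have "Q (T m)"
    using T_I
  proof (induction rule: WP_induct)
    case id
    then show ?case using I[of 1] by (simp del: id_apply)
  next
    case (srefl \<alpha> w)
    then have "T (srefl \<alpha> \<circ> w) = T (srefl \<alpha>) * T w"
      using T_mult assms W_simple_refl WP_W by (metis subsetD)
    then show ?case using mult[of "T (srefl \<alpha>)" "T w"] srefl T HP_T WP_refl by metis
  qed
  then show ?case using mult T_I I HP_T HP_I by blast
qed (rule add)

lemma HP_simple: "HP S = UNIV"
  by (auto simp: HP_eq coeffs_in_def coeff_outside simp flip: W_eq_WP_simple)

subsection \<open>The projection onto a parabolic subalgebra\<close>

definition proj :: "'v set \<Rightarrow> 'h \<Rightarrow> 'h" where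
  "proj M = coeff_ext M (\<lambda>m a. T m * I a)"

lemma proj_add: "proj M (x + y) = proj M x + proj M y"
  unfolding proj_def by (rule coeff_ext_add) (simp add: I_add distrib_left)

lemma proj_T_I: "M \<subseteq> S \<Longrightarrow> u \<in> W \<Longrightarrow> proj M (T u * I a) = (if u \<in> WP M then T u * I a else 0)"
  unfolding proj_def by (rule coeff_ext_T_I) simp_all

lemma proj_HP: "proj M x \<in> HP M"
proof -
  have "(\<Sum>m\<in>A. T m * I (coeff x m)) \<in> HP M" if "A \<subseteq> WP M" for A
    using that
  proof (induction A rule: infinite_finite_induct)
    case (insert m A)
    then show ?case by (simp add: HP_add HP_mult HP_T HP_I)
  qed (use HP_I[of 0 M] in simp_all)
  then show ?thesis by (simp add: proj_def coeff_ext_def)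
qed

lemma proj_eq_0: "(\<And>m. m \<in> WP M \<Longrightarrow> coeff x m = 0) \<Longrightarrow> proj M x = 0"
  unfolding proj_def coeff_ext_def by (intro sum.neutral) simp

lemma proj_HP_id:
  assumes "M \<subseteq> S" "x \<in> HP M" shows "proj M x = x"
  using assms by (induction rule: HP_induct) (simp_all add: proj_add proj_T_I assms(1) WP_W[OF assms(1)])

lemma WP_cancel:
  assumes "M \<subseteq> S" "m \<in> WP M"
  shows "u \<circ> m \<in> WP M \<longleftrightarrow> u \<in> WP M" and "m \<circ> u \<in> WP M \<longleftrightarrow> u \<in> WP M"
proof -
  have m: "m \<in> W" "inv m \<in> WP M" using assms WP_W WP_inv by auto
  then have "u = (u \<circ> m) \<circ> inv m" "u = inv m \<circ> (m \<circ> u)" by (simp_all add: comp_assoc fun_eq_iff)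
  then show "u \<circ> m \<in> WP M \<longleftrightarrow> u \<in> WP M" "m \<circ> u \<in> WP M \<longleftrightarrow> u \<in> WP M"
    using assms(2) m(2) WP_comp by metis+
qed

lemma proj_coset_HP:
  assumes "M \<subseteq> S" "u \<in> W" "n \<in> HP M"
  shows "proj M (T u * n) = (if u \<in> WP M then T u * n else 0)"
  using assms(1,3)
proof (induction rule: HP_induct)
  case (T_I m a)
  have m: "m \<in> W" "inv m \<in> WP M" using T_I assms WP_W WP_inv by auto
  have "u \<circ> m \<in> WP M \<longleftrightarrow> u \<in> WP M" using T_I assms by (intro WP_cancel)
  then show ?case
    using proj_T_I[OF assms(1), of "u \<circ> m" a] assms m
    by (simp add: T_mult W_comp flip: mult.assoc)
qed (simp add: distrib_left proj_add)

text \<open>Right multiplication by the parabolic subalgebra preserves each of the spaces \<open>t\<^sub>w\<close> times the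
  parabolic subalgebra, and the projection selects one of them.\<close>

lemma proj_mult:
  assumes "M \<subseteq> S" "n \<in> HP M" shows "proj M (h * n) = proj M h * n"
proof (induction h rule: hecke_induct)
  case (T_I w a)
  have "I a * n \<in> HP M" using assms HP_I HP_mult by blast
  then show ?case using assms T_I by (simp add: mult.assoc proj_coset_HP HP_I)
qed (simp add: distrib_right proj_add)

lemma proj_T_mult:
  assumes "M \<subseteq> S" "m \<in> WP M" shows "proj M (T m * h) = T m * proj M h"
proof (induction h rule: hecke_induct)
  case (T_I w a)
  have m: "m \<in> W" "inv m \<in> WP M" using assms WP_W WP_inv by auto
  have "m \<circ> w \<in> WP M \<longleftrightarrow> w \<in> WP M" using assms by (intro WP_cancel)
  then show ?case
    using proj_T_I[OF assms(1), of "m \<circ> w" a] assms m T_I proj_T_I[OF assms(1) T_I, of a]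
    by (simp add: T_mult W_comp flip: mult.assoc)
qed (simp add: distrib_left proj_add)

text \<open>Supported on Weyl group elements with fewer than \<open>n\<close> inversions.\<close>

definition shorter :: "nat \<Rightarrow> 'h \<Rightarrow> bool" where
  "shorter n h \<longleftrightarrow> (\<forall>v\<in>W. coeff h v \<noteq> 0 \<longrightarrow> card (inversions v) < n)"

lemma shorter_add: "shorter n x \<Longrightarrow> shorter n y \<Longrightarrow> shorter n (x + y)"
  unfolding shorter_def coeff_add by (metis add_0)

lemma shorter_T_I: "u \<in> W \<Longrightarrow> card (inversions u) < n \<or> a = 0 \<Longrightarrow> shorter n (T u * I a)"
  by (auto simp: shorter_def coeff_T_I)

lemma shorter_sum: "(\<And>i. i \<in> A \<Longrightarrow> shorter n (f i)) \<Longrightarrow> shorter n (sum f A)"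
  by (induction A rule: infinite_finite_induct) (auto intro: shorter_add simp: shorter_def[of n 0])

lemma card_inversions_step:
  "\<alpha> \<in> S \<Longrightarrow> w \<in> W \<Longrightarrow> card (inversions (w \<circ> srefl \<alpha>)) \<le> Suc (card (inversions w))"
  using card_inversions_up[of \<alpha> w] card_inversions_down[of \<alpha> w] by (cases "w \<alpha> \<in> P") auto

lemma shorter_mult_T:
  assumes "\<alpha> \<in> S" "shorter n h" shows "shorter (Suc n) (h * T (srefl \<alpha>))"
proof -
  have "shorter (Suc n) (T v * I (coeff h v) * T (srefl \<alpha>))" if v: "v \<in> W" for v
  proof -
    obtain q where q: "sym_vec (\<alpha>, 0) * q = coeff h v - sym_map (srefl \<alpha>) (coeff h v)"
      "I (coeff h v) * T (srefl \<alpha>)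
        = T (srefl \<alpha>) * I (sym_map (srefl \<alpha>) (coeff h v)) + sc (complex_of_real (k \<alpha>)) (I q)"
      using cross_ex[OF assms(1)] by metis
    have eq: "T v * I (coeff h v) * T (srefl \<alpha>) = T (v \<circ> srefl \<alpha>) * I (sym_map (srefl \<alpha>) (coeff h v))
        + T v * I (sym_const (complex_of_real (k \<alpha>)) * q)"
      using v W_simple_refl[OF assms(1)]
      by (simp add: mult.assoc q(2) distrib_left I_scale T_mult flip: mult.assoc[of "T v" "T (srefl \<alpha>)"])
    show ?thesis
    proof (cases "coeff h v = 0")
      case True
      then show ?thesis by (simp add: shorter_def)
    next
      case False
      then have "card (inversions v) < n" using assms(2) v by (simp add: shorter_def)
      then show ?thesis
        unfolding eq using card_inversions_step[OF assms(1) v] v W_simple_refl[OF assms(1)]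
        by (intro shorter_add shorter_T_I W_comp) auto
    qed
  qed
  then have "shorter (Suc n) (\<Sum>v\<in>W. T v * I (coeff h v) * T (srefl \<alpha>))" by (intro shorter_sum)
  then show ?thesis by (simp add: sum_distrib_right[symmetric] coeff_expansion)
qed

text \<open>Split off a simple reflection on the right of \<open>u\<close>. Each application of the cross relation
  produces the expected leading term and a term in which one reflection is lost.\<close>

lemma I_T_triangular:
  assumes "u \<in> W"
  shows "\<exists>r. I a * T u = T u * I (sym_map (inv u) a) + r \<and> shorter (card (inversions u)) r"
  using assms
proof (induction "card (inversions u)" arbitrary: u rule: less_induct)
  case less
  show ?case
  proof (cases "u = id")
    case True
    then show ?thesis by (intro exI[of _ 0]) (simp add: sym_map_id shorter_def del: id_apply)
  next
    case False
    then obtain \<alpha> where \<alpha>: "\<alpha> \<in> S" "u \<alpha> \<notin> P" using exists_descent less.prems by blast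
    define u' where "u' = u \<circ> srefl \<alpha>"
    have u': "u' \<in> W" "u = u' \<circ> srefl \<alpha>" and s: "srefl \<alpha> \<in> W"
      using less.prems \<alpha> W_simple_refl W_comp refl_comp_refl[OF simple_root[OF \<alpha>(1)]]
      by (simp_all add: u'_def comp_assoc)
    have c: "card (inversions u) = Suc (card (inversions u'))"
      unfolding u'_def by (rule card_inversions_down) (use \<alpha> less.prems in auto)
    then obtain r where r: "I a * T u' = T u' * I (sym_map (inv u') a) + r"
      "shorter (card (inversions u')) r" using less.hyps[of u'] u' by auto
    let ?b = "sym_map (inv u') a"
    obtain q where q: "I ?b * T (srefl \<alpha>)
        = T (srefl \<alpha>) * I (sym_map (srefl \<alpha>) ?b) + sc (complex_of_real (k \<alpha>)) (I q)"
      using cross_ex[OF \<alpha>(1)] by metis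
    have "inv u = srefl \<alpha> \<circ> inv u'" using u' s by (simp add: W_inv_o simple_root \<alpha>)
    then have b: "sym_map (srefl \<alpha>) ?b = sym_map (inv u) a"
      using sym_map_comp[OF linear_refl W_linear[OF W_inv[OF u'(1)]]] by simp
    have "I a * T u = (I a * T u') * T (srefl \<alpha>)" using u' s by (simp add: T_mult mult.assoc)
    also have "\<dots> = T u' * (I ?b * T (srefl \<alpha>)) + r * T (srefl \<alpha>)"
      by (simp add: r distrib_right mult.assoc)
    also have "\<dots> = T u * I (sym_map (inv u) a)
        + (T u' * I (sym_const (complex_of_real (k \<alpha>)) * q) + r * T (srefl \<alpha>))"
      unfolding q b using u' s by (simp add: distrib_left I_scale T_mult flip: mult.assoc)
    finally show ?thesis
      using shorter_mult_T[OF \<alpha>(1) r(2)] shorter_T_I[OF u'(1)] c by (metis lessI shorter_add)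
  qed
qed

subsection \<open>The star operation\<close>

text \<open>The only possibility on \<open>t\<^sub>m a\<close>, since the operation reverses products.\<close>

definition star :: "'h \<Rightarrow> 'h" where
  "star = coeff_ext S (\<lambda>m a. I (sym_cnj a) * T (inv m))"

lemma star_add: "star (x + y) = star x + star y"
  unfolding star_def by (rule coeff_ext_add) (simp add: sym_cnj_hom I_add distrib_right)

lemma star_T_I: "u \<in> W \<Longrightarrow> star (T u * I a) = I (sym_cnj a) * T (inv u)"
  unfolding star_def by (subst coeff_ext_T_I) (auto simp: sym_cnj_0 W_eq_WP_simple)

lemma star_I: "star (I a) = I (sym_cnj a)"
  using star_T_I[of id a] by simp

lemma star_T: "u \<in> W \<Longrightarrow> star (T u) = T (inv u)"
  using star_T_I[of u 1] by (simp add: sym_cnj_1)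

lemma star_T_mult: "u \<in> W \<Longrightarrow> star (T u * h) = star h * T (inv u)"
  by (induction h rule: hecke_induct)
    (simp_all add: star_add distrib_left distrib_right star_T_I W_comp T_mult W_inv W_inv_o
      mult.assoc flip: mult.assoc[of "T u"])

text \<open>The cross relation is self-adjoint: for \<open>a' = s (cnj a)\<close> the divided difference changes sign, so
  the relation for \<open>a'\<close> cancels the term that the relation for \<open>a\<close> has produced. This uses that the
  parameter is real.\<close>

lemma star_I_T:
  assumes "\<alpha> \<in> S" shows "star (I a * T (srefl \<alpha>)) = T (srefl \<alpha>) * I (sym_cnj a)"
proof -
  let ?s = "sym_map (srefl \<alpha>)"
  let ?k = "complex_of_real (k \<alpha>)"
  have s: "srefl \<alpha> \<in> W" "\<alpha> \<in> R" using assms W_simple_refl simple_root by auto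
  have ss: "?s (?s b) = b" for b
    using sym_map_comp[OF linear_refl linear_refl, of \<alpha> \<alpha> b] refl_comp_refl[OF s(2)] sym_map_id by metis
  obtain q where q: "sym_vec (\<alpha>, 0) * q = a - ?s a"
    "I a * T (srefl \<alpha>) = T (srefl \<alpha>) * I (?s a) + sc ?k (I q)"
    using cross_ex[OF assms] by metis
  have "sym_vec (\<alpha>, 0) * sym_cnj q = sym_cnj a - ?s (sym_cnj a)"
    using arg_cong[OF q(1), of sym_cnj]
    by (simp add: sym_cnj_hom sym_cnj_diff sym_cnj_map[OF linear_refl] cx_cnj_def)
  then have q': "sym_vec (\<alpha>, 0) * (- sym_cnj q) = ?s (sym_cnj a) - ?s (?s (sym_cnj a))"
    by (simp add: ss)
  have "star (I a * T (srefl \<alpha>)) = I (sym_cnj (?s a)) * T (srefl \<alpha>) + I (sym_cnj (sym_const ?k * q))"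
    using s by (simp add: q(2) star_add star_T_I star_I flip: I_scale)
  also have "\<dots> = T (srefl \<alpha>) * I (sym_cnj a) + sc ?k (I (- sym_cnj q)) + I (sym_const ?k * sym_cnj q)"
    using cross[OF assms q'] by (simp add: sym_cnj_map[OF linear_refl] ss sym_cnj_hom)
  also have "\<dots> = T (srefl \<alpha>) * I (sym_cnj a)"
    by (simp add: add.assoc flip: I_scale I_add)
  finally show ?thesis .
qed

lemma star_mult: "star (x * y) = star y * star x"
proof -
  have "y \<in> HP S" by (simp add: HP_simple)
  with order_refl have "\<forall>x. star (x * y) = star y * star x"
  proof (induction rule: HP_gen_induct)
    case (I b)
    have "star (x * I b) = star (I b) * star x" for x
    proof (induction x rule: hecke_induct)
      case (T_I w a)
      have "T w * I a * I b = T w * I (b * a)" by (simp only: I_mult[symmetric] mult.assoc mult.commute[of b])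
      then have "star (T w * I a * I b) = I (sym_cnj (b * a)) * T (inv w)"
        using T_I by (simp only: star_T_I)
      then show ?case using T_I by (simp add: star_T_I star_I sym_cnj_hom I_mult mult.assoc)
    qed (simp add: star_add distrib_left distrib_right)
    then show ?case by blast
  next
    case (T \<alpha>)
    have s: "srefl \<alpha> \<in> W" "\<alpha> \<in> R" using T W_simple_refl simple_root by auto
    have "star (x * T (srefl \<alpha>)) = star (T (srefl \<alpha>)) * star x" for x
    proof (induction x rule: hecke_induct)
      case (T_I w a)
      have "star (T w * I a * T (srefl \<alpha>)) = star (I a * T (srefl \<alpha>)) * T (inv w)"
        using T_I by (simp add: mult.assoc star_T_mult)
      then show ?case using T_I s T by (simp add: star_I_T star_T star_T_I mult.assoc)
    qed (simp add: star_add distrib_left distrib_right)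
    then show ?case by blast
  next
    case (mult y z)
    have "star (x * (y * z)) = star (y * z) * star x" for x
    proof -
      have "star (x * (y * z)) = star z * star (x * y)" using mult by (metis mult.assoc)
      also have "\<dots> = star z * star y * star x" using mult by (simp add: mult.assoc)
      also have "star z * star y = star (y * z)" using mult by simp
      finally show ?thesis .
    qed
    then show ?case by blast
  qed (simp add: star_add distrib_left distrib_right)
  then show ?thesis by blast
qed

lemma star_star: "star (star x) = x"
  by (induction x rule: hecke_induct)
    (simp_all add: star_add star_mult star_T star_I W_inv sym_cnj_cnj)

lemma star_scale: "star (sc c x) = sc (cnj c) (star x)"
  by (simp add: sc_eq(1)[of c] sc_eq(2)[of "cnj c"] star_mult star_I sym_cnj_hom)

lemma is_star_star: "is_star D H star"
  unfolding is_star_def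
proof (intro conjI allI ballI)
  show "bij star" using star_star by (metis bijI')
qed (simp_all add: star_add star_scale star_mult star_T star_I sym_cnj_hom)

lemma is_star_unique:
  assumes "is_star D H s" shows "s = star"
proof
  note s = assms[unfolded is_star_def]
  have s_I: "s (I a) = star (I a)" for a
  proof (induction a rule: symalg_induct)
    case (const c)
    \<comment> \<open>A star operation is not assumed to preserve the unit, but this follows from surjectivity.\<close>
    have "s 1 * s x = s x" for x using s by (metis mult_1_right)
    moreover obtain x where "s x = 1" using s by (metis bij_pointE)
    ultimately have "s 1 = 1" by (metis mult_1_right)
    then have "s (sc c 1) = sc (cnj c) 1" using s by metis
    then show ?case by (simp add: sc_1 star_I sym_cnj_hom)
  next
    case (vec z)
    then show ?case using s star_I[of "sym_vec z"] sym_cnj_hom(4)[of z] by metis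
  next
    case (add a b)
    then show ?case using s by (simp add: I_add star_add)
  next
    case (mult a b)
    then show ?case using s by (simp add: I_mult star_mult)
  qed
  fix h show "s h = star h"
    by (induction h rule: hecke_induct) (use s in \<open>simp_all add: s_I star_add star_mult star_T\<close>)
qed

lemma hecke_star_eq: "hecke_star D H = star"
  unfolding hecke_star_def using is_star_star is_star_unique by (rule the_equality)

lemma star_HP:
  assumes "M \<subseteq> S" "x \<in> HP M" shows "star x \<in> HP M"
  using assms
proof (induction rule: HP_gen_induct)
  case (T \<alpha>)
  then have "star (T (srefl \<alpha>)) = T (srefl \<alpha>)"
    using assms simple_root by (subst star_T) (auto intro: W_refl)
  then show ?case using T HP_T WP_refl by simp
qed (simp_all add: star_I HP_I star_add star_mult HP_add HP_mult)

end

section \<open>Transfer between parabolic subalgebras\<close>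

locale parabolic_hecke = hecke D k H
  for D :: "('v::real_vector, 'w::real_vector) root_data"
    and k :: "'v \<Rightarrow> real" and H :: "('v, 'h::ring_1) hecke_data" +
  fixes M :: "'v set"
  assumes M: "M \<subseteq> S"
begin

abbreviation "M' \<equiv> delta_par D M"
abbreviation "w\<^sub>M \<equiv> w_transfer D M"

lemmas M' = delta_par_subset[OF M]
lemmas w_W = w_transfer_W[OF M] and w_inv_W = W_inv[OF w_transfer_W[OF M]]
lemmas lin_w = W_linear[OF w_W] and lin_inv_w = W_linear[OF w_inv_W]

lemma sym_map_w_inv: "sym_map w\<^sub>M (sym_map (inv w\<^sub>M) a) = a" "sym_map (inv w\<^sub>M) (sym_map w\<^sub>M a) = a"
  using sym_map_comp[OF lin_w lin_inv_w] sym_map_comp[OF lin_inv_w lin_w]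
  by (simp_all add: w_W sym_map_id)

text \<open>Conjugation \<open>t\<^sub>m a \<mapsto> t\<^sub>n (inv w a)\<close> with \<open>n = inv w \<circ> m \<circ> w\<close>, a total function that is only meaningful on the
  parabolic subalgebra of \<open>M\<close>.\<close>

definition transfer :: "'h \<Rightarrow> 'h" where
  "transfer = coeff_ext M (\<lambda>m a. T (inv w\<^sub>M \<circ> m \<circ> w\<^sub>M) * I (sym_map (inv w\<^sub>M) a))"

definition transfer_inv :: "'h \<Rightarrow> 'h" where
  "transfer_inv = coeff_ext M' (\<lambda>m a. T (w\<^sub>M \<circ> m \<circ> inv w\<^sub>M) * I (sym_map w\<^sub>M a))"

lemma transfer_add: "transfer (x + y) = transfer x + transfer y"
  unfolding transfer_def
  by (rule coeff_ext_add) (simp add: sym_map_hom[OF lin_inv_w] I_add distrib_left)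

lemma transfer_T_I:
  "m \<in> WP M \<Longrightarrow> transfer (T m * I a) = T (inv w\<^sub>M \<circ> m \<circ> w\<^sub>M) * I (sym_map (inv w\<^sub>M) a)"
  unfolding transfer_def using WP_W[OF M] by (subst coeff_ext_T_I) (simp_all add: sym_map_0[OF lin_inv_w] M)

lemma transfer_inv_add: "transfer_inv (x + y) = transfer_inv x + transfer_inv y"
  unfolding transfer_inv_def
  by (rule coeff_ext_add) (simp add: sym_map_hom[OF lin_w] I_add distrib_left)

lemma transfer_inv_T_I:
  "m \<in> WP M' \<Longrightarrow> transfer_inv (T m * I a) = T (w\<^sub>M \<circ> m \<circ> inv w\<^sub>M) * I (sym_map w\<^sub>M a)"
  unfolding transfer_inv_def using WP_W[OF M']
  by (subst coeff_ext_T_I) (simp_all add: sym_map_0[OF lin_w] M')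

lemma transfer_T: "m \<in> WP M \<Longrightarrow> transfer (T m) = T (inv w\<^sub>M \<circ> m \<circ> w\<^sub>M)"
  using transfer_T_I[of m 1] by (simp add: sym_map_1[OF lin_inv_w])

lemma transfer_I: "transfer (I a) = I (sym_map (inv w\<^sub>M) a)"
  using transfer_T_I[of id a] by (simp add: w_W)

lemma transfer_1: "transfer 1 = 1"
  using transfer_I[of 1] by (simp add: sym_map_1[OF lin_inv_w])

lemma transfer_HP: "x \<in> HP M \<Longrightarrow> transfer x \<in> HP M'"
proof (induction rule: HP_induct[OF M, consumes 1, case_names T_I add])
  case (T_I m a)
  then show ?case by (simp add: transfer_T_I HP_mult HP_T HP_I w_transfer_conj[OF M])
qed (simp add: transfer_add HP_add)

lemma transfer_inv_HP: "x \<in> HP M' \<Longrightarrow> transfer_inv x \<in> HP M"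
proof (induction rule: HP_induct[OF M', consumes 1, case_names T_I add])
  case (T_I m a)
  then show ?case by (simp add: transfer_inv_T_I HP_mult HP_T HP_I w_transfer_conj[OF M])
qed (simp add: transfer_inv_add HP_add)

lemma transfer_inv_transfer: "x \<in> HP M \<Longrightarrow> transfer_inv (transfer x) = x"
proof (induction rule: HP_induct[OF M, consumes 1, case_names T_I add])
  case (T_I m a)
  have "w\<^sub>M \<circ> (inv w\<^sub>M \<circ> m \<circ> w\<^sub>M) \<circ> inv w\<^sub>M = m" using w_W by (simp add: fun_eq_iff)
  then show ?case using T_I w_transfer_conj[OF M] by (simp add: transfer_T_I transfer_inv_T_I sym_map_w_inv)
qed (simp add: transfer_add transfer_inv_add)

lemma transfer_transfer_inv: "x \<in> HP M' \<Longrightarrow> transfer (transfer_inv x) = x"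
proof (induction rule: HP_induct[OF M', consumes 1, case_names T_I add])
  case (T_I m a)
  have "inv w\<^sub>M \<circ> (w\<^sub>M \<circ> m \<circ> inv w\<^sub>M) \<circ> w\<^sub>M = m" using w_W by (simp add: fun_eq_iff)
  then show ?case using T_I w_transfer_conj[OF M] by (simp add: transfer_T_I transfer_inv_T_I sym_map_w_inv)
qed (simp add: transfer_add transfer_inv_add)

lemma k_transfer: "\<alpha> \<in> M \<Longrightarrow> k (inv w\<^sub>M \<alpha>) = k \<alpha>"
  using param inv_w_transfer_base[OF M] M M' w_inv_W unfolding parameter_function_def by (metis subsetD)

lemma conj_srefl: "\<alpha> \<in> M \<Longrightarrow> inv w\<^sub>M \<circ> srefl \<alpha> \<circ> w\<^sub>M = srefl (inv w\<^sub>M \<alpha>)"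
  using refl_W[OF w_inv_W, of \<alpha>] M simple_root w_W by (metis W_inv_comp(1) comp_assoc comp_id subsetD)

text \<open>The cross relation for \<open>\<alpha>\<close> is mapped to the cross relation for the simple root \<open>inv w \<alpha>\<close>: the
  divided differences correspond, and the parameters agree because the two roots are conjugate.\<close>

lemma transfer_mult:
  assumes "x \<in> HP M" "y \<in> HP M" shows "transfer (x * y) = transfer x * transfer y"
proof -
  have "\<forall>x\<in>HP M. transfer (x * y) = transfer x * transfer y"
    using M assms(2)
  proof (induction rule: HP_gen_induct)
    case (I b)
    have "transfer (x * I b) = transfer x * transfer (I b)" if "x \<in> HP M" for x
      using M that
    proof (induction rule: HP_induct)
      case (T_I m a)
      have "transfer (T m * I a * I b) = transfer (T m * I (a * b))" by (simp add: I_mult mult.assoc)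
      also have "\<dots> = transfer (T m * I a) * transfer (I b)"
        unfolding transfer_T_I[OF T_I] by (simp add: transfer_I sym_map_hom[OF lin_inv_w] I_mult mult.assoc)
      finally show ?case .
    qed (simp add: distrib_right transfer_add)
    then show ?case by blast
  next
    case (T \<alpha>)
    let ?\<beta> = "inv w\<^sub>M \<alpha>"
    have \<alpha>: "\<alpha> \<in> S" "\<alpha> \<in> R" "srefl \<alpha> \<in> WP M" "srefl \<alpha> \<in> W" "?\<beta> \<in> S"
      using T M M' simple_root WP_refl W_simple_refl inv_w_transfer_base[OF M] by blast+
    have trT: "transfer (T (srefl \<alpha>)) = T (srefl ?\<beta>)" using T \<alpha> by (simp add: transfer_T conj_srefl)
    have conj: "inv w\<^sub>M \<circ> srefl \<alpha> = srefl ?\<beta> \<circ> inv w\<^sub>M" using refl_W[OF w_inv_W \<alpha>(2)] by simp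
    have "transfer (x * T (srefl \<alpha>)) = transfer x * transfer (T (srefl \<alpha>))" if "x \<in> HP M" for x
      using M that
    proof (induction rule: HP_induct)
      case (T_I m a)
      obtain q where q: "sym_vec (\<alpha>, 0) * q = a - sym_map (srefl \<alpha>) a"
        "I a * T (srefl \<alpha>)
          = T (srefl \<alpha>) * I (sym_map (srefl \<alpha>) a) + sc (complex_of_real (k \<alpha>)) (I q)"
        using cross_ex[OF \<alpha>(1)] by metis
      let ?f = "sym_map (inv w\<^sub>M)"
      have fs: "?f (sym_map (srefl \<alpha>) a) = sym_map (srefl ?\<beta>) (?f a)"
        using sym_map_comp[OF lin_inv_w linear_refl, of \<alpha>] sym_map_comp[OF linear_refl lin_inv_w, of ?\<beta>]
        by (simp only: conj)
      have "?f (sym_vec (\<alpha>, 0) * q) = sym_vec (?\<beta>, 0) * ?f q"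
        by (simp add: sym_map_hom[OF lin_inv_w] cx_map_def linear_0[OF lin_inv_w])
      then have "sym_vec (?\<beta>, 0) * ?f q = ?f a - sym_map (srefl ?\<beta>) (?f a)"
        by (simp add: q(1) sym_map_diff[OF lin_inv_w] fs)
      from cross[OF \<alpha>(5) this]
      have crossf: "I (?f a) * T (srefl ?\<beta>) = T (srefl ?\<beta>) * I (?f (sym_map (srefl \<alpha>) a))
          + I (sym_const (complex_of_real (k \<alpha>)) * ?f q)"
        using T by (simp add: fs k_transfer I_scale)
      have mW: "m \<in> W" using T_I WP_W M by blast
      have cmW: "inv w\<^sub>M \<circ> m \<circ> w\<^sub>M \<in> W" using mW w_W w_inv_W by (intro W_comp)
      have "inv w\<^sub>M \<circ> (m \<circ> srefl \<alpha>) \<circ> w\<^sub>M = (inv w\<^sub>M \<circ> m \<circ> w\<^sub>M) \<circ> srefl ?\<beta>"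
        using conj_srefl[OF T] w_W by (simp add: fun_eq_iff flip: \<open>inv w\<^sub>M \<circ> srefl \<alpha> \<circ> w\<^sub>M = srefl ?\<beta>\<close>)
      then have Tm: "T (inv w\<^sub>M \<circ> (m \<circ> srefl \<alpha>) \<circ> w\<^sub>M) = T (inv w\<^sub>M \<circ> m \<circ> w\<^sub>M) * T (srefl ?\<beta>)"
        using cmW \<alpha>(5) by (simp only: T_mult W_simple_refl)
      have "T m * I a * T (srefl \<alpha>) = T (m \<circ> srefl \<alpha>) * I (sym_map (srefl \<alpha>) a)
          + T m * I (sym_const (complex_of_real (k \<alpha>)) * q)"
        using mW \<alpha>(4)
        by (simp add: mult.assoc q distrib_left I_scale T_mult flip: mult.assoc[of "T m" "T (srefl \<alpha>)"])
      then have "transfer (T m * I a * T (srefl \<alpha>))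
          = T (inv w\<^sub>M \<circ> m \<circ> w\<^sub>M) * T (srefl ?\<beta>) * I (?f (sym_map (srefl \<alpha>) a))
            + T (inv w\<^sub>M \<circ> m \<circ> w\<^sub>M) * I (sym_const (complex_of_real (k \<alpha>)) * ?f q)"
        using WP_comp[OF T_I \<alpha>(3)] T_I by (simp only: transfer_add transfer_T_I Tm sym_map_hom[OF lin_inv_w])
      also have "\<dots> = transfer (T m * I a) * transfer (T (srefl \<alpha>))"
        using T_I by (simp only: transfer_T_I trT crossf mult.assoc distrib_left)
      finally show ?case .
    qed (simp add: distrib_right transfer_add)
    then show ?case by blast
  next
    case (mult y z)
    show ?case
    proof
      fix x assume x: "x \<in> HP M"
      have "transfer (x * (y * z)) = transfer (x * y) * transfer z" using mult x HP_mult by (metis mult.assoc)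
      also have "\<dots> = transfer x * (transfer y * transfer z)" using mult x by (simp add: mult.assoc)
      finally show "transfer (x * (y * z)) = transfer x * transfer (y * z)" using mult by simp
    qed
  qed (simp add: distrib_left transfer_add)
  then show ?thesis using assms by blast
qed

lemma transfer_scale: "x \<in> HP M \<Longrightarrow> transfer (sc c x) = sc c (transfer x)"
  by (simp add: sc_eq(1) transfer_mult HP_I transfer_I sym_map_hom[OF lin_inv_w])

lemma is_transfer_transfer: "is_transfer D H M (restrict transfer (HP M))"
  unfolding is_transfer_def
proof (intro conjI ballI allI)
  show "restrict transfer (HP M) \<in> extensional (HP M)" by simp
  have "bij_betw transfer (HP M) (HP M')"
    by (rule bij_betw_byWitness[where f' = transfer_inv]) (use transfer_inv_transfer transfer_transfer_inv transfer_HP transfer_inv_HP in auto)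
  then show "bij_betw (restrict transfer (HP M)) (HP M) (HP M')" by (simp cong: bij_betw_cong)
  fix x y assume "x \<in> HP M" "y \<in> HP M"
  then show "restrict transfer (HP M) (x + y) = restrict transfer (HP M) x + restrict transfer (HP M) y"
    "restrict transfer (HP M) (x * y) = restrict transfer (HP M) x * restrict transfer (HP M) y"
    by (simp_all add: transfer_add transfer_mult HP_add HP_mult)
qed (simp_all add: transfer_1 HP_1 transfer_scale HP_scale transfer_T HP_T transfer_I HP_I sym_map_hom[OF lin_inv_w])

lemma is_transfer_unique:
  assumes "is_transfer D H M \<phi>" shows "\<phi> = restrict transfer (HP M)"
proof (rule extensionalityI)
  note p = assms[unfolded is_transfer_def]
  show "\<phi> \<in> extensional (HP M)" "restrict transfer (HP M) \<in> extensional (HP M)" using p by auto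
  have add: "\<phi> (x + y) = \<phi> x + \<phi> y" and mult: "\<phi> (x * y) = \<phi> x * \<phi> y"
    if "x \<in> HP M" "y \<in> HP M" for x y using p that by auto
  have \<phi>_I: "\<phi> (I a) = transfer (I a)" for a
  proof (induction a rule: symalg_induct)
    case (const c)
    have "\<phi> (sc c 1) = sc c 1" using p HP_1 by metis
    then show ?case by (simp add: sc_1 transfer_I sym_map_hom[OF lin_inv_w])
  next
    case (vec z)
    have "\<phi> (I (sym_vec z)) = I (sym_vec (cx_map (inv w\<^sub>M) z))" using p by blast
    then show ?case by (simp add: transfer_I sym_map_hom[OF lin_inv_w])
  qed (simp_all add: I_add I_mult add mult transfer_add transfer_mult HP_I)
  fix x assume x: "x \<in> HP M"
  with M have "\<phi> x = transfer x"
  proof (induction rule: HP_induct)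
    case (T_I m a)
    have "\<phi> (T m) = transfer (T m)" using p T_I by (simp add: transfer_T)
    then show ?case using T_I by (simp add: mult transfer_mult \<phi>_I HP_T HP_I)
  qed (simp add: add transfer_add)
  then show "\<phi> x = restrict transfer (HP M) x" using x by simp
qed

lemma transfer_iso_inv:
  assumes "x \<in> HP M'" shows "inv_into (HP M) (transfer_iso D H M) x = transfer_inv x"
proof -
  have "transfer_iso D H M = restrict transfer (HP M)"
    unfolding transfer_iso_def using is_transfer_transfer is_transfer_unique by (rule the_equality)
  moreover have "bij_betw (restrict transfer (HP M)) (HP M) (HP M')"
    using is_transfer_transfer by (simp add: is_transfer_def)
  ultimately show ?thesis
    using assms transfer_inv_HP transfer_transfer_inv by (intro inv_into_f_eq) (auto simp: bij_betw_def)
qed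

lemma transfer_inv_1: "transfer_inv 1 = 1"
  using transfer_inv_transfer[OF HP_1] by (simp add: transfer_1)

lemma transfer_inv_mult:
  assumes "x \<in> HP M'" "y \<in> HP M'" shows "transfer_inv (x * y) = transfer_inv x * transfer_inv y"
  using assms transfer_mult[of "transfer_inv x" "transfer_inv y"] transfer_inv_transfer[of "transfer_inv x * transfer_inv y"]
  by (simp add: transfer_inv_HP transfer_transfer_inv HP_mult)

lemma transfer_inv_scale: "x \<in> HP M' \<Longrightarrow> transfer_inv (sc c x) = sc c (transfer_inv x)"
  using transfer_scale[of "transfer_inv x" c] transfer_inv_transfer[of "sc c (transfer_inv x)"]
  by (simp add: transfer_inv_HP transfer_transfer_inv HP_scale)

lemma star_transfer: "x \<in> HP M \<Longrightarrow> star (transfer x) = transfer (star x)"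
proof (induction rule: HP_gen_induct[OF M, consumes 1, case_names I T add mult])
  case (I a)
  then show ?case by (simp add: transfer_I star_I sym_cnj_map[OF lin_inv_w])
next
  case (T \<alpha>)
  then have "\<alpha> \<in> R" "inv w\<^sub>M \<alpha> \<in> R" "srefl \<alpha> \<in> WP M"
    using M M' simple_root WP_refl inv_w_transfer_base[OF M] by blast+
  then show ?case using T by (simp add: transfer_T conj_srefl star_T W_refl)
qed (simp_all add: transfer_add star_add transfer_mult star_mult star_HP[OF M])

text \<open>By right linearity it is enough to treat \<open>h = T y\<close> with \<open>y\<close> a minimal representative. The lower
  terms that arise from moving an element of the symmetric algebra past \<open>T y\<close> are too short to meet
  the coset of \<open>inv w\<close>, on which the twisted projection is supported; the leading term meets it only
  for \<open>y = inv w\<close>, where the two twists by \<open>w\<close> cancel.\<close>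

lemma proj_twist:
  assumes "m \<in> HP M" shows "proj M (T w\<^sub>M * (transfer m * h)) = m * proj M (T w\<^sub>M * h)"
proof -
  have "\<forall>h. proj M (T w\<^sub>M * (transfer m * h)) = m * proj M (T w\<^sub>M * h)"
    using M assms
  proof (induction rule: HP_gen_induct)
    case (I a)
    let ?a = "sym_map (inv w\<^sub>M) a"
    have base: "proj M (T w\<^sub>M * (I ?a * T y)) = I a * proj M (T w\<^sub>M * T y)"
      if y: "y \<in> min_reps D M" for y
    proof -
      have yW: "y \<in> W" using y min_reps_W by blast
      obtain r where r: "I ?a * T y = T y * I (sym_map (inv y) ?a) + r" "shorter (card (inversions y)) r"
        using I_T_triangular[OF yW] by blast
      have "proj M (T w\<^sub>M * r) = 0"
      proof (rule proj_eq_0)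
        fix m assume m: "m \<in> WP M"
        have u: "inv w\<^sub>M \<circ> m \<in> W" using w_inv_W m WP_W M W_comp by blast
        have "w\<^sub>M \<circ> (inv w\<^sub>M \<circ> m) \<in> WP M" using m w_W by (simp flip: comp_assoc)
        then have "card (inversions y) \<le> card (inversions (inv w\<^sub>M \<circ> m))"
          using w_transfer_coset_long M u y by blast
        then have "coeff r (inv w\<^sub>M \<circ> m) = 0" using r(2) u unfolding shorter_def by force
        then show "coeff (T w\<^sub>M * r) m = 0" by (simp add: coeff_T_mult w_W)
      qed
      then have "proj M (T w\<^sub>M * (I ?a * T y)) = proj M (T (w\<^sub>M \<circ> y) * I (sym_map (inv y) ?a))"
        using w_W yW by (simp add: r(1) distrib_left proj_add T_mult flip: mult.assoc)
      also have "\<dots> = I a * proj M (T (w\<^sub>M \<circ> y))"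
      proof (cases "w\<^sub>M \<circ> y \<in> WP M")
        case True
        have "y = inv w\<^sub>M \<circ> (w\<^sub>M \<circ> y)" using w_W by (simp flip: comp_assoc)
        then have "w\<^sub>M \<circ> y = id"
          using coset_unique[OF M inv_w_transfer_min_rep[OF M] y True] by blast
        moreover from this have "sym_map (inv y) ?a = a"
          using sym_map_w_inv(1)[of a] w_W yW by (metis inv_unique_comp W_inv_comp(1) comp_assoc comp_id id_comp)
        moreover have "proj M 1 = 1" using proj_HP_id[OF M HP_1] .
        ultimately show ?thesis using proj_HP_id[OF M HP_I] by simp
      next
        case False
        then show ?thesis
          using proj_T_I[OF M W_comp[OF w_W yW], of 1] proj_T_I[OF M W_comp[OF w_W yW]] by simp
      qed
      finally show ?thesis using w_W yW by (simp add: T_mult)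
    qed
    have "proj M (T w\<^sub>M * (I ?a * h)) = I a * proj M (T w\<^sub>M * h)" for h
    proof (induction h rule: hecke_induct)
      case (T_I u b)
      obtain y m where ym: "y \<in> min_reps D M" "m \<in> WP M" "u = y \<circ> m"
        using coset_decomposition[OF M T_I] by metis
      then have W: "y \<in> W" "m \<in> W" using min_reps_W WP_W M by auto
      have n: "T m * I b \<in> HP M" using ym HP_mult HP_T HP_I by blast
      have h: "T u * I b = T y * (T m * I b)" using ym W by (simp add: T_mult flip: mult.assoc)
      have "proj M (T w\<^sub>M * (I ?a * (T u * I b))) = proj M ((T w\<^sub>M * (I ?a * T y)) * (T m * I b))"
        by (simp only: h mult.assoc)
      also have "\<dots> = I a * (proj M (T w\<^sub>M * T y) * (T m * I b))"
        unfolding proj_mult[OF M n] base[OF ym(1)] by (rule mult.assoc)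
      also have "\<dots> = I a * proj M (T w\<^sub>M * (T u * I b))"
        unfolding proj_mult[OF M n, symmetric] h by (simp only: mult.assoc)
      finally show ?case .
    qed (simp add: distrib_left proj_add)
    then show ?case by (simp add: transfer_I)
  next
    case (T \<alpha>)
    have \<alpha>: "srefl \<alpha> \<in> WP M" "srefl \<alpha> \<in> W" "inv w\<^sub>M \<circ> srefl \<alpha> \<circ> w\<^sub>M \<in> W"
      using T M by (auto intro!: WP_refl W_simple_refl W_comp w_W w_inv_W)
    have "w\<^sub>M \<circ> (inv w\<^sub>M \<circ> srefl \<alpha> \<circ> w\<^sub>M) = srefl \<alpha> \<circ> w\<^sub>M" using w_W by (simp add: fun_eq_iff)
    then have "T w\<^sub>M * transfer (T (srefl \<alpha>)) = T (srefl \<alpha>) * T w\<^sub>M"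
      using \<alpha> w_W by (simp only: transfer_T T_mult)
    then show ?case using proj_T_mult[OF M \<alpha>(1)] by (metis mult.assoc)
  next
    case (mult x y)
    then show ?case by (simp add: transfer_mult mult.assoc)
  qed (simp add: transfer_add distrib_left distrib_right proj_add)
  then show ?thesis by blast
qed

end

section \<open>Modules, hermitian duals and induction\<close>

locale hecke_module = parabolic_hecke D k H M
  for D :: "('v::real_vector, 'w::real_vector) root_data"
    and k :: "'v \<Rightarrow> real" and H :: "('v, 'h::ring_1) hecke_data" and M :: "'v set" +
  fixes U :: "('h, 'u) hmodule"
  assumes module: "module_over (ha_scale H) (hecke_par D H M) U"
begin

abbreviation "C \<equiv> hm_carrier U"
abbreviation "addU \<equiv> hm_add U"
abbreviation "act \<equiv> hm_act U"
abbreviation "scl \<equiv> hm_scale U"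

lemma zero_C: "hm_zero U \<in> C"
  and add_C: "x \<in> C \<Longrightarrow> y \<in> C \<Longrightarrow> addU x y \<in> C"
  and scl_C: "x \<in> C \<Longrightarrow> scl c x \<in> C"
  and zero_add: "x \<in> C \<Longrightarrow> addU (hm_zero U) x = x"
  and scl_add_left: "x \<in> C \<Longrightarrow> scl (c + d) x = addU (scl c x) (scl d x)"
  and scl_scl: "x \<in> C \<Longrightarrow> scl (c * d) x = scl c (scl d x)"
  and scl_1: "x \<in> C \<Longrightarrow> scl 1 x = x"
  and act_C: "h \<in> HP M \<Longrightarrow> x \<in> C \<Longrightarrow> act h x \<in> C"
  and act_add: "h \<in> HP M \<Longrightarrow> x \<in> C \<Longrightarrow> y \<in> C \<Longrightarrow> act h (addU x y) = addU (act h x) (act h y)"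
  and act_scl: "h \<in> HP M \<Longrightarrow> x \<in> C \<Longrightarrow> act h (scl c x) = scl c (act h x)"
  and act_1: "x \<in> C \<Longrightarrow> act 1 x = x"
  and act_plus: "g \<in> HP M \<Longrightarrow> h \<in> HP M \<Longrightarrow> x \<in> C \<Longrightarrow> act (g + h) x = addU (act g x) (act h x)"
  and act_mult: "g \<in> HP M \<Longrightarrow> h \<in> HP M \<Longrightarrow> x \<in> C \<Longrightarrow> act (g * h) x = act g (act h x)"
  and act_sc: "h \<in> HP M \<Longrightarrow> x \<in> C \<Longrightarrow> act (sc c h) x = scl c (act h x)"
  using module unfolding module_over_def complex_space_def linear_between_def Ball_def
  by (elim conjE, meson)+

subsection \<open>Hermitian duals\<close>

abbreviation "Uh \<equiv> herm_dual star U"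

lemma Uh_iff: "f \<in> hm_carrier Uh \<longleftrightarrow> f \<in> extensional C
    \<and> (\<forall>x\<in>C. \<forall>y\<in>C. f (addU x y) = f x + f y) \<and> (\<forall>c. \<forall>x\<in>C. f (scl c x) = cnj c * f x)"
  by (simp add: herm_dual_def)

lemma Uh_ops: "hm_zero Uh = (\<lambda>x\<in>C. 0)" "hm_add Uh f g = (\<lambda>x\<in>C. f x + g x)"
  "hm_scale Uh c f = (\<lambda>x\<in>C. c * f x)" "hm_act Uh h f = (\<lambda>x\<in>C. f (act (star h) x))"
  by (simp_all add: herm_dual_def)

lemma Uh_ext: "f \<in> hm_carrier Uh \<Longrightarrow> g \<in> hm_carrier Uh \<Longrightarrow> (\<And>x. x \<in> C \<Longrightarrow> f x = g x) \<Longrightarrow> f = g"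
  unfolding Uh_iff by (blast intro: extensionalityI)

lemma module_herm_dual: "module_over sc (HP M) Uh"
proof -
  have ext: "f = g" if "f \<in> extensional C" "g \<in> extensional C" "\<And>x. x \<in> C \<Longrightarrow> f x = g x" for f g :: "'u \<Rightarrow> complex"
    using that by (blast intro: extensionalityI)
  have zero: "hm_zero Uh \<in> hm_carrier Uh"
    by (simp add: Uh_iff Uh_ops add_C scl_C)
  have add: "hm_add Uh f g \<in> hm_carrier Uh" if "f \<in> hm_carrier Uh" "g \<in> hm_carrier Uh" for f g
    using that by (simp add: Uh_iff Uh_ops add_C scl_C algebra_simps)
  have scale: "hm_scale Uh c f \<in> hm_carrier Uh" if "f \<in> hm_carrier Uh" for c f
    using that by (simp add: Uh_iff Uh_ops add_C scl_C algebra_simps)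
  have act: "hm_act Uh h f \<in> hm_carrier Uh" if "f \<in> hm_carrier Uh" "h \<in> HP M" for h f
    using that star_HP[OF M, of h] by (simp add: Uh_iff Uh_ops add_C scl_C act_C act_add act_scl)
  have act_of_add: "hm_act Uh h (hm_add Uh f g) = hm_add Uh (hm_act Uh h f) (hm_act Uh h g)"
    and act_of_scale: "hm_act Uh h (hm_scale Uh c f) = hm_scale Uh c (hm_act Uh h f)"
    if "f \<in> hm_carrier Uh" "g \<in> hm_carrier Uh" "h \<in> HP M" for h f g c
    using that star_HP[OF M, of h] by (auto simp: Uh_ops act_C)
  have one: "hm_act Uh 1 f = f" if "f \<in> hm_carrier Uh" for f
    using that by (intro Uh_ext act HP_1) (simp_all add: Uh_ops star_T[of id, simplified] act_1)
  have act_plus': "hm_act Uh (g + h) f = hm_add Uh (hm_act Uh g f) (hm_act Uh h f)"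
    and act_mult': "hm_act Uh (g * h) f = hm_act Uh g (hm_act Uh h f)"
    and act_sc': "hm_act Uh (sc c h) f = hm_scale Uh c (hm_act Uh h f)"
    if "f \<in> hm_carrier Uh" "g \<in> HP M" "h \<in> HP M" for h f g c
    using that star_HP[OF M, of h] star_HP[OF M, of g]
    by (auto simp: Uh_ops Uh_iff act_C star_add star_mult star_scale act_plus act_mult act_sc intro!: restrict_ext)
  have zero_l: "hm_add Uh (hm_zero Uh) f = f" and scale1: "hm_scale Uh 1 f = f" if "f \<in> hm_carrier Uh" for f
    by (rule Uh_ext[OF add[OF zero that] that], simp add: Uh_ops,
        rule Uh_ext[OF scale[OF that] that], simp add: Uh_ops)
  have neg: "\<exists>g\<in>hm_carrier Uh. hm_add Uh f g = hm_zero Uh" if "f \<in> hm_carrier Uh" for f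
    using scale[OF that, of "- 1"] by (rule bexI[rotated]) (auto simp: Uh_ops)
  have cs: "complex_space Uh"
    unfolding complex_space_def
    by (intro conjI ballI allI zero add scale neg zero_l scale1) (auto simp: Uh_ops algebra_simps intro!: restrict_ext)
  show ?thesis
    unfolding module_over_def linear_between_def
    by (intro conjI ballI allI cs act act_of_add act_of_scale one act_plus' act_mult' act_sc'; assumption)
qed

subsection \<open>Induced modules\<close>

abbreviation "rels \<equiv> tensor_rels (HP M) U"
abbreviation "cls \<equiv> tensor_class (HP M) U"
abbreviation "ten \<equiv> tensor (HP M) U"
abbreviation "X \<equiv> ind_module D H M U"

text \<open>The frags with second components in the carrier. The relations are only imposed for such frags,
  and the carrier of the induced module consists of their classes.\<close>

definition supported :: "('h \<times> 'u \<Rightarrow>\<^sub>0 int) set" where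
  "supported = {p. Poly_Mapping.keys p \<subseteq> UNIV \<times> C}"

lemma rels_uminus: "p \<in> rels \<Longrightarrow> - p \<in> rels"
  using tensor_rels.diff[OF tensor_rels.zero, of p] by simp

lemma rels_add: "p \<in> rels \<Longrightarrow> q \<in> rels \<Longrightarrow> p + q \<in> rels"
  using tensor_rels.diff[of p _ _ "- q"] rels_uminus[of q] by simp

lemma rels_sum: "(\<And>i. i \<in> J \<Longrightarrow> f i \<in> rels) \<Longrightarrow> sum f J \<in> rels"
  by (induction J rule: infinite_finite_induct) (auto intro: rels_add tensor_rels.zero)

lemma cls_eq_iff: "cls p = cls q \<longleftrightarrow> p - q \<in> rels"
proof
  assume "cls p = cls q"
  moreover have "p \<in> cls p" by (simp add: tensor_class_def tensor_rels.zero)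
  ultimately show "p - q \<in> rels" by (simp add: tensor_class_def)
next
  assume pq: "p - q \<in> rels"
  have "r - p \<in> rels \<longleftrightarrow> r - q \<in> rels" for r
    using rels_add[OF _ pq, of "r - p"] tensor_rels.diff[OF _ pq, of "r - q"] by auto
  then show "cls p = cls q" by (simp add: tensor_class_def)
qed

lemma mem_cls: "q \<in> cls p \<longleftrightarrow> cls q = cls p"
  unfolding cls_eq_iff by (simp add: tensor_class_def)

lemma self_cls: "p \<in> cls p"
  by (simp add: mem_cls)

lemma supported_closed: "0 \<in> supported" "u \<in> C \<Longrightarrow> frag_of (h, u) \<in> supported" "p \<in> supported \<Longrightarrow> - p \<in> supported"
  and supported_add: "p \<in> supported \<Longrightarrow> q \<in> supported \<Longrightarrow> p + q \<in> supported"
  using Poly_Mapping.keys_add[of p q] by (auto simp: supported_def)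

lemma supported_sum: "(\<And>i. i \<in> J \<Longrightarrow> f i \<in> supported) \<Longrightarrow> sum f J \<in> supported"
  by (induction J rule: infinite_finite_induct) (auto intro: supported_closed supported_add)

lemma X_carrier: "hm_carrier X = cls ` supported"
  by (simp add: ind_module_def induced_def supported_def)

lemma X_zero: "hm_zero X = cls 0"
  by (simp add: ind_module_def induced_def)

lemma X_add: "hm_add X (cls p) (cls q) = cls (p + q)"
proof -
  have *: "cls (p' + q') = cls (p + q)" if "p' \<in> cls p" "q' \<in> cls q" for p' q'
    using rels_add[of "p' - p" "q' - q"] that unfolding cls_eq_iff
    by (simp add: tensor_class_def algebra_simps)
  have "(\<Union>q'\<in>cls q. cls (p' + q')) = cls (p + q)" if "p' \<in> cls p" for p'
    by (rule UN_constant_eq[OF self_cls]) (use * that in blast)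
  then have "(\<Union>p'\<in>cls p. \<Union>q'\<in>cls q. cls (p' + q')) = cls (p + q)"
    by (intro UN_constant_eq[OF self_cls]) blast
  then show ?thesis by (simp only: ind_module_def induced_def hmodule.simps)
qed

lemma left_mult_simps: "left_mult h (frag_of (g, u)) = frag_of (h * g, u)"
  "left_mult h (p + q) = left_mult h p + left_mult h q" "left_mult h (p - q) = left_mult h p - left_mult h q"
  "left_mult h 0 = 0"
  by (simp_all add: left_mult_def frag_extend_add frag_extend_diff)

lemma left_mult_rels: "p \<in> rels \<Longrightarrow> left_mult h p \<in> rels"
proof (induction rule: tensor_rels.induct)
  case (add_left u g g')
  then show ?case using tensor_rels.add_left[of u U "h * g" "h * g'"] by (simp add: left_mult_simps distrib_left)
next
  case (add_right u v g)
  then show ?case using tensor_rels.add_right[of u U v "h * g"] by (simp add: left_mult_simps)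
next
  case (balanced u m g)
  then show ?case using tensor_rels.balanced[of u U m "HP M" "h * g"] by (simp add: left_mult_simps mult.assoc)
qed (auto simp: left_mult_simps intro: tensor_rels.zero tensor_rels.diff)

lemma X_act: "hm_act X h (cls p) = cls (left_mult h p)"
proof -
  have "cls (left_mult h q) = cls (left_mult h p)" if "q \<in> cls p" for q
    using left_mult_rels[of "q - p" h] that unfolding cls_eq_iff
    by (simp add: tensor_class_def left_mult_simps)
  then have "(\<Union>q\<in>cls p. cls (left_mult h q)) = cls (left_mult h p)"
    by (intro UN_constant_eq[OF self_cls]) blast
  then show ?thesis by (simp only: ind_module_def induced_def hmodule.simps tensor_act_def)
qed

lemma X_scale: "hm_scale X c Z = hm_act X (sc c 1) Z"
  by (simp add: ind_module_def induced_def)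

lemma supported_induct [consumes 1, case_names zero one diff]:
  assumes "p \<in> supported" "Q 0" "\<And>h u. u \<in> C \<Longrightarrow> Q (frag_of (h, u))" "\<And>p q. Q p \<Longrightarrow> Q q \<Longrightarrow> Q (p - q)"
  shows "Q p"
proof -
  have "Poly_Mapping.keys p \<subseteq> UNIV \<times> C" using assms(1) by (simp add: supported_def)
  then show ?thesis by (rule frag_induction) (use assms in auto)
qed

lemma supported_left_mult: "p \<in> supported \<Longrightarrow> left_mult h p \<in> supported"
proof -
  assume "p \<in> supported"
  then have "left_mult h p \<in> supported \<and> left_mult h (- p) \<in> supported"
  proof (induction rule: supported_induct)
    case (one g u)
    have "left_mult h (- frag_of (g, u)) = - frag_of (h * g, u)"
      using left_mult_simps(3)[of h 0 "frag_of (g, u)"] by (simp add: left_mult_simps)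
    then show ?case using one by (simp add: left_mult_simps supported_closed)
  next
    case (diff p q)
    have "left_mult h (p - q) = left_mult h p + left_mult h (- q)"
      "left_mult h (- (p - q)) = left_mult h (- p) + left_mult h q"
      using left_mult_simps(2)[of h p "- q"] left_mult_simps(2)[of h "- p" q] by simp_all
    then show ?case using diff supported_add by metis
  qed (simp add: left_mult_simps supported_closed)
  then show ?thesis by blast
qed

lemma ten_add_left: "u \<in> C \<Longrightarrow> ten (g + h) u = hm_add X (ten g u) (ten h u)"
  and ten_add_right: "u \<in> C \<Longrightarrow> v \<in> C \<Longrightarrow> ten h (addU u v) = hm_add X (ten h u) (ten h v)"
  and ten_balanced: "u \<in> C \<Longrightarrow> m \<in> HP M \<Longrightarrow> ten (h * m) u = ten h (act m u)"
  unfolding tensor_def X_add cls_eq_iff by (auto intro: tensor_rels.intros)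

lemma ten_X: "u \<in> C \<Longrightarrow> ten h u \<in> hm_carrier X"
  by (auto simp: X_carrier tensor_def supported_closed)

lemma act_ten: "hm_act X h (ten g u) = ten (h * g) u"
  by (simp add: tensor_def X_act left_mult_simps)

lemma ten_scale: "u \<in> C \<Longrightarrow> hm_scale X c (ten h u) = ten h (scl c u)"
proof -
  assume u: "u \<in> C"
  have "hm_scale X c (ten h u) = ten (h * sc c 1) u"
    by (simp add: X_scale act_ten sc_mult_left sc_mult_right)
  also have "\<dots> = ten h (scl c u)" using u by (simp add: ten_balanced HP_scale HP_1 act_sc act_1)
  finally show ?thesis .
qed

text \<open>Negatives come for free, as \<open>- (h \<otimes> u) = (- h) \<otimes> u\<close>, and every \<open>h \<otimes> u\<close> is a sum of terms
  \<open>t\<^sub>x \<otimes> v\<close> since the \<open>t\<^sub>x\<close> generate the Hecke algebra as a right module over the parabolic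
  subalgebra.\<close>

lemma X_induct [consumes 1, case_names ten add]:
  assumes "Z \<in> hm_carrier X"
    and ten: "\<And>x u. x \<in> min_reps D M \<Longrightarrow> u \<in> C \<Longrightarrow> Q (ten (T x) u)"
    and add: "\<And>Z Z'. Z \<in> hm_carrier X \<Longrightarrow> Z' \<in> hm_carrier X \<Longrightarrow> Q Z \<Longrightarrow> Q Z' \<Longrightarrow> Q (hm_add X Z Z')"
  shows "Q Z"
proof -
  have Q_ten: "Q (ten h u)" if "u \<in> C" for h u
  proof (induction h rule: hecke_induct)
    case (T_I v a)
    obtain x m where xm: "x \<in> min_reps D M" "m \<in> WP M" "v = x \<circ> m"
      using coset_decomposition[OF M T_I] by metis
    then have "x \<in> W" "m \<in> W" "T m * I a \<in> HP M" using min_reps_W WP_W M HP_mult HP_T HP_I by auto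
    then have "ten (T v * I a) u = ten (T x) (act (T m * I a) u)"
      using ten_balanced[OF that, of "T m * I a" "T x"] xm by (simp add: T_mult flip: mult.assoc)
    then show ?case using ten xm that act_C \<open>T m * I a \<in> HP M\<close> by simp
  qed (use that add ten_X ten_add_left in simp)
  obtain p where p: "p \<in> supported" "Z = cls p" using assms(1) by (auto simp: X_carrier)
  from p(1) have "p \<in> supported \<and> Q (cls p) \<and> Q (cls (- p))"
  proof (induction rule: supported_induct)
    case zero
    have "frag_of (0, hm_zero U) \<in> rels"
      using rels_uminus[OF tensor_rels.add_left[OF zero_C, of 0 0]] by simp
    then have "cls 0 = ten 0 (hm_zero U)" unfolding tensor_def cls_eq_iff using rels_uminus by fastforce
    then show ?case using Q_ten[OF zero_C] supported_closed by simp
  next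
    case (one h u)
    have "frag_of (0, u) \<in> rels"
      using rels_uminus[OF tensor_rels.add_left[OF one, of 0 0]] by simp
    then have "- frag_of (h, u) - frag_of (- h, u) \<in> rels"
      using rels_add[OF tensor_rels.add_left[OF one, of h "- h"] rels_uminus] rels_uminus
        tensor_rels.diff[OF tensor_rels.add_left[OF one, of h "- h"], of "frag_of (0, u)"] by simp
    then have "cls (- frag_of (h, u)) = ten (- h) u" unfolding tensor_def cls_eq_iff .
    then show ?case using Q_ten[OF one] supported_closed one by (simp add: tensor_def)
  next
    case (diff p q)
    have "cls (p - q) = hm_add X (cls p) (cls (- q))" "cls (- (p - q)) = hm_add X (cls (- p)) (cls q)"
      by (simp_all add: X_add)
    moreover have "p - q \<in> supported" using supported_add[of p "- q"] supported_closed diff by simp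
    moreover have "cls r \<in> hm_carrier X" if "r \<in> supported" for r using that X_carrier by blast
    ultimately show ?case using diff add supported_closed(3) by simp
  qed
  then show ?thesis using p by simp
qed

lemma module_induced: "module_over sc UNIV X"
proof -
  have carrier: "(\<forall>Z\<in>hm_carrier X. Q Z) \<longleftrightarrow> (\<forall>p\<in>supported. Q (cls p))" for Q
    by (simp add: X_carrier)
  have lm_add: "cls (left_mult (g + h) p) = cls (left_mult g p + left_mult h p)" if "p \<in> supported" for g h p
    unfolding cls_eq_iff using that
  proof (induction rule: supported_induct)
    case (one r u)
    then show ?case using tensor_rels.add_left[OF one, of "g * r" "h * r"] by (simp add: left_mult_simps distrib_right)
  next
    case (diff p q)
    then show ?case using tensor_rels.diff[OF diff] by (simp add: left_mult_simps algebra_simps)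
  qed (simp add: left_mult_simps tensor_rels.zero)
  have lm_mult: "left_mult (g * h) p = left_mult g (left_mult h p)" if "p \<in> supported" for g h p
    using that by (induction rule: supported_induct) (simp_all add: left_mult_simps mult.assoc)
  have lm_1: "left_mult 1 p = p" if "p \<in> supported" for p
    using that by (induction rule: supported_induct) (simp_all add: left_mult_simps)
  have sc_mult: "sc c 1 * sc d 1 = sc (c * d) 1" for c d
    by (simp add: sc_mult_left sc_mult_right sc_sc mult.commute)
  have "complex_space X"
    unfolding complex_space_def carrier
  proof (intro conjI ballI allI)
    show "hm_zero X \<in> hm_carrier X" using supported_closed by (simp add: X_zero X_carrier)
  next
    fix p assume p: "p \<in> supported"
    show "\<exists>y\<in>hm_carrier X. hm_add X (cls p) y = hm_zero X"
      using supported_closed(3)[OF p] by (intro bexI[of _ "cls (- p)"]) (simp_all add: X_add X_zero X_carrier)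
  qed (simp_all add: X_carrier X_add X_scale X_act X_zero supported_add supported_left_mult left_mult_simps
      lm_add lm_1 add_ac sc_add_left flip: sc_mult lm_mult)
  then show ?thesis
    unfolding module_over_def linear_between_def carrier
    by (simp add: X_carrier X_add X_act X_scale supported_left_mult left_mult_simps lm_add lm_1 sc_mult_left
        sc_mult_right flip: lm_mult)
qed

definition balanced :: "('h \<Rightarrow> 'u \<Rightarrow> complex) \<Rightarrow> bool" where
  "balanced \<psi> \<longleftrightarrow> (\<forall>g h. \<forall>u\<in>C. \<psi> (g + h) u = \<psi> g u + \<psi> h u)
     \<and> (\<forall>h. \<forall>u\<in>C. \<forall>v\<in>C. \<psi> h (addU u v) = \<psi> h u + \<psi> h v)
     \<and> (\<forall>h. \<forall>u\<in>C. \<forall>m\<in>HP M. \<psi> (h * m) u = \<psi> h (act m u))"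

definition eval_frag :: "('h \<Rightarrow> 'u \<Rightarrow> complex) \<Rightarrow> ('h \<times> 'u \<Rightarrow>\<^sub>0 int) \<Rightarrow> complex" where
  "eval_frag \<psi> p = (\<Sum>k\<in>Poly_Mapping.keys p. of_int (Poly_Mapping.lookup p k) * \<psi> (fst k) (snd k))"

lemma eval_frag_superset:
  "finite A \<Longrightarrow> Poly_Mapping.keys p \<subseteq> A \<Longrightarrow>
    eval_frag \<psi> p = (\<Sum>k\<in>A. of_int (Poly_Mapping.lookup p k) * \<psi> (fst k) (snd k))"
  unfolding eval_frag_def by (intro sum.mono_neutral_left) (auto simp: in_keys_iff)

lemma eval_frag_add: "eval_frag \<psi> (p + q) = eval_frag \<psi> p + eval_frag \<psi> q"
proof -
  let ?A = "Poly_Mapping.keys p \<union> Poly_Mapping.keys q"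
  have "Poly_Mapping.keys (p + q) \<subseteq> ?A" by (rule Poly_Mapping.keys_add)
  then show ?thesis
    by (simp add: eval_frag_superset[of ?A] lookup_add sum.distrib distrib_right)
qed

lemma eval_frag_0: "eval_frag \<psi> 0 = 0" and eval_frag_of: "eval_frag \<psi> (frag_of (h, u)) = \<psi> h u"
  by (simp_all add: eval_frag_def)

lemma eval_frag_diff: "eval_frag \<psi> (p - q) = eval_frag \<psi> p - eval_frag \<psi> q"
  using eval_frag_add[of \<psi> "p - q" q] by simp

lemma eval_frag_sum: "eval_frag \<psi> (sum f J) = (\<Sum>i\<in>J. eval_frag \<psi> (f i))"
  by (induction J rule: infinite_finite_induct) (simp_all add: eval_frag_add eval_frag_0)

lemma eval_frag_rels: "balanced \<psi> \<Longrightarrow> p \<in> rels \<Longrightarrow> eval_frag \<psi> p = 0"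
  by (rotate_tac, induction rule: tensor_rels.induct)
    (simp_all add: eval_frag_0 eval_frag_diff eval_frag_add eval_frag_of balanced_def)

text \<open>The map on the tensor product induced by a balanced map. The representative is immaterial for
  balanced \<open>\<psi>\<close>, and the value outside of the carrier is \<open>undefined\<close>, as in \<open>herm_dual\<close>.\<close>

definition descend :: "('h \<Rightarrow> 'u \<Rightarrow> complex) \<Rightarrow> ('h \<times> 'u \<Rightarrow>\<^sub>0 int) set \<Rightarrow> complex" where
  "descend \<psi> = (\<lambda>Z\<in>hm_carrier X. eval_frag \<psi> (SOME p. p \<in> Z))"

lemma descend_cls: "balanced \<psi> \<Longrightarrow> p \<in> supported \<Longrightarrow> descend \<psi> (cls p) = eval_frag \<psi> p"
proof -
  assume b: "balanced \<psi>" "p \<in> supported"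
  have "(SOME q. q \<in> cls p) \<in> cls p" by (rule someI[of _ p]) (simp add: mem_cls)
  then have "(SOME q. q \<in> cls p) - p \<in> rels" by (simp add: tensor_class_def)
  from eval_frag_rels[OF b(1) this] show ?thesis using b(2) by (simp add: descend_def X_carrier eval_frag_diff)
qed

lemma descend_ten: "balanced \<psi> \<Longrightarrow> u \<in> C \<Longrightarrow> descend \<psi> (ten h u) = \<psi> h u"
  by (simp add: tensor_def descend_cls supported_closed eval_frag_of)

abbreviation "Xh \<equiv> herm_dual star X"

lemma Xh_iff: "F \<in> hm_carrier Xh \<longleftrightarrow> F \<in> extensional (hm_carrier X)
    \<and> (\<forall>x\<in>hm_carrier X. \<forall>y\<in>hm_carrier X. F (hm_add X x y) = F x + F y)
    \<and> (\<forall>c. \<forall>x\<in>hm_carrier X. F (hm_scale X c x) = cnj c * F x)"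
  by (simp add: herm_dual_def)

lemma Xh_ops: "hm_add Xh F G = (\<lambda>x\<in>hm_carrier X. F x + G x)"
  "hm_scale Xh c F = (\<lambda>x\<in>hm_carrier X. c * F x)"
  "hm_act Xh h F = (\<lambda>x\<in>hm_carrier X. F (hm_act X (star h) x))"
  by (simp_all add: herm_dual_def)

lemma descend_Xh:
  assumes "balanced \<psi>" and scale: "\<And>c h u. u \<in> C \<Longrightarrow> \<psi> (sc c h) u = cnj c * \<psi> h u"
  shows "descend \<psi> \<in> hm_carrier Xh"
proof -
  have add: "descend \<psi> (hm_add X Z Y) = descend \<psi> Z + descend \<psi> Y"
    if "Z \<in> hm_carrier X" "Y \<in> hm_carrier X" for Z Y
    using that assms(1) by (auto simp: X_carrier X_add descend_cls supported_add eval_frag_add)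
  have "eval_frag \<psi> (left_mult (sc c 1) p) = cnj c * eval_frag \<psi> p" if "p \<in> supported" for c p
    using that by (induction rule: supported_induct)
      (simp_all add: left_mult_simps eval_frag_0 eval_frag_of eval_frag_diff scale sc_mult_left algebra_simps)
  then have "descend \<psi> (hm_scale X c Z) = cnj c * descend \<psi> Z" if "Z \<in> hm_carrier X" for c Z
    using that assms(1) by (auto simp: X_carrier X_scale X_act descend_cls supported_left_mult)
  then show ?thesis using add by (simp add: Xh_iff descend_def)
qed

lemma Xh_ext:
  assumes "F \<in> hm_carrier Xh" "G \<in> hm_carrier Xh"
    "\<And>x u. x \<in> min_reps D M \<Longrightarrow> u \<in> C \<Longrightarrow> F (ten (T x) u) = G (ten (T x) u)"
  shows "F = G"
proof (rule extensionalityI)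
  show "F \<in> extensional (hm_carrier X)" "G \<in> extensional (hm_carrier X)" using assms Xh_iff by blast+
  fix Z assume "Z \<in> hm_carrier X"
  then show "F Z = G Z"
    by (induction rule: X_induct) (use assms Xh_iff in auto)
qed

lemma cls_sum_cong: "(\<And>i. i \<in> J \<Longrightarrow> cls (p i) = cls (q i)) \<Longrightarrow> cls (sum p J) = cls (sum q J)"
  unfolding cls_eq_iff by (simp flip: sum_subtractf add: rels_sum)

lemma cls_frag_zero: "cls (frag_of (h, hm_zero U)) = cls 0"
  using tensor_rels.add_right[OF zero_C zero_C, of h "HP M"] rels_uminus
  unfolding cls_eq_iff by (simp add: zero_add[OF zero_C]) (metis add.inverse_inverse)

lemma cls_frag_add: "u \<in> C \<Longrightarrow> v \<in> C \<Longrightarrow> cls (frag_of (h, addU u v)) = cls (frag_of (h, u) + frag_of (h, v))"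
  unfolding cls_eq_iff by (rule tensor_rels.add_right)

lemma cls_frag_scale: "u \<in> C \<Longrightarrow> cls (frag_of (h, scl c u)) = cls (left_mult (sc c 1) (frag_of (h, u)))"
  using ten_scale[of u c h] by (simp add: X_scale X_act tensor_def)

lemma left_mult_sum: "left_mult h (sum f J) = (\<Sum>i\<in>J. left_mult h (f i))"
  by (induction J rule: infinite_finite_induct) (simp_all add: left_mult_simps)

lemma Uh_add: "f \<in> hm_carrier Uh \<Longrightarrow> x \<in> C \<Longrightarrow> y \<in> C \<Longrightarrow> f (addU x y) = f x + f y"
  and Uh_scl: "f \<in> hm_carrier Uh \<Longrightarrow> x \<in> C \<Longrightarrow> f (scl c x) = cnj c * f x"
  by (simp_all add: Uh_iff)

lemma Uh_act_0: "f \<in> hm_carrier Uh \<Longrightarrow> x \<in> C \<Longrightarrow> f (act 0 x) = 0"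
  using act_sc[OF HP_1, of x 0] Uh_scl[of f x 0] by (simp add: sc_eq(1) act_1)

section \<open>The hermitian dual of an induced module\<close>

subsection \<open>The transferred dual\<close>

abbreviation "V \<equiv> transfer_module D H M Uh"
abbreviation "Y \<equiv> ind_module D H M' V"

lemma V_simps: "hm_carrier V = hm_carrier Uh" "hm_zero V = hm_zero Uh" "hm_add V = hm_add Uh"
  "hm_scale V = hm_scale Uh"
  by (simp_all add: transfer_module_def)

lemma V_act: "n \<in> HP M' \<Longrightarrow> hm_act V n = hm_act Uh (transfer_inv n)"
  by (simp add: transfer_module_def transfer_iso_inv)

lemma module_transfer: "module_over sc (HP M') V"
proof -
  note mod = module_herm_dual[unfolded module_over_def]
  have "complex_space V = complex_space Uh" unfolding complex_space_def V_simps ..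
  moreover have "linear_between V V = linear_between Uh Uh"
    unfolding linear_between_def V_simps ..
  ultimately show ?thesis
    using mod unfolding module_over_def V_simps
    by (simp add: V_act transfer_inv_HP HP_1 HP_add HP_mult HP_scale transfer_inv_1 transfer_inv_add transfer_inv_mult
        transfer_inv_scale)
qed

text \<open>Modules over the whole Hecke algebra are treated as modules over the parabolic subalgebra of all
  simple roots.\<close>

interpretation DU: hecke_module D k H M Uh
  by unfold_locales (rule module_herm_dual)

interpretation IX: hecke_module D k H S X
  by unfold_locales (simp_all add: HP_simple module_induced)

interpretation DX: hecke_module D k H S Xh
  by unfold_locales (rule IX.module_herm_dual)

interpretation IY: hecke_module D k H M' V
  by unfold_locales (simp_all add: M' module_transfer)

interpretation MY: hecke_module D k H S Y
  by unfold_locales (simp_all add: HP_simple IY.module_induced)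

subsection \<open>The functionals supported on one coset\<close>

text \<open>The functional \<open>t\<^sub>x\<^sup>h \<otimes> f\<close>, written with the \<open>x\<close>-coordinate \<open>proj M (T (inv x) * h)\<close> of \<open>h\<close>.
  The formula makes sense for every \<open>x\<close> and is visibly balanced.\<close>

definition dual_at :: "('v \<Rightarrow> 'v) \<Rightarrow> ('u \<Rightarrow> complex) \<Rightarrow> ('h \<times> 'u \<Rightarrow>\<^sub>0 int) set \<Rightarrow> complex" where
  "dual_at x f = descend (\<lambda>h u. f (act (proj M (T (inv x) * h)) u))"

lemma proj_scale: "proj M (sc c h) = sc c (proj M h)"
  by (simp add: sc_eq(2) proj_mult[OF M HP_I])

lemma dual_at_balanced:
  "f \<in> hm_carrier Uh \<Longrightarrow> balanced (\<lambda>h u. f (act (proj M (T (inv x) * h)) u))"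
  by (simp add: balanced_def distrib_left proj_add act_plus proj_HP Uh_add act_C act_add
      proj_mult[OF M] act_mult flip: mult.assoc)

lemma dual_at_ten:
  "f \<in> hm_carrier Uh \<Longrightarrow> u \<in> C \<Longrightarrow> dual_at x f (ten h u) = f (act (proj M (T (inv x) * h)) u)"
  unfolding dual_at_def by (rule descend_ten[OF dual_at_balanced])

lemma dual_at_Xh: "f \<in> hm_carrier Uh \<Longrightarrow> dual_at x f \<in> hm_carrier Xh"
  unfolding dual_at_def
  by (intro descend_Xh dual_at_balanced)
    (simp_all add: sc_mult_right proj_scale act_sc proj_HP Uh_scl act_C)

lemma proj_min_reps:
  assumes "N \<subseteq> S" "x \<in> min_reps D N" "y \<in> min_reps D N"
  shows "proj N (T (inv x) * T y) = (if x = y then 1 else 0)"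
proof -
  have W: "x \<in> W" "y \<in> W" "inv x \<in> W" using assms min_reps_W W_inv by auto
  have eq: "y = x \<circ> (inv x \<circ> y)" using W by (simp flip: comp_assoc)
  have "inv x \<circ> y \<in> WP N \<longleftrightarrow> x = y"
    using coset_unique[OF assms _ eq] eq W by (metis W_inv_comp(1) WP_id comp_id)
  then show ?thesis
    using proj_T_I[OF assms(1) W_comp[OF W(3,2)], of 1] W by (auto simp: T_mult)
qed

lemma dual_at_min_reps:
  "x \<in> min_reps D M \<Longrightarrow> y \<in> min_reps D M \<Longrightarrow> f \<in> hm_carrier Uh \<Longrightarrow> u \<in> C \<Longrightarrow>
    dual_at x f (ten (T y) u) = (if x = y then f u else 0)"
  by (simp add: dual_at_ten proj_min_reps[OF M] act_1 Uh_act_0)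

lemma dual_tensor_eq:
  assumes "x \<in> min_reps D M" "f \<in> hm_carrier Uh" shows "dual_tensor D H M U x f = dual_at x f"
  unfolding dual_tensor_def hecke_star_eq
  by (rule the_equality, use assms in \<open>simp add: dual_at_Xh dual_at_min_reps\<close>,
      rule Xh_ext) (use assms in \<open>auto simp: dual_at_Xh dual_at_min_reps\<close>)

text \<open>The \<open>f\<close> for which \<open>t\<^sub>x\<^sup>h \<otimes> f\<close> occurs in \<open>F\<close>.\<close>

definition component :: "('v \<Rightarrow> 'v) \<Rightarrow> (('h \<times> 'u \<Rightarrow>\<^sub>0 int) set \<Rightarrow> complex) \<Rightarrow> 'u \<Rightarrow> complex" where
  "component x F = (\<lambda>u\<in>C. F (ten (T x) u))"

lemma component_apply: "u \<in> C \<Longrightarrow> component x F u = F (ten (T x) u)"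
  by (simp add: component_def)

lemma component_Uh: "F \<in> hm_carrier Xh \<Longrightarrow> component x F \<in> hm_carrier Uh"
  by (simp add: component_def Uh_iff Xh_iff add_C scl_C ten_X ten_add_right flip: ten_scale)

lemma component_add: "component x (hm_add Xh F G) = hm_add Uh (component x F) (component x G)"
  and component_scale: "component x (hm_scale Xh c F) = hm_scale Uh c (component x F)"
  by (auto simp: component_def Uh_ops Xh_ops ten_X intro!: restrict_ext)

lemma component_dual_at:
  "x \<in> min_reps D M \<Longrightarrow> y \<in> min_reps D M \<Longrightarrow> f \<in> hm_carrier Uh \<Longrightarrow>
    component y (dual_at x f) = (if x = y then f else hm_zero Uh)"
  by (rule Uh_ext[OF component_Uh[OF dual_at_Xh]])
    (simp_all add: DU.zero_C component_apply dual_at_min_reps, simp add: Uh_ops(1))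

lemma Xh_eq_if_components:
  "F \<in> hm_carrier Xh \<Longrightarrow> G \<in> hm_carrier Xh \<Longrightarrow> (\<And>x. x \<in> min_reps D M \<Longrightarrow> component x F = component x G) \<Longrightarrow> F = G"
  by (rule Xh_ext) (auto simp flip: component_apply)

text \<open>Every functional is the sum of the \<open>dual_at x (component x F)\<close>. The sum is taken inside of the
  module, which has no additive type structure, so it is built up by induction on the set of \<open>x\<close> at
  which the components do not vanish.\<close>

lemma Xh_induct [consumes 1, case_names dual_at add]:
  assumes "F \<in> hm_carrier Xh"
    and dual: "\<And>x f. x \<in> min_reps D M \<Longrightarrow> f \<in> hm_carrier Uh \<Longrightarrow> Q (dual_at x f)"
    and add: "\<And>F G. F \<in> hm_carrier Xh \<Longrightarrow> G \<in> hm_carrier Xh \<Longrightarrow> Q F \<Longrightarrow> Q G \<Longrightarrow> Q (hm_add Xh F G)"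
  shows "Q F"
proof -
  have "Q F" if "A \<subseteq> min_reps D M" "F \<in> hm_carrier Xh"
    "\<And>x. x \<in> min_reps D M - A \<Longrightarrow> component x F = hm_zero Uh" for A F
    using finite_subset[OF that(1) finite_min_reps] that
  proof (induction A arbitrary: F)
    case empty
    \<comment> \<open>Any representative would do; the zero functional has to be presented as some \<open>dual_at\<close>.\<close>
    have x: "inv w\<^sub>M \<in> min_reps D M" by (rule inv_w_transfer_min_rep[OF M])
    have "F = dual_at (inv w\<^sub>M) (hm_zero Uh)"
      by (rule Xh_eq_if_components) (use empty x in \<open>simp_all add: dual_at_Xh DU.zero_C component_dual_at\<close>)
    then show ?case using dual[OF x DU.zero_C] by simp
  next
    case (insert x A)
    define f where "f = component x F"
    have x: "x \<in> min_reps D M" "f \<in> hm_carrier Uh" using insert component_Uh f_def by auto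
    define G where "G = hm_add Xh F (hm_scale Xh (- 1) (dual_at x f))"
    have G: "G \<in> hm_carrier Xh"
      unfolding G_def using insert x by (intro DX.add_C DX.scl_C dual_at_Xh)
    have zero: "hm_add Uh g (hm_scale Uh (- 1) g) = hm_zero Uh" "hm_scale Uh c (hm_zero Uh) = hm_zero Uh"
      "hm_add Uh (hm_zero Uh) (hm_zero Uh) = hm_zero Uh" for g c
      by (auto simp: Uh_ops)
    have "component y G = hm_zero Uh" if "y \<in> min_reps D M - A" for y
      using that insert.prems(3)[of y] x
      by (cases "y = x") (auto simp: G_def component_add component_scale component_dual_at zero f_def)
    then have "Q G" using insert G by blast
    then have "Q (hm_add Xh G (dual_at x f))" using add G dual dual_at_Xh x by blast
    moreover have "hm_add Xh G (dual_at x f) = F"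
      using insert.prems(2) Xh_iff DX.add_C[OF G dual_at_Xh[OF x(2)]]
      by (intro extensionalityI[of _ "hm_carrier X"]) (auto simp: G_def Xh_ops)
    ultimately show ?case by simp
  qed
  from this[of "min_reps D M" F] show ?thesis using assms(1) by simp
qed

text \<open>In the formula for \<open>dual_at (inv w) f\<close> the action of \<open>T (x \<circ> w)\<close> multiplies \<open>h\<close> on the left by
  the inverse, which combines with \<open>T w\<close> to \<open>T (inv x)\<close>. So the functionals on the longest coset
  generate the dual.\<close>

lemma dual_at_translate:
  assumes "x \<in> W" "f \<in> hm_carrier Uh"
  shows "hm_act Xh (T (x \<circ> w\<^sub>M)) (dual_at (inv w\<^sub>M) f) = dual_at x f"
proof (rule Xh_ext)
  have xw: "x \<circ> w\<^sub>M \<in> W" using assms w_W W_comp by blast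
  show "hm_act Xh (T (x \<circ> w\<^sub>M)) (dual_at (inv w\<^sub>M) f) \<in> hm_carrier Xh"
    using assms by (intro DX.act_C dual_at_Xh) (simp_all add: HP_simple)
  show "dual_at x f \<in> hm_carrier Xh" using assms by (intro dual_at_Xh)
  fix y u assume "y \<in> min_reps D M" and u: "u \<in> C"
  have "w\<^sub>M \<circ> inv (x \<circ> w\<^sub>M) = inv x" using assms w_W by (simp add: W_inv_o flip: comp_assoc)
  then have "T w\<^sub>M * (T (inv (x \<circ> w\<^sub>M)) * T y) = T (inv x) * T y"
    using T_mult[OF w_W W_inv[OF xw]] by (simp flip: mult.assoc)
  then show "hm_act Xh (T (x \<circ> w\<^sub>M)) (dual_at (inv w\<^sub>M) f) (ten (T y) u) = dual_at x f (ten (T y) u)"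
    using assms u xw w_W by (simp add: Xh_ops ten_X act_ten star_T dual_at_ten)
qed

text \<open>This is \<open>proj_twist\<close> for the element \<open>star n\<close>, which corresponds to \<open>star m\<close> because transfer
  commutes with the star operation.\<close>

lemma dual_at_equivariant:
  assumes "n \<in> HP M'" "f \<in> hm_carrier Uh"
  shows "hm_act Xh n (dual_at (inv w\<^sub>M) f) = dual_at (inv w\<^sub>M) (hm_act V n f)"
proof (rule Xh_ext)
  define m where "m = transfer_inv n"
  have m: "m \<in> HP M" "transfer m = n" using assms transfer_inv_HP transfer_transfer_inv by (simp_all add: m_def)
  have mf: "hm_act Uh m f \<in> hm_carrier Uh" using assms m DU.act_C by blast
  show "hm_act Xh n (dual_at (inv w\<^sub>M) f) \<in> hm_carrier Xh"
    using assms by (intro DX.act_C dual_at_Xh) (simp_all add: HP_simple)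
  show "dual_at (inv w\<^sub>M) (hm_act V n f) \<in> hm_carrier Xh"
    using assms mf by (intro dual_at_Xh) (simp add: V_act m_def)
  fix y u assume "y \<in> min_reps D M" and u: "u \<in> C"
  have "proj M (T w\<^sub>M * (star n * T y)) = star m * proj M (T w\<^sub>M * T y)"
    using proj_twist[OF star_HP[OF M m(1)], of "T y"] star_transfer[OF m(1)] m(2) by simp
  then show "hm_act Xh n (dual_at (inv w\<^sub>M) f) (ten (T y) u)
      = dual_at (inv w\<^sub>M) (hm_act V n f) (ten (T y) u)"
    using assms(2) u w_W mf m
    by (simp add: V_act[OF assms(1)] m_def[symmetric] Xh_ops ten_X act_ten dual_at_ten Uh_ops(4)
        act_mult act_C star_HP[OF M] proj_HP)
qed

subsection \<open>The isomorphism\<close>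

definition Phi :: "(('h \<times> 'u \<Rightarrow>\<^sub>0 int) set \<Rightarrow> complex) \<Rightarrow> ('h \<times> ('u \<Rightarrow> complex) \<Rightarrow>\<^sub>0 int) set" where
  "Phi F = IY.cls (\<Sum>x\<in>min_reps D M. frag_of (T (x \<circ> w\<^sub>M), component x F))"

lemma Phi_Y: "F \<in> hm_carrier Xh \<Longrightarrow> Phi F \<in> hm_carrier Y"
  unfolding Phi_def IY.X_carrier
  by (intro imageI IY.supported_sum IY.supported_closed) (simp add: V_simps component_Uh)

lemma Phi_add: "F \<in> hm_carrier Xh \<Longrightarrow> G \<in> hm_carrier Xh \<Longrightarrow> Phi (hm_add Xh F G) = hm_add Y (Phi F) (Phi G)"
  unfolding Phi_def IY.X_add sum.distrib[symmetric]
  using IY.cls_frag_add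
  by (intro IY.cls_sum_cong) (simp add: V_simps component_add component_Uh)

lemma Phi_scale: "F \<in> hm_carrier Xh \<Longrightarrow> Phi (hm_scale Xh c F) = hm_scale Y c (Phi F)"
  unfolding Phi_def IY.X_scale IY.X_act IY.left_mult_sum
  using IY.cls_frag_scale
  by (intro IY.cls_sum_cong) (simp add: V_simps component_scale component_Uh)

lemma Phi_dual_at:
  assumes "x \<in> min_reps D M" "f \<in> hm_carrier Uh"
  shows "Phi (dual_at x f) = IY.ten (T (x \<circ> w\<^sub>M)) f"
proof -
  have "Phi (dual_at x f) = IY.cls (\<Sum>y\<in>min_reps D M. if y = x then frag_of (T (x \<circ> w\<^sub>M), f) else 0)"
    unfolding Phi_def
    using assms IY.cls_frag_zero by (intro IY.cls_sum_cong) (auto simp: component_dual_at V_simps)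
  then show ?thesis using assms finite_min_reps by (simp add: tensor_def)
qed

lemma Phi_is_Phi: "is_Phi D H M U Phi"
  unfolding is_Phi_def Let_def hecke_star_eq linear_between_def
  by (intro conjI ballI allI Phi_Y Phi_add Phi_scale) (simp_all add: dual_tensor_eq Phi_dual_at)

text \<open>The prescribed values determine the map, so it suffices to study \<open>Phi\<close>.\<close>

lemma is_Phi_eq:
  assumes "is_Phi D H M U \<Phi>" "F \<in> hm_carrier Xh" shows "\<Phi> F = Phi F"
proof -
  note p = assms(1)[unfolded is_Phi_def Let_def hecke_star_eq linear_between_def]
  show ?thesis
    using assms(2)
  proof (induction rule: Xh_induct)
    case (dual_at x f)
    then have "\<Phi> (dual_tensor D H M U x f) = IY.ten (T (x \<circ> w\<^sub>M)) f" using p by blast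
    then show ?case using dual_at by (simp add: dual_tensor_eq Phi_dual_at)
  next
    case (add F G)
    then have "\<Phi> (hm_add Xh F G) = hm_add Y (\<Phi> F) (\<Phi> G)" using p by blast
    then show ?case using add by (simp add: Phi_add)
  qed
qed

text \<open>Additivity in \<open>g\<close> reduces this to \<open>g = t\<^sub>y n\<close> with \<open>n\<close> in the transferred parabolic subalgebra.
  There \<open>n\<close> passes from the functional to \<open>f\<close> by \<open>dual_at_equivariant\<close>, and from \<open>g\<close> to \<open>f\<close> on the
  other side by balancedness.\<close>

lemma Phi_generated:
  assumes "f \<in> hm_carrier Uh"
  shows "Phi (hm_act Xh g (dual_at (inv w\<^sub>M) f)) = IY.ten g f"
proof (induction g rule: hecke_induct)
  case (T_I v a)
  obtain y m where ym: "y \<in> min_reps D M'" "m \<in> WP M'" "v = y \<circ> m"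
    using coset_decomposition[OF M' T_I] by metis
  then have W: "y \<in> W" "m \<in> W" and n: "T m * I a \<in> HP M'"
    using min_reps_W WP_W M' HP_mult HP_T HP_I by auto
  obtain x where x: "x \<in> min_reps D M" "y = x \<circ> w\<^sub>M"
    using ym(1) min_reps_transfer[OF M] by (auto simp: bij_betw_def)
  have nf: "hm_act V (T m * I a) f \<in> hm_carrier Uh"
    using IY.act_C[OF n] assms by (simp add: V_simps)
  have g: "T v * I a = T y * (T m * I a)" using ym W by (simp add: T_mult flip: mult.assoc)
  have "hm_act Xh (T v * I a) (dual_at (inv w\<^sub>M) f)
      = hm_act Xh (T y) (hm_act Xh (T m * I a) (dual_at (inv w\<^sub>M) f))"
    unfolding g using assms by (intro DX.act_mult dual_at_Xh) (simp_all add: HP_simple)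
  also have "\<dots> = dual_at x (hm_act V (T m * I a) f)"
    unfolding dual_at_equivariant[OF n assms] x(2) using x min_reps_W nf
    by (intro dual_at_translate) auto
  finally have "Phi (hm_act Xh (T v * I a) (dual_at (inv w\<^sub>M) f)) = IY.ten (T y) (hm_act V (T m * I a) f)"
    using Phi_dual_at[OF x(1) nf] x(2) by simp
  also have "\<dots> = IY.ten (T v * I a) f"
    unfolding g using IY.ten_balanced[OF _ n, of f] assms by (simp add: V_simps)
  finally show ?case .
next
  case (add g h)
  have "hm_act Xh (g + h) (dual_at (inv w\<^sub>M) f)
      = hm_add Xh (hm_act Xh g (dual_at (inv w\<^sub>M) f)) (hm_act Xh h (dual_at (inv w\<^sub>M) f))"
    using assms by (intro DX.act_plus dual_at_Xh) (simp_all add: HP_simple)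
  then show ?case
    using assms add IY.ten_add_left[of f g h]
    by (simp add: Phi_add DX.act_C HP_simple dual_at_Xh V_simps)
qed

lemma Phi_equivariant:
  assumes "F \<in> hm_carrier Xh" shows "Phi (hm_act Xh h F) = hm_act Y h (Phi F)"
  using assms
proof (induction rule: Xh_induct)
  case (dual_at x f)
  let ?g = "T (x \<circ> w\<^sub>M)"
  have x: "x \<in> W" using dual_at min_reps_W by blast
  have "hm_act Xh h (dual_at x f) = hm_act Xh (h * ?g) (dual_at (inv w\<^sub>M) f)"
    using DX.act_mult[of h ?g "dual_at (inv w\<^sub>M) f"] dual_at
    by (simp add: HP_simple dual_at_Xh dual_at_translate[OF x])
  then show ?case
    using dual_at by (simp add: Phi_generated Phi_dual_at IY.act_ten)
next
  case (add F G)
  then show ?case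
    using DX.act_add[of h F G] MY.act_add[of h "Phi F" "Phi G"] Phi_Y
    by (simp add: HP_simple Phi_add DX.act_C)
qed

text \<open>The components of \<open>F\<close> are recovered from \<open>Phi F\<close> by the coordinate functionals of the target,
  composed with the evaluations at vectors of \<open>U\<close>.\<close>

lemma Phi_inj: "inj_on Phi (hm_carrier Xh)"
proof (rule inj_onI)
  fix F G assume FG: "F \<in> hm_carrier Xh" "G \<in> hm_carrier Xh" "Phi F = Phi G"
  have comp: "IY.descend (\<lambda>h v. hm_act V (proj M' (T (inv (x \<circ> w\<^sub>M)) * h)) v u) (Phi F) = component x F u"
    if x: "x \<in> min_reps D M" and u: "u \<in> C" and F: "F \<in> hm_carrier Xh" for x u F
  proof -
    let ?\<psi> = "\<lambda>h v. hm_act V (proj M' (T (inv (x \<circ> w\<^sub>M)) * h)) v u"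
    have b: "IY.balanced ?\<psi>"
      unfolding IY.balanced_def distrib_left proj_add mult.assoc[symmetric]
      by (simp add: proj_mult[OF M'] IY.act_plus IY.act_add IY.act_mult proj_HP)
        (simp add: V_simps Uh_ops u)
    have rep: "y \<circ> w\<^sub>M \<in> min_reps D M'" if "y \<in> min_reps D M" for y
      using min_reps_transfer[OF M] that by (auto simp: bij_betw_def)
    have cancel: "y = x" if "x \<circ> w\<^sub>M = y \<circ> w\<^sub>M" for y
      using w_W that by (metis W_inv_comp(2) comp_assoc comp_id)
    have c: "component y F \<in> IY.C" for y using component_Uh[OF F] by (simp add: V_simps)
    have zero: "hm_act V 0 v u = 0" if "v \<in> IY.C" for v
    proof -
      have "hm_act V 0 v = hm_scale V 0 (hm_act V 1 v)"
        using IY.act_sc[OF HP_1 that, of 0] by (simp add: sc_eq(1))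
      then show ?thesis using u by (simp add: V_simps Uh_ops)
    qed
    have "IY.descend ?\<psi> (Phi F) = (\<Sum>y\<in>min_reps D M. ?\<psi> (T (y \<circ> w\<^sub>M)) (component y F))"
      unfolding Phi_def using c
      by (subst IY.descend_cls[OF b]) (auto intro!: IY.supported_sum IY.supported_closed simp: IY.eval_frag_sum IY.eval_frag_of)
    also have "\<dots> = (\<Sum>y\<in>min_reps D M. if y = x then component x F u else 0)"
      using cancel c zero IY.act_1
      by (intro sum.cong) (auto simp: proj_min_reps[OF M' rep[OF x] rep])
    also have "\<dots> = component x F u" using x finite_min_reps by simp
    finally show ?thesis .
  qed
  show "F = G"
  proof (rule Xh_eq_if_components[OF FG(1,2)])
    fix x assume x: "x \<in> min_reps D M"
    show "component x F = component x G"
      using comp[OF x _ FG(1)] comp[OF x _ FG(2)] FG component_Uh by (intro Uh_ext) auto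
  qed
qed

lemma Phi_surj: "Phi ` hm_carrier Xh = hm_carrier Y"
proof (intro equalityI subsetI)
  fix Z assume "Z \<in> hm_carrier Y"
  then show "Z \<in> Phi ` hm_carrier Xh"
  proof (induction rule: IY.X_induct)
    case (ten y f)
    then obtain x where x: "x \<in> min_reps D M" "y = x \<circ> w\<^sub>M"
      using min_reps_transfer[OF M] by (auto simp: bij_betw_def)
    have f: "f \<in> hm_carrier Uh" using ten by (simp add: V_simps)
    show ?case
      using Phi_dual_at[OF x(1) f] dual_at_Xh[OF f, of x] x(2) by (metis image_eqI)
  next
    case (add Z Z')
    then obtain F F' where "F \<in> hm_carrier Xh" "F' \<in> hm_carrier Xh" "Z = Phi F" "Z' = Phi F'" by blast
    then show ?case using Phi_add[of F F'] DX.add_C[of F F'] by (metis image_eqI)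
  qed
qed (use Phi_Y in blast)

theorem Phi_exists_and_iso:
  "(\<exists>\<Phi>. is_Phi D H M U \<Phi>) \<and> (\<forall>\<Phi>. is_Phi D H M U \<Phi> \<longrightarrow> equivariant_iso UNIV Xh Y \<Phi>)"
proof (intro conjI allI impI)
  show "\<exists>\<Phi>. is_Phi D H M U \<Phi>" using Phi_is_Phi by blast
  fix \<Phi> assume p: "is_Phi D H M U \<Phi>"
  have "linear_between Xh Y \<Phi>" using p by (simp add: is_Phi_def Let_def hecke_star_eq)
  moreover have "bij_betw \<Phi> (hm_carrier Xh) (hm_carrier Y)"
    using Phi_inj Phi_surj is_Phi_eq[OF p] by (simp add: bij_betw_def cong: inj_on_cong image_cong)
  moreover have "\<Phi> (hm_act Xh h F) = hm_act Y h (\<Phi> F)" if "F \<in> hm_carrier Xh" for h F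
    using is_Phi_eq[OF p] that Phi_equivariant[OF that] DX.act_C[of h F] by (simp add: HP_simple)
  ultimately show "equivariant_iso UNIV Xh Y \<Phi>" by (simp add: equivariant_iso_def)
qed

end

theorem theorem3p6p5:
  fixes D :: "('v::real_vector, 'w::real_vector) root_data"
    and k :: "'v \<Rightarrow> real"
    and H :: "('v, 'h::ring_1) hecke_data"
    and M :: "'v set"
    and \<sigma> :: "('h, 'u) hmodule"
  assumes "reduced_root_data D"
    and "parameter_function D k"
    and "graded_hecke_algebra D k H"
    and "M \<subseteq> rd_simple D"
    and "module_over (ha_scale H) (hecke_par D H M) \<sigma>"
    and "finite_dimensional \<sigma>"
  shows "(\<exists>\<Phi>. is_Phi D H M \<sigma> \<Phi>) \<and>
    (\<forall>\<Phi>. is_Phi D H M \<sigma> \<Phi> \<longrightarrow>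
      equivariant_iso UNIV
        (herm_dual (hecke_star D H) (ind_module D H M \<sigma>))
        (ind_module D H (delta_par D M) (transfer_module D H M (herm_dual (hecke_star D H) \<sigma>)))
        \<Phi>)"
proof -
  interpret hecke_module D k H M \<sigma>
    by unfold_locales (rule assms)+
  show ?thesis unfolding hecke_star_eq by (rule Phi_exists_and_iso)
qed

end
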